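(* Let $n > 2$ and $f_{\alpha\beta}(x, t)$, $2 \leq \alpha, \beta \leq n$, be real-analytic, real-valued functions in a connected open subset $U \times V \subset \mathbb{R}^n \times (\mathbb{R} \setminus \{0\})$. Then the following two conditions are equivalent: (i) For any $x_0 = (x_0^1, \dots, x_0^n) \in U$ and any real-valued, real-analytic functions $a(x^1)$, $a_2(x^1), \dots, a_n(x^1)$ in a neighborhood of $x_0^1$ in $\mathbb{R}$ such that $a''(x_0^1) \in V$, there exists a unique real-valued, real-analytic solution $u(x)$ in a neighborhood of $x_0$ to the Cauchy problem $$\begin{cases} \Delta_{\alpha\beta}(u) = f_{\alpha\beta}(x, u_{11}), \\ u(x^1, x_0^2, \dots, x_0^n) = a(x^1), \quad u_\alpha(x^1, x_0^2, \dots, x_0^n) = a_\alpha(x^1), \end{cases} \quad \alpha, \beta = 2, \dots, n.$$ (ii) The functions $f_{\alpha\beta}$ are of the form $f_{\alpha\beta}(x, t) = g_{\alpha\beta}(x)t$ with $g_{\alpha\beta}$ satisfying the compatibility conditions $$g_{\alpha\beta} = g_{\beta\alpha}, \quad \partial_{x^1} g_{\alpha\beta} = 0, \quad \partial_{x^\gamma} g_{\alpha\beta} = \partial_{x^\beta} g_{\alpha\gamma}, \quad \alpha, \beta, \gamma = 2, \dots, n.$$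
   Context: Coordinates $x=(x^1,\dots,x^n)$ on $\mathbb{R}^n$. For a function $u(x)$, $u_i = \partial u/\partial x^i$, $u_{ij} = \partial^2 u/\partial x^i \partial x^j$. For $2 \leq \alpha,\beta \leq n$, $\Delta_{\alpha\beta}(u) := \det \begin{pmatrix} u_{11} & u_{1\beta} \\ u_{\alpha 1} & u_{\alpha\beta} \end{pmatrix}$. *)

theory Defs
  imports "HOL-Analysis.Analysis"
begin

text \<open>Real-analyticity of a real-valued function on a Euclidean space: near every point
  of S the function is the sum of an (unconditionally, i.e. absolutely) convergent
  multivariate power series centred at that point. Multi-indices are functions
  Basis -> nat (zero outside the basis).\<close>
definition real_analytic_on :: "('a::euclidean_space \<Rightarrow> real) \<Rightarrow> 'a set \<Rightarrow> bool" where
  "real_analytic_on f S \<longleftrightarrow>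
     (\<forall>x0\<in>S. \<exists>r>0. \<exists>c :: ('a \<Rightarrow> nat) \<Rightarrow> real.
        \<forall>x\<in>ball x0 r.
          ((\<lambda>m. c m * (\<Prod>b\<in>Basis. (inner (x - x0) b) ^ m b)) has_sum f x)
            {m. \<forall>b. b \<notin> Basis \<longrightarrow> m b = 0})"

definition pd :: "'n::finite \<Rightarrow> (real^'n \<Rightarrow> real) \<Rightarrow> real^'n \<Rightarrow> real" where
  "pd i u x = deriv (\<lambda>t. u (x + t *\<^sub>R axis i 1)) 0"

text \<open>Delta_{ab}(u) = u_{11} u_{ab} - u_{1b} u_{a1}, where k1 is the distinguished first coordinate.\<close>
definition Delta :: "'n::finite \<Rightarrow> 'n \<Rightarrow> 'n \<Rightarrow> (real^'n \<Rightarrow> real) \<Rightarrow> real^'n \<Rightarrow> real" where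
  "Delta k1 a b u x =
     pd k1 (pd k1 u) x * pd a (pd b u) x - pd k1 (pd b u) x * pd a (pd k1 u) x"

definition cauchy_solution ::
  "'n::finite \<Rightarrow> ('n \<Rightarrow> 'n \<Rightarrow> (real^'n) \<times> real \<Rightarrow> real) \<Rightarrow> (real^'n) set \<Rightarrow> real set \<Rightarrow>
   real^'n \<Rightarrow> real set \<Rightarrow> (real \<Rightarrow> real) \<Rightarrow> ('n \<Rightarrow> real \<Rightarrow> real) \<Rightarrow>
   (real^'n \<Rightarrow> real) \<Rightarrow> (real^'n) set \<Rightarrow> bool" where
  "cauchy_solution k1 f U V x0 I a A u W \<longleftrightarrow>
     open W \<and> x0 \<in> W \<and> W \<subseteq> U \<and> real_analytic_on u W \<and>
     (\<forall>x\<in>W. pd k1 (pd k1 u) x \<in> V \<and>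
        (\<forall>\<alpha> \<beta>. \<alpha> \<noteq> k1 \<longrightarrow> \<beta> \<noteq> k1 \<longrightarrow>
            Delta k1 \<alpha> \<beta> u x = f \<alpha> \<beta> (x, pd k1 (pd k1 u) x))) \<and>
     (\<forall>x\<in>W. (\<forall>\<beta>. \<beta> \<noteq> k1 \<longrightarrow> x$\<beta> = x0$\<beta>) \<longrightarrow>
        x$k1 \<in> I \<and> u x = a (x$k1) \<and>
        (\<forall>\<alpha>. \<alpha> \<noteq> k1 \<longrightarrow> pd \<alpha> u x = A \<alpha> (x$k1)))"

end

theory Submission
  imports Defs
begin

text \<open>Convergent power series with the norm \<open>\<Sum>m. \<bar>c m\<bar> * r ^ deg m\<close> form a Banach algebra; closure of
  analytic functions under composition, differentiation and fixed points becomes a norm estimate.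

  Sufficiency: the compatibility conditions say that \<open>g\<close> is locally the Hessian of a function \<open>H\<close>
  of the remaining coordinates, and \<open>u - H\<close> then has Hessian of rank one. The graph of such a function
  is the envelope of a one-parameter family of hyperplanes, which the Cauchy data prescribe.
  Conversely the gradient of any solution is constant along the characteristic hyperplanes, which
  gives uniqueness.

  Necessity: for quadratic data the values of \<open>u_{1\<alpha>}\<close> and \<open>u_{11\<alpha>}\<close> at \<open>x0\<close> are arbitrary, and
  equality of the third derivatives \<open>u_{\<alpha>\<beta>\<gamma>} = u_{\<alpha>\<gamma>\<beta>}\<close> with \<open>\<beta> \<noteq> \<gamma>\<close> forces the derivatives of
  \<open>f_{\<alpha>\<beta>}(x, t) / t\<close> in \<open>t\<close> and in the first coordinate to vanish.\<close>

section \<open>Power series on cubes\<close>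

text \<open>The system is overdetermined: (n - 1)^2 equations for one unknown. The solution is
  therefore written down explicitly, and the only equation left to solve is the implicit one for the
  hyperplane parameter. With h = f / t, the equations read u_{\<alpha>\<beta>} =
  h_{\<alpha>\<beta>}(x, u_11) + u_{1\<alpha>} u_{1\<beta>} / u_11. In u_{\<alpha>\<beta>\<gamma>} =
  u_{\<alpha>\<gamma>\<beta>} the terms with u_{1\<beta>\<gamma>} cancel, and what remains at x0 is
  polynomial in the freely chosen numbers u_{1i} and u_{11i}. An index \<gamma> different from both
  the first index and \<beta> isolates single coefficients; its existence is where n > 2 enters. In
  the other direction g is extended by zero to the first index. Independence of the first coordinate
  then becomes one more case of closedness, and the potential H vanishes together with its gradient
  along the initial line, so adding it leaves the Cauchy data unchanged.\<close>

definition midx :: "('a::euclidean_space \<Rightarrow> nat) set" where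
  "midx = {m. \<forall>b. b \<notin> Basis \<longrightarrow> m b = 0}"

definition mdeg :: "('a::euclidean_space \<Rightarrow> nat) \<Rightarrow> nat" where
  "mdeg m = (\<Sum>b\<in>Basis. m b)"

definition monomial :: "('a::euclidean_space \<Rightarrow> nat) \<Rightarrow> 'a \<Rightarrow> real" where
  "monomial m x = (\<Prod>b\<in>Basis. (x \<bullet> b) ^ m b)"

text \<open>A sup-norm ball rather than a Euclidean one: on it a monomial is at most
  \<open>r ^ mdeg m\<close>, with equality at the corner. Convergence at that single point therefore
  controls the norm at radius \<open>r\<close>.\<close>

definition cube :: "real \<Rightarrow> 'a::euclidean_space set" where
  "cube r = {x. \<forall>b\<in>Basis. \<bar>x \<bullet> b\<bar> \<le> r}"

text \<open>A bound \<open>K\<close> on the norm at radius \<open>r\<close> of a power series with sum \<open>f\<close>, centred at the origin.\<close>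

definition psb :: "real \<Rightarrow> ('a::euclidean_space \<Rightarrow> real) \<Rightarrow> real \<Rightarrow> bool" where
  "psb r f K \<longleftrightarrow> (\<exists>c N. N \<le> K \<and> ((\<lambda>m. \<bar>c m\<bar> * r ^ mdeg m) has_sum N) midx \<and>
     (\<forall>x\<in>cube r. ((\<lambda>m. c m * monomial m x) has_sum f x) midx))"

lemma psbI:
  assumes "((\<lambda>m. \<bar>c m\<bar> * r ^ mdeg m) has_sum N) midx" "N \<le> K"
    and "\<And>x. x \<in> cube r \<Longrightarrow> ((\<lambda>m. c m * monomial m x) has_sum f x) midx"
  shows "psb r f K"
  using assms unfolding psb_def by blast

lemma zero_in_midx [simp]: "(\<lambda>_. 0) \<in> midx"
  by (simp add: midx_def)

lemma monomial_zero_index [simp]: "monomial (\<lambda>_. 0) x = 1"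
  by (simp add: monomial_def)

lemma mdeg_zero_index [simp]: "mdeg (\<lambda>_. 0) = 0"
  by (simp add: mdeg_def)

lemma zero_in_cube [simp]: "0 \<le> r \<Longrightarrow> 0 \<in> cube r"
  by (simp add: cube_def)

lemma cube_mono: "x \<in> cube r \<Longrightarrow> r \<le> s \<Longrightarrow> x \<in> cube s"
  by (force simp: cube_def)

lemma ball_subset_cube: "ball (0::'a::euclidean_space) r \<subseteq> cube r"
proof
  fix x :: 'a assume "x \<in> ball 0 r"
  then show "x \<in> cube r"
    using Basis_le_norm[of _ x] by (force simp: cube_def)
qed

lemma monomial_bound:
  assumes "x \<in> cube r"
  shows "\<bar>monomial m x\<bar> \<le> r ^ mdeg m"
proof -
  have "\<bar>monomial m x\<bar> = (\<Prod>b\<in>Basis. \<bar>x \<bullet> b\<bar> ^ m b)"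
    by (simp add: monomial_def abs_prod power_abs)
  also have "\<dots> \<le> (\<Prod>b\<in>Basis. r ^ m b)"
    using assms by (intro prod_mono) (auto simp: cube_def intro!: power_mono)
  also have "\<dots> = r ^ mdeg m"
    by (simp add: mdeg_def power_sum)
  finally show ?thesis .
qed

lemma monomial_corner: "monomial m (\<Sum>b\<in>Basis. r *\<^sub>R b) = r ^ mdeg m"
  by (simp add: monomial_def mdeg_def power_sum inner_sum_left_Basis)

lemma mdeg_upd:
  assumes "b \<in> Basis"
  shows "mdeg (m(b := k)) + m b = mdeg m + k"
  using assms by (simp add: mdeg_def sum.remove[of Basis b])

lemma monomial_remove:
  assumes "b \<in> Basis"
  shows "monomial m x = (x \<bullet> b) ^ m b * (\<Prod>b'\<in>Basis - {b}. (x \<bullet> b') ^ m b')"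
  using assms by (simp add: monomial_def prod.remove[of Basis b])

lemma monomial_upd_Suc:
  assumes "b \<in> Basis"
  shows "monomial (m(b := Suc (m b))) x = (x \<bullet> b) * monomial m x"
proof -
  have "(\<Prod>b'\<in>Basis - {b}. (x \<bullet> b') ^ (m(b := Suc (m b))) b') = (\<Prod>b'\<in>Basis - {b}. (x \<bullet> b') ^ m b')"
    by (rule prod.cong) auto
  then show ?thesis
    by (simp add: monomial_remove[OF assms])
qed

lemma psb_mono: "psb r f K \<Longrightarrow> K \<le> L \<Longrightarrow> psb r f L"
  unfolding psb_def by (meson order_trans)

lemma psb_cong:
  assumes "psb r f K" "\<And>x. x \<in> cube r \<Longrightarrow> f x = g x"
  shows "psb r g K"
  using assms unfolding psb_def by auto

lemma psb_shrink:
  assumes "psb r f K" "0 \<le> s" "s \<le> r"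
  shows "psb s f K"
proof -
  obtain c N where c: "((\<lambda>m. \<bar>c m\<bar> * r ^ mdeg m) has_sum N) midx" "N \<le> K"
    "\<And>x. x \<in> cube r \<Longrightarrow> ((\<lambda>m. c m * monomial m x) has_sum f x) midx"
    using assms(1) unfolding psb_def by blast
  have le: "\<bar>c m\<bar> * s ^ mdeg m \<le> \<bar>c m\<bar> * r ^ mdeg m" for m
    using assms by (intro mult_left_mono power_mono) auto
  have "(\<lambda>m. \<bar>c m\<bar> * s ^ mdeg m) summable_on midx"
    using assms le by (intro summable_on_comparison_test[OF has_sum_imp_summable[OF c(1)]]) auto
  then obtain M where M: "((\<lambda>m. \<bar>c m\<bar> * s ^ mdeg m) has_sum M) midx"
    by (auto simp: summable_on_def)
  show ?thesis
  proof (rule psbI[OF M])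
    show "M \<le> K"
      using has_sum_mono[OF M c(1) le] c(2) by simp
  qed (use c(3) cube_mono assms(3) in blast)
qed

lemma psb_bound:
  assumes "psb r f K" "x \<in> cube r"
  shows "\<bar>f x\<bar> \<le> K"
proof -
  obtain c N where c: "((\<lambda>m. \<bar>c m\<bar> * r ^ mdeg m) has_sum N) midx" "N \<le> K"
    "\<And>x. x \<in> cube r \<Longrightarrow> ((\<lambda>m. c m * monomial m x) has_sum f x) midx"
    using assms(1) unfolding psb_def by blast
  have "\<bar>c m * monomial m x\<bar> \<le> \<bar>c m\<bar> * r ^ mdeg m" for m
    by (simp add: abs_mult mult_left_mono monomial_bound assms(2))
  then have up: "c m * monomial m x \<le> \<bar>c m\<bar> * r ^ mdeg m"
    and lo: "- (\<bar>c m\<bar> * r ^ mdeg m) \<le> c m * monomial m x" for m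
    by (simp_all add: abs_le_iff minus_le_iff)
  show ?thesis
    using has_sum_mono[OF c(3)[OF assms(2)] c(1) up] c(2)
      has_sum_mono[OF has_sum_uminusI[OF c(1)] c(3)[OF assms(2)] lo] by linarith
qed

lemma psb_nonneg: "psb r f K \<Longrightarrow> 0 \<le> r \<Longrightarrow> 0 \<le> K"
  using psb_bound[of r f K 0] by fastforce

lemma psb_const: "psb r (\<lambda>_. a) \<bar>a\<bar>"
proof (rule psbI)
  let ?c = "\<lambda>m. if m = (\<lambda>_. 0) then a else 0"
  show "((\<lambda>m. \<bar>?c m\<bar> * r ^ mdeg m) has_sum \<bar>a\<bar>) midx"
    by (rule has_sum_finite_neutralI[of "{\<lambda>_. 0}"]) auto
  show "((\<lambda>m. ?c m * monomial m x) has_sum a) midx" for x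
    by (rule has_sum_finite_neutralI[of "{\<lambda>_. 0}"]) auto
qed auto

text \<open>Raising the exponent of \<open>b\<close> by one is injective on multi-indices and misses
  exactly those with exponent 0 at \<open>b\<close>, where \<open>F\<close> vanishes.\<close>

lemma has_sum_shift_index:
  fixes F :: "('a::euclidean_space \<Rightarrow> nat) \<Rightarrow> real"
  assumes b: "b \<in> Basis" and F: "((\<lambda>m. F (m(b := Suc (m b)))) has_sum S) midx"
    and z: "\<And>m. m b = 0 \<Longrightarrow> F m = 0"
  shows "(F has_sum S) midx"
proof -
  let ?h = "\<lambda>m::'a \<Rightarrow> nat. m(b := Suc (m b))"
  have inj: "inj_on ?h midx"
  proof (rule inj_onI)
    fix m m' :: "'a \<Rightarrow> nat" assume eq: "?h m = ?h m'"
    show "m = m'"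
    proof
      fix x show "m x = m' x"
        using fun_cong[OF eq, of x] by (cases "x = b") auto
    qed
  qed
  have "(F has_sum S) (?h ` midx)"
    using F by (simp add: has_sum_reindex[OF inj] o_def)
  also have "?this \<longleftrightarrow> (F has_sum S) midx"
  proof (rule has_sum_cong_neutral)
    fix m assume m: "m \<in> midx - ?h ` midx"
    show "F m = 0"
    proof (cases "m b = 0")
      case False
      then have "m = ?h (m(b := m b - 1))" by auto
      moreover have "m(b := m b - 1) \<in> midx"
        using m by (auto simp: midx_def)
      ultimately show ?thesis using m by blast
    qed (rule z)
  next
    fix m assume m: "m \<in> ?h ` midx - midx"
    then show "F m = 0" using b by (auto simp: midx_def split: if_splits)
  qed auto
  finally show ?thesis .
qed

lemma psb_coord_mult:
  assumes f: "psb r f K" and r: "0 \<le> r" and b: "b \<in> Basis"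
  shows "psb r (\<lambda>x. (x \<bullet> b) * f x) (r * K)"
proof -
  obtain c N where c: "((\<lambda>m. \<bar>c m\<bar> * r ^ mdeg m) has_sum N) midx" "N \<le> K"
    "\<And>x. x \<in> cube r \<Longrightarrow> ((\<lambda>m. c m * monomial m x) has_sum f x) midx"
    using f unfolding psb_def by blast
  \<comment> \<open>The coefficients of the product with the coordinate. Exponent 0 needs its own
    case: truncated subtraction would return \<open>c m\<close> there.\<close>
  define d where "d m = (if m b = 0 then 0 else c (m(b := m b - 1)))" for m
  have d_Suc [simp]: "d (m(b := Suc (m b))) = c m" for m
    by (simp add: d_def)
  have deg: "mdeg (m(b := Suc (m b))) = Suc (mdeg m)" for m
    using mdeg_upd[OF b, of m "Suc (m b)"] by simp
  show ?thesis
  proof (rule psbI)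
    show "((\<lambda>m. \<bar>d m\<bar> * r ^ mdeg m) has_sum r * N) midx"
    proof (rule has_sum_shift_index[OF b])
      show "((\<lambda>m. \<bar>d (m(b := Suc (m b)))\<bar> * r ^ mdeg (m(b := Suc (m b)))) has_sum r * N) midx"
        using has_sum_cmult_right[OF c(1), of r] by (simp add: deg mult_ac)
    qed (simp add: d_def)
    show "r * N \<le> r * K" using c(2) r by (rule mult_left_mono)
    fix x :: 'a assume x: "x \<in> cube r"
    show "((\<lambda>m. d m * monomial m x) has_sum (x \<bullet> b) * f x) midx"
    proof (rule has_sum_shift_index[OF b])
      show "((\<lambda>m. d (m(b := Suc (m b))) * monomial (m(b := Suc (m b))) x) has_sum (x \<bullet> b) * f x) midx"
        using has_sum_cmult_right[OF c(3)[OF x], of "x \<bullet> b"] by (simp add: monomial_upd_Suc[OF b] mult_ac)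
    qed (simp add: d_def)
  qed
qed

section \<open>Completeness of the norm and the algebra operations\<close>

lemma psb_cmult:
  assumes f: "psb r f K"
  shows "psb r (\<lambda>x. a * f x) (\<bar>a\<bar> * K)"
proof -
  obtain c N where c: "((\<lambda>m. \<bar>c m\<bar> * r ^ mdeg m) has_sum N) midx" "N \<le> K"
    "\<And>x. x \<in> cube r \<Longrightarrow> ((\<lambda>m. c m * monomial m x) has_sum f x) midx"
    using f unfolding psb_def by blast
  show ?thesis
  proof (rule psbI)
    show "((\<lambda>m. \<bar>a * c m\<bar> * r ^ mdeg m) has_sum \<bar>a\<bar> * N) midx"
      using has_sum_cmult_right[OF c(1), of "\<bar>a\<bar>"] by (simp add: abs_mult mult_ac)
    show "\<bar>a\<bar> * N \<le> \<bar>a\<bar> * K" using c(2) by (simp add: mult_left_mono)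
    show "((\<lambda>m. a * c m * monomial m x) has_sum a * f x) midx" if "x \<in> cube r" for x
      using has_sum_cmult_right[OF c(3)[OF that], of a] by (simp add: mult_ac)
  qed
qed

text \<open>Completeness: a series of power series whose norm bounds are summable is again a power
  series. Products, substitutions, reciprocals, termwise derivatives and the fixed point below are
  all obtained from it.\<close>

lemma psb_has_sum:
  fixes f :: "'j \<Rightarrow> 'a::euclidean_space \<Rightarrow> real"
  assumes r: "0 < r" and f: "\<And>j. j \<in> J \<Longrightarrow> psb r (f j) (K j)" and K: "(K has_sum L) J"
    and g: "\<And>x. x \<in> cube r \<Longrightarrow> ((\<lambda>j. f j x) has_sum g x) J"
  shows "psb r g L"
proof -
  define A where "A j c N \<longleftrightarrow> N \<le> K j \<and> ((\<lambda>m. \<bar>c m\<bar> * r ^ mdeg m) has_sum N) midx \<and>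
     (\<forall>x\<in>cube r. ((\<lambda>m. c m * monomial m x) has_sum f j x) midx)" for j c N
  have "\<forall>j\<in>J. \<exists>c. \<exists>N. A j c N"
    using f unfolding psb_def A_def by blast
  then obtain c where "\<forall>j\<in>J. \<exists>N. A j (c j) N"
    using bchoice[of J "\<lambda>j c. \<exists>N. A j c N"] by blast
  then obtain N where "\<forall>j\<in>J. A j (c j) (N j)"
    using bchoice[of J "\<lambda>j N. A j (c j) N"] by blast
  then have cN: "\<And>j. j \<in> J \<Longrightarrow> N j \<le> K j"
    "\<And>j. j \<in> J \<Longrightarrow> ((\<lambda>m. \<bar>c j m\<bar> * r ^ mdeg m) has_sum N j) midx"
    "\<And>j x. j \<in> J \<Longrightarrow> x \<in> cube r \<Longrightarrow> ((\<lambda>m. c j m * monomial m x) has_sum f j x) midx"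
    by (simp_all add: A_def)
  have N0: "0 \<le> N j" if "j \<in> J" for j
    using cN(2)[OF that] by (rule has_sum_nonneg) (use r in auto)
  have "N summable_on J"
    using cN(1) N0 by (intro summable_on_comparison_test[OF has_sum_imp_summable[OF K]]) auto
  then obtain S where S: "(N has_sum S) J" by (auto simp: summable_on_def)
  have SL: "S \<le> L" using has_sum_mono[OF S K cN(1)] .
  \<comment> \<open>The terms are nonnegative, so the double series may be summed in either order.
    Summing over \<open>j\<close> first gives the coefficients \<open>d m\<close> of the limit, and
    \<open>P\<close> then dominates the signed double series at every point of the cube.\<close>
  define P where "P = (\<lambda>(j, m). \<bar>c j m\<bar> * r ^ mdeg m)"
  have Psum: "P summable_on J \<times> midx"
    by (rule summable_on_SigmaI[where g = N])
      (use cN(2) S r in \<open>auto simp: P_def summable_on_def\<close>)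
  have PS: "(P has_sum S) (J \<times> midx)"
    by (rule has_sum_SigmaI[where g = N]) (use cN(2) S Psum in \<open>auto simp: P_def\<close>)
  then have PS': "((\<lambda>(m, j). \<bar>c j m\<bar> * r ^ mdeg m) has_sum S) (midx \<times> J)"
    unfolding has_sum_swap[of P J midx S] by (simp add: P_def)
  have sm: "(\<lambda>j. \<bar>c j m\<bar> * r ^ mdeg m) summable_on J" if "m \<in> midx" for m
    using summable_on_SigmaD1[of "\<lambda>m j. \<bar>c j m\<bar> * r ^ mdeg m" midx "\<lambda>_. J"] PS' that
    by (auto simp: summable_on_def)
  have sm': "(\<lambda>j. \<bar>c j m\<bar>) summable_on J" if "m \<in> midx" for m
    using sm[OF that] r by (simp add: summable_on_cmult_left')
  have sm'': "(\<lambda>j. c j m) summable_on J" if "m \<in> midx" for m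
    using sm'[OF that] by (simp add: abs_summable_summable)
  define d where "d m = infsum (\<lambda>j. c j m) J" for m
  have d: "((\<lambda>j. c j m) has_sum d m) J" if "m \<in> midx" for m
    using sm''[OF that] by (simp add: d_def)
  define M where "M m = infsum (\<lambda>j. \<bar>c j m\<bar> * r ^ mdeg m) J" for m
  have M: "((\<lambda>j. \<bar>c j m\<bar> * r ^ mdeg m) has_sum M m) J" if "m \<in> midx" for m
    using sm[OF that] by (simp add: M_def)
  have MS: "(M has_sum S) midx"
    using has_sum_SigmaD[OF PS'] M by auto
  have dM: "\<bar>d m\<bar> * r ^ mdeg m \<le> M m" if "m \<in> midx" for m
  proof -
    have "\<bar>d m\<bar> \<le> infsum (\<lambda>j. \<bar>c j m\<bar>) J"
      using norm_infsum_bound[of "\<lambda>j. c j m" J] sm'[OF that] by (simp add: d_def)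
    then have "\<bar>d m\<bar> * r ^ mdeg m \<le> infsum (\<lambda>j. \<bar>c j m\<bar>) J * r ^ mdeg m"
      using r by (intro mult_right_mono) auto
    also have "\<dots> = M m" by (simp add: M_def infsum_cmult_left')
    finally show ?thesis .
  qed
  have "(\<lambda>m. \<bar>d m\<bar> * r ^ mdeg m) summable_on midx"
    using dM r by (intro summable_on_comparison_test[OF has_sum_imp_summable[OF MS]]) auto
  then obtain D where D: "((\<lambda>m. \<bar>d m\<bar> * r ^ mdeg m) has_sum D) midx"
    by (auto simp: summable_on_def)
  show ?thesis
  proof (rule psbI[OF D])
    show "D \<le> L" using has_sum_mono[OF D MS dM] SL by simp
    fix x :: 'a assume x: "x \<in> cube r"
    define Q where "Q = (\<lambda>(j, m). c j m * monomial m x)"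
    have "(\<lambda>p. norm (Q p)) summable_on J \<times> midx"
    proof (rule summable_on_comparison_test[OF Psum])
      fix p :: "'j \<times> ('a \<Rightarrow> nat)" assume "p \<in> J \<times> midx"
      then show "norm (Q p) \<le> P p"
        using monomial_bound[OF x] by (auto simp: Q_def P_def abs_mult mult_left_mono split: prod.splits)
    qed simp
    then have "Q summable_on J \<times> midx" by (rule abs_summable_summable)
    then obtain T where T: "(Q has_sum T) (J \<times> midx)" by (auto simp: summable_on_def)
    have "((\<lambda>j. f j x) has_sum T) J"
      using has_sum_SigmaD[OF T, of "\<lambda>j. f j x"] cN(3) x by (auto simp: Q_def)
    then have "T = g x" using g[OF x] has_sum_unique by blast
    have "((\<lambda>(m, j). c j m * monomial m x) has_sum T) (midx \<times> J)"
      using T unfolding has_sum_swap[of Q J midx T] by (simp add: Q_def)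
    then have "((\<lambda>m. d m * monomial m x) has_sum T) midx"
      by (rule has_sum_SigmaD) (auto intro!: has_sum_cmult_left d)
    then show "((\<lambda>m. d m * monomial m x) has_sum g x) midx" using \<open>T = g x\<close> by simp
  qed
qed

lemma psb_sum:
  assumes "0 < r" "finite J" "\<And>j. j \<in> J \<Longrightarrow> psb r (f j) (K j)"
  shows "psb r (\<lambda>x. \<Sum>j\<in>J. f j x) (\<Sum>j\<in>J. K j)"
  by (rule psb_has_sum[of r J f K]) (use assms in auto)

lemma psb_add:
  assumes "0 < r" "psb r f K" "psb r g L"
  shows "psb r (\<lambda>x. f x + g x) (K + L)"
  using psb_sum[of r "UNIV :: bool set" "\<lambda>i. if i then f else g" "\<lambda>i. if i then K else L"] assms
  by (simp add: UNIV_bool add.commute split: if_splits)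

lemma psb_diff:
  assumes "0 < r" "psb r f K" "psb r g L"
  shows "psb r (\<lambda>x. f x - g x) (K + L)"
  using psb_add[OF assms(1,2) psb_cmult[OF assms(3), of "-1"]] by simp

lemma psb_coord:
  assumes "0 \<le> r" "b \<in> Basis"
  shows "psb r (\<lambda>x. x \<bullet> b) r"
  using psb_coord_mult[OF psb_const[of r 1] assms] by simp

lemma psb_monomial_mult:
  assumes f: "psb r f K" and r: "0 \<le> r"
  shows "psb r (\<lambda>x. monomial m x * f x) (r ^ mdeg m * K)"
proof -
  have pow: "psb r (\<lambda>x. (x \<bullet> b) ^ k * h x) (r ^ k * L)" if "psb r h L" "b \<in> Basis" for h b k L
  proof (induction k)
    case (Suc k)
    show ?case using psb_coord_mult[OF Suc r that(2)] by (simp add: mult_ac)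
  qed (use that in simp)
  have "psb r (\<lambda>x. (\<Prod>b\<in>B. (x \<bullet> b) ^ m b) * f x) ((\<Prod>b\<in>B. r ^ m b) * K)" if "finite B" "B \<subseteq> Basis" for B
    using that
  proof (induction B rule: finite_induct)
    case (insert b B)
    then show ?case
      using pow[of "\<lambda>x. (\<Prod>b\<in>B. (x \<bullet> b) ^ m b) * f x" "(\<Prod>b\<in>B. r ^ m b) * K" b "m b"]
      by (simp add: mult_ac)
  qed (use f in simp)
  from this[of Basis] show ?thesis
    by (simp add: monomial_def mdeg_def power_sum)
qed

lemma psb_monomial: "0 \<le> r \<Longrightarrow> psb r (monomial m) (r ^ mdeg m)"
  using psb_monomial_mult[OF psb_const[of r 1]] by simp

text \<open>Only \<open>f\<close> is expanded. Each \<open>monomial m * g\<close> costs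
  \<open>r ^ mdeg m * L\<close>, and completeness adds these up, so no Cauchy product of
  coefficients has to be formed.\<close>

lemma psb_mult:
  fixes f g :: "'a::euclidean_space \<Rightarrow> real"
  assumes r: "0 < r" and f: "psb r f K" and g: "psb r g L"
  shows "psb r (\<lambda>x. f x * g x) (K * L)"
proof -
  obtain c N where c: "((\<lambda>m. \<bar>c m\<bar> * r ^ mdeg m) has_sum N) midx" "N \<le> K"
    "\<And>x. x \<in> cube r \<Longrightarrow> ((\<lambda>m. c m * monomial m x) has_sum f x) midx"
    using f unfolding psb_def by blast
  have "psb r (\<lambda>x. f x * g x) (N * L)"
  proof (rule psb_has_sum[OF r])
    show "psb r (\<lambda>x. c m * (monomial m x * g x)) (\<bar>c m\<bar> * (r ^ mdeg m * L))" for m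
      by (intro psb_cmult psb_monomial_mult g) (use r in simp)
    show "((\<lambda>m. \<bar>c m\<bar> * (r ^ mdeg m * L)) has_sum (N * L)) midx"
      using has_sum_cmult_left[OF c(1), of L] by (simp add: mult_ac)
    show "((\<lambda>m. c m * (monomial m x * g x)) has_sum (f x * g x)) midx" if "x \<in> cube r" for x
      using has_sum_cmult_left[OF c(3)[OF that], of "g x"] by (simp add: mult_ac)
  qed
  then show ?thesis
    by (rule psb_mono) (use c(2) psb_nonneg[OF g] r in \<open>simp add: mult_right_mono\<close>)
qed

lemma psb_power:
  assumes "0 < r" "psb r f K"
  shows "psb r (\<lambda>x. f x ^ k) (K ^ k)"
proof (induction k)
  case 0 show ?case using psb_const[of r 1] by simp
next
  case (Suc k) show ?case using psb_mult[OF assms(1,2) Suc] by simp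
qed

lemma psb_prod:
  assumes "0 < r" "finite J" "\<And>j. j \<in> J \<Longrightarrow> psb r (f j) (K j)"
  shows "psb r (\<lambda>x. \<Prod>j\<in>J. f j x) (\<Prod>j\<in>J. K j)"
  using assms(2,3)
proof (induction J rule: finite_induct)
  case empty show ?case using psb_const[of r 1] by simp
next
  case (insert j J)
  then show ?case using psb_mult[OF assms(1), of "f j" "K j" "\<lambda>x. \<Prod>j\<in>J. f j x"] by simp
qed

text \<open>Substitution into a monomial has norm at most \<open>R ^ mdeg m\<close> by
  submultiplicativity, which is exactly the weight of that monomial in the norm of \<open>f\<close>
  at radius \<open>R\<close>.\<close>

lemma psb_compose:
  fixes f :: "'a::euclidean_space \<Rightarrow> real" and G :: "'c::euclidean_space \<Rightarrow> 'a"
  assumes r: "0 < r" and f: "psb R f K" and G: "\<And>b. b \<in> Basis \<Longrightarrow> psb r (\<lambda>y. G y \<bullet> b) R"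
  shows "psb r (\<lambda>y. f (G y)) K"
proof -
  obtain c N where c: "((\<lambda>m. \<bar>c m\<bar> * R ^ mdeg m) has_sum N) midx" "N \<le> K"
    "\<And>x. x \<in> cube R \<Longrightarrow> ((\<lambda>m. c m * monomial m x) has_sum f x) midx"
    using f unfolding psb_def by blast
  have "psb r (\<lambda>y. f (G y)) N"
  proof (rule psb_has_sum[OF r _ c(1)])
    fix m :: "'a \<Rightarrow> nat"
    have "psb r (\<lambda>y. monomial m (G y)) (\<Prod>b\<in>Basis. R ^ m b)"
      unfolding monomial_def by (intro psb_prod psb_power r G) auto
    then show "psb r (\<lambda>y. c m * monomial m (G y)) (\<bar>c m\<bar> * R ^ mdeg m)"
      using psb_cmult by (simp add: mdeg_def power_sum)
  next
    fix y :: 'c assume "y \<in> cube r"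
    then have "G y \<in> cube R"
      using psb_bound[OF G] by (auto simp: cube_def)
    then show "((\<lambda>m. c m * monomial m (G y)) has_sum f (G y)) midx" by (rule c(3))
  qed
  then show ?thesis using c(2) by (rule psb_mono)
qed

section \<open>Closure properties of analytic functions\<close>

lemma midx_mdeg_eq_0: "m \<in> midx \<Longrightarrow> mdeg m = 0 \<longleftrightarrow> m = (\<lambda>_. 0)"
  by (auto simp: midx_def mdeg_def fun_eq_iff)

lemma monomial_at_0:
  assumes "m \<in> midx"
  shows "monomial m (0::'a::euclidean_space) = (if m = (\<lambda>_. 0) then 1 else 0)"
proof (cases "m = (\<lambda>_. 0)")
  case False
  then obtain b where "m b \<noteq> 0" by auto
  moreover have "b \<in> Basis" using assms calculation by (auto simp: midx_def)
  ultimately show ?thesis using False by (auto simp: monomial_def intro!: prod_zero bexI[of _ b])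
qed simp

text \<open>Without a constant term every monomial has degree at least 1 and gains the factor
  \<open>s / r\<close>. The norm therefore tends to 0 with the radius, which is what makes inner
  functions small enough for \<open>psb_compose\<close>.\<close>

lemma psb_shrink_zero:
  fixes f :: "'a::euclidean_space \<Rightarrow> real"
  assumes f: "psb r f K" and f0: "f 0 = 0" and s: "0 < s" "s \<le> r"
  shows "psb s f (s / r * K)"
proof -
  obtain c N where c: "((\<lambda>m. \<bar>c m\<bar> * r ^ mdeg m) has_sum N) midx" "N \<le> K"
    "\<And>x. x \<in> cube r \<Longrightarrow> ((\<lambda>m. c m * monomial m x) has_sum f x) midx"
    using f unfolding psb_def by blast
  have "((\<lambda>m. c m * monomial m (0::'a)) has_sum c (\<lambda>_. 0)) midx"
    by (rule has_sum_finite_neutralI[of "{\<lambda>_. 0}"]) (auto simp: monomial_at_0)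
  moreover have "((\<lambda>m. c m * monomial m (0::'a)) has_sum 0) midx"
    using c(3)[of 0] f0 s by simp
  ultimately have c0: "c (\<lambda>_. 0) = 0"
    by (rule has_sum_unique)
  have le: "\<bar>c m\<bar> * s ^ mdeg m \<le> s / r * (\<bar>c m\<bar> * r ^ mdeg m)" if m: "m \<in> midx" for m
  proof (cases "mdeg m")
    case 0
    then show ?thesis using m c0 by (simp add: midx_mdeg_eq_0)
  next
    case (Suc k)
    have "s ^ k \<le> r ^ k" using s by (intro power_mono) auto
    then have "\<bar>c m\<bar> * s * s ^ k \<le> \<bar>c m\<bar> * s * r ^ k"
      using s by (intro mult_left_mono) auto
    then show ?thesis using s Suc by (simp add: mult_ac)
  qed
  have R: "((\<lambda>m. s / r * (\<bar>c m\<bar> * r ^ mdeg m)) has_sum s / r * N) midx"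
    by (rule has_sum_cmult_right[OF c(1)])
  have "(\<lambda>m. \<bar>c m\<bar> * s ^ mdeg m) summable_on midx"
    using s le by (intro summable_on_comparison_test[OF has_sum_imp_summable[OF R]]) auto
  then obtain M where M: "((\<lambda>m. \<bar>c m\<bar> * s ^ mdeg m) has_sum M) midx"
    by (auto simp: summable_on_def)
  have "M \<le> s / r * N" using has_sum_mono[OF M R le] .
  also have "\<dots> \<le> s / r * K" using c(2) s by (intro mult_left_mono) auto
  finally show ?thesis
    using c(3) cube_mono[OF _ s(2)] by (intro psbI[OF M]) auto
qed

text \<open>The definition gives unconditional sums point by point, with no uniform bound. For real
  series unconditional means absolute, and convergence at one corner of a cube inside the ball
  already bounds the norm.\<close>

lemma real_analytic_on_iff_psb:
  fixes f :: "'a::euclidean_space \<Rightarrow> real"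
  shows "real_analytic_on f S \<longleftrightarrow> (\<forall>x0\<in>S. \<exists>r>0. \<exists>K. psb r (\<lambda>y. f (x0 + y)) K)"
proof (intro iffI ballI)
  fix x0 assume f: "real_analytic_on f S" and x0: "x0 \<in> S"
  then obtain r c where r: "0 < r" and c: "\<And>x. x \<in> ball x0 r \<Longrightarrow>
     ((\<lambda>m. c m * monomial m (x - x0)) has_sum f x) midx"
    unfolding real_analytic_on_def monomial_def midx_def by blast
  \<comment> \<open>On the cube of this radius the l1 norm, and with it the Euclidean norm, is at
    most \<open>r / 2\<close>.\<close>
  define \<rho> where "\<rho> = r / (2 * DIM('a))"
  have \<rho>: "0 < \<rho>" "DIM('a) * \<rho> < r" using r by (auto simp: \<rho>_def)
  have c': "((\<lambda>m. c m * monomial m y) has_sum f (x0 + y)) midx" if "y \<in> cube \<rho>" for y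
  proof -
    have "norm y \<le> (\<Sum>b\<in>Basis. \<bar>y \<bullet> b\<bar>)" by (rule norm_le_l1)
    also have "\<dots> \<le> (\<Sum>b\<in>(Basis::'a set). \<rho>)" using that by (intro sum_mono) (auto simp: cube_def)
    also have "\<dots> < r" using \<rho> by simp
    finally show ?thesis using c[of "x0 + y"] by (simp add: dist_norm)
  qed
  \<comment> \<open>At the corner each monomial equals \<open>\<rho> ^ mdeg m\<close>, so the series
    of \<open>f\<close> there is the series of the norm up to signs.\<close>
  have "(\<Sum>b\<in>Basis. \<rho> *\<^sub>R b) \<in> cube \<rho>"
    using \<rho> by (simp add: cube_def)
  from c'[OF this] have "(\<lambda>m. c m * \<rho> ^ mdeg m) summable_on midx"
    by (auto simp: monomial_corner summable_on_def)
  then have "(\<lambda>m. norm (c m * \<rho> ^ mdeg m)) summable_on midx"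
    by (rule summable_on_iff_abs_summable_on_real[THEN iffD1])
  then obtain N where "((\<lambda>m. \<bar>c m\<bar> * \<rho> ^ mdeg m) has_sum N) midx"
    using \<rho> by (auto simp: abs_mult power_abs summable_on_def)
  then have "psb \<rho> (\<lambda>y. f (x0 + y)) N"
    using c' by (intro psbI) auto
  then show "\<exists>r>0. \<exists>K. psb r (\<lambda>y. f (x0 + y)) K" using \<rho> by blast
next
  assume f: "\<forall>x0\<in>S. \<exists>r>0. \<exists>K. psb r (\<lambda>y. f (x0 + y)) K"
  show "real_analytic_on f S"
    unfolding real_analytic_on_def
  proof
    fix x0 assume "x0 \<in> S"
    then obtain r K where r: "0 < r" and "psb r (\<lambda>y. f (x0 + y)) K" using f by blast
    then obtain c where c: "\<And>y. y \<in> cube r \<Longrightarrow> ((\<lambda>m. c m * monomial m y) has_sum f (x0 + y)) midx"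
      unfolding psb_def by blast
    have "((\<lambda>m. c m * monomial m (x - x0)) has_sum f x) midx" if "x \<in> ball x0 r" for x
    proof -
      have "x - x0 \<in> cube r"
        using that ball_subset_cube[of r] by (force simp: dist_norm norm_minus_commute)
      from c[OF this] show ?thesis by simp
    qed
    then show "\<exists>r>0. \<exists>c. \<forall>x\<in>ball x0 r. ((\<lambda>m. c m * (\<Prod>b\<in>Basis. ((x - x0) \<bullet> b) ^ m b)) has_sum f x)
            {m. \<forall>b. b \<notin> Basis \<longrightarrow> m b = 0}"
      using r unfolding monomial_def midx_def by blast
  qed
qed

lemma real_analytic_on_psbE:
  assumes "real_analytic_on f S" "x0 \<in> S"
  obtains r K where "0 < r" "psb r (\<lambda>y. f (x0 + y)) K"
  using assms unfolding real_analytic_on_iff_psb by blast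

text \<open>Recentring is composition with a translation, whose components have norm at most
  \<open>\<bar>p \<bullet> b\<bar> + s\<close>. Hence a single expansion gives analyticity on a
  whole ball.\<close>

lemma psb_translate:
  fixes f :: "'a::euclidean_space \<Rightarrow> real"
  assumes f: "psb r f K" and s: "0 < s" and p: "\<And>b. b \<in> Basis \<Longrightarrow> \<bar>p \<bullet> b\<bar> + s \<le> r"
  shows "psb s (\<lambda>y. f (p + y)) K"
proof (rule psb_compose[OF s f])
  fix b :: 'a assume b: "b \<in> Basis"
  have "psb s (\<lambda>y. p \<bullet> b + y \<bullet> b) (\<bar>p \<bullet> b\<bar> + s)"
    using s b by (intro psb_add psb_const psb_coord) auto
  then show "psb s (\<lambda>y. (p + y) \<bullet> b) r"
    using psb_mono[OF _ p[OF b]] by (simp add: inner_add_left)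
qed

lemma psb_imp_real_analytic_on_ball:
  assumes f: "psb r (\<lambda>y. f (x0 + y)) K"
  shows "real_analytic_on f (ball x0 r)"
  unfolding real_analytic_on_iff_psb
proof
  fix x assume x: "x \<in> ball x0 r"
  define s where "s = r - norm (x - x0)"
  have s: "0 < s" using x by (simp add: s_def dist_norm norm_minus_commute)
  have "psb s (\<lambda>y. f (x0 + ((x - x0) + y))) K"
    by (rule psb_translate[OF f s]) (use Basis_le_norm[of _ "x - x0"] in \<open>auto simp: s_def\<close>)
  then show "\<exists>r>0. \<exists>K. psb r (\<lambda>y. f (x + y)) K" using s by (auto simp: algebra_simps)
qed

lemma real_analytic_on_subset: "real_analytic_on f S \<Longrightarrow> T \<subseteq> S \<Longrightarrow> real_analytic_on f T"
  unfolding real_analytic_on_def by blast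

lemma real_analytic_on_cong:
  assumes f: "real_analytic_on f S" and S: "open S" and eq: "\<And>x. x \<in> S \<Longrightarrow> f x = g x"
  shows "real_analytic_on g S"
  unfolding real_analytic_on_iff_psb
proof
  fix x assume x: "x \<in> S"
  obtain r K where r: "0 < r" "psb r (\<lambda>y. f (x + y)) K"
    using real_analytic_on_psbE[OF f x] .
  obtain e where e: "0 < e" "ball x e \<subseteq> S" using S x open_contains_ball by blast
  let ?d = "min (e / (2 * DIM('a))) r"
  have d: "0 < ?d" using e r by simp
  have "psb ?d (\<lambda>y. f (x + y)) K" using r d by (intro psb_shrink[OF r(2)]) auto
  then have "psb ?d (\<lambda>y. g (x + y)) K"
  proof (rule psb_cong)
    fix y :: 'a assume y: "y \<in> cube ?d"
    have "norm y \<le> (\<Sum>b\<in>Basis. \<bar>y \<bullet> b\<bar>)" by (rule norm_le_l1)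
    also have "\<dots> \<le> (\<Sum>b\<in>(Basis::'a set). e / (2 * DIM('a)))"
      using y by (intro sum_mono) (auto simp: cube_def)
    also have "\<dots> < e" using e by simp
    finally show "f (x + y) = g (x + y)" using e by (intro eq subsetD[OF e(2)]) (simp add: dist_norm)
  qed
  then show "\<exists>r>0. \<exists>K. psb r (\<lambda>y. g (x + y)) K" using d by blast
qed

section \<open>Ring operations, composition and division of analytic functions\<close>

lemma real_analytic_on_const: "real_analytic_on (\<lambda>_. a) S"
  unfolding real_analytic_on_iff_psb using psb_const zero_less_one by blast

lemma real_analytic_on_inner_Basis:
  assumes "b \<in> Basis"
  shows "real_analytic_on (\<lambda>x. x \<bullet> b) S"
  unfolding real_analytic_on_iff_psb
proof
  fix x
  have "psb 1 (\<lambda>y. x \<bullet> b + y \<bullet> b) (\<bar>x \<bullet> b\<bar> + 1)"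
    using assms by (intro psb_add psb_const psb_coord) auto
  then show "\<exists>r>0. \<exists>K. psb r (\<lambda>y. (x + y) \<bullet> b) K"
    unfolding inner_add_left using zero_less_one by blast
qed

lemma real_analytic_on_common_psbE:
  assumes "real_analytic_on f S" "real_analytic_on g S" "x \<in> S"
  obtains r K L where "0 < r" "psb r (\<lambda>y. f (x + y)) K" "psb r (\<lambda>y. g (x + y)) L"
proof -
  obtain r K where r: "0 < r" "psb r (\<lambda>y. f (x + y)) K"
    using real_analytic_on_psbE assms(1,3) .
  obtain s L where s: "0 < s" "psb s (\<lambda>y. g (x + y)) L"
    using real_analytic_on_psbE assms(2,3) .
  show thesis
    by (rule that[of "min r s" K L]) (use r s in \<open>auto intro: psb_shrink\<close>)
qed

lemma real_analytic_on_add: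
  assumes "real_analytic_on f S" "real_analytic_on g S"
  shows "real_analytic_on (\<lambda>x. f x + g x) S"
  unfolding real_analytic_on_iff_psb
proof
  fix x assume "x \<in> S"
  then obtain r K L where "0 < r" "psb r (\<lambda>y. f (x + y)) K" "psb r (\<lambda>y. g (x + y)) L"
    using real_analytic_on_common_psbE[OF assms] by blast
  then show "\<exists>r>0. \<exists>K. psb r (\<lambda>y. f (x + y) + g (x + y)) K"
    using psb_add by blast
qed

lemma real_analytic_on_mult:
  assumes "real_analytic_on f S" "real_analytic_on g S"
  shows "real_analytic_on (\<lambda>x. f x * g x) S"
  unfolding real_analytic_on_iff_psb
proof
  fix x assume "x \<in> S"
  then obtain r K L where "0 < r" "psb r (\<lambda>y. f (x + y)) K" "psb r (\<lambda>y. g (x + y)) L"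
    using real_analytic_on_common_psbE[OF assms] by blast
  then show "\<exists>r>0. \<exists>K. psb r (\<lambda>y. f (x + y) * g (x + y)) K"
    using psb_mult by blast
qed

lemma real_analytic_on_diff:
  assumes "real_analytic_on f S" "real_analytic_on g S"
  shows "real_analytic_on (\<lambda>x. f x - g x) S"
  unfolding real_analytic_on_iff_psb
proof
  fix x assume "x \<in> S"
  then obtain r K L where "0 < r" "psb r (\<lambda>y. f (x + y)) K" "psb r (\<lambda>y. g (x + y)) L"
    using real_analytic_on_common_psbE[OF assms] by blast
  then show "\<exists>r>0. \<exists>K. psb r (\<lambda>y. f (x + y) - g (x + y)) K"
    using psb_diff by blast
qed

lemma real_analytic_on_sum:
  assumes "\<And>j. j \<in> J \<Longrightarrow> real_analytic_on (f j) S"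
  shows "real_analytic_on (\<lambda>x. \<Sum>j\<in>J. f j x) S"
  using assms by (induction J rule: infinite_finite_induct)
    (auto intro: real_analytic_on_const real_analytic_on_add)

text \<open>The increment \<open>G (y + z) - G y\<close> vanishes at \<open>z = 0\<close>, so a
  smaller radius brings the norms of its components below the radius \<open>R\<close> of the outer
  expansion.\<close>

lemma real_analytic_on_compose:
  fixes f :: "'a::euclidean_space \<Rightarrow> real" and G :: "'c::euclidean_space \<Rightarrow> 'a"
  assumes f: "real_analytic_on f T" and G: "\<And>b. b \<in> Basis \<Longrightarrow> real_analytic_on (\<lambda>y. G y \<bullet> b) S"
    and GT: "\<And>y. y \<in> S \<Longrightarrow> G y \<in> T"
  shows "real_analytic_on (\<lambda>y. f (G y)) S"
  unfolding real_analytic_on_iff_psb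
proof
  fix y assume y: "y \<in> S"
  obtain R K where R: "0 < R" "psb R (\<lambda>x. f (G y + x)) K"
    using real_analytic_on_psbE[OF f GT[OF y]] .
  have "\<exists>r>0. psb r (\<lambda>z. (G (y + z) - G y) \<bullet> b) R" if b: "b \<in> Basis" for b
  proof -
    obtain r L where r: "0 < r" "psb r (\<lambda>z. G (y + z) \<bullet> b) L"
      using real_analytic_on_psbE[OF G[OF b] y] .
    have L: "psb r (\<lambda>z. (G (y + z) - G y) \<bullet> b) (L + \<bar>G y \<bullet> b\<bar>)"
      unfolding inner_diff_left by (intro psb_diff psb_const r)
    define M where "M = L + \<bar>G y \<bullet> b\<bar>"
    have M: "0 \<le> M" using psb_nonneg[OF L] r by (simp add: M_def)
    \<comment> \<open>Chosen so that \<open>s / r * M \<le> R\<close>; the summand 1 covers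
      \<open>M = 0\<close>.\<close>
    define s where "s = min r (r * R / (M + 1))"
    have s: "0 < s" "s \<le> r" using r R M by (auto simp: s_def)
    have "psb s (\<lambda>z. (G (y + z) - G y) \<bullet> b) (s / r * M)"
      using L s by (intro psb_shrink_zero) (auto simp: M_def)
    moreover have "s / r * M \<le> R"
    proof -
      have "s / r * M \<le> (r * R / (M + 1)) / r * M"
        using r M by (intro mult_right_mono divide_right_mono) (auto simp: s_def)
      also have "\<dots> = R * (M / (M + 1))" using r by simp
      also have "\<dots> \<le> R * 1" using R M by (intro mult_left_mono) auto
      finally show ?thesis by simp
    qed
    ultimately show ?thesis using s psb_mono by blast
  qed
  then have "\<forall>b\<in>Basis. \<exists>r. 0 < r \<and> psb r (\<lambda>z. (G (y + z) - G y) \<bullet> b) R"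
    by blast
  from bchoice[OF this] obtain r
    where r: "\<And>b. b \<in> Basis \<Longrightarrow> 0 < r b \<and> psb (r b) (\<lambda>z. (G (y + z) - G y) \<bullet> b) R"
    by blast
  define s where "s = Min (insert 1 (r ` Basis))"
  have s: "0 < s" unfolding s_def using r by (subst Min_gr_iff) auto
  have "psb s (\<lambda>z. f (G y + (G (y + z) - G y))) K"
  proof (rule psb_compose[OF s R(2)])
    fix b :: 'a assume b: "b \<in> Basis"
    have "s \<le> r b" unfolding s_def by (rule Min_le) (use b in auto)
    then show "psb s (\<lambda>z. (G (y + z) - G y) \<bullet> b) R"
      using r[OF b] s psb_shrink by (metis less_imp_le)
  qed
  then show "\<exists>r>0. \<exists>K. psb r (\<lambda>z. f (G (y + z))) K" using s by auto
qed

text \<open>The geometric series 1/(a + y) = (1/a) * sum of (-y/a)^k. At radius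
  \<open>\<bar>a\<bar> / 2\<close> the ratio has norm 1/2.\<close>

lemma real_analytic_on_inverse: "real_analytic_on (inverse :: real \<Rightarrow> real) {x. x \<noteq> 0}"
  unfolding real_analytic_on_iff_psb
proof
  fix a :: real assume "a \<in> {x. x \<noteq> 0}"
  then have a: "a \<noteq> 0" by simp
  define r where "r = \<bar>a\<bar> / 2"
  have r: "0 < r" using a by (simp add: r_def)
  have "psb r (\<lambda>y. inverse (a + y)) (\<Sum>\<^sub>\<infinity>k. \<bar>1 / a\<bar> * (1 / 2) ^ k)"
  proof (rule psb_has_sum[OF r])
    show "psb r (\<lambda>y::real. (1 / a) * ((- 1 / a) * (y \<bullet> 1)) ^ k) (\<bar>1 / a\<bar> * (1 / 2) ^ k)" for k
    proof -
      have eq: "\<bar>- 1 / a\<bar> * r = 1 / 2" using a by (simp add: r_def)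
      have "psb r (\<lambda>y::real. y \<bullet> 1) r" using r by (intro psb_coord) auto
      from psb_cmult[OF this, of "- 1 / a"] have "psb r (\<lambda>y::real. (- 1 / a) * (y \<bullet> 1)) (1 / 2)"
        unfolding eq .
      from psb_cmult[OF psb_power[OF r this]] show ?thesis .
    qed
    have "((\<lambda>k. (1 / 2 :: real) ^ k) has_sum (1 / (1 - 1 / 2))) UNIV"
      by (intro norm_summable_imp_has_sum geometric_sums) (auto simp: norm_power)
    then show "((\<lambda>k. \<bar>1 / a\<bar> * (1 / 2) ^ k) has_sum (\<Sum>\<^sub>\<infinity>k. \<bar>1 / a\<bar> * (1 / 2) ^ k)) UNIV"
      by (intro has_sum_infsum summable_on_cmult_right) (auto simp: summable_on_def)
    fix y :: real assume "y \<in> cube r"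
    then have y: "\<bar>y\<bar> \<le> r" by (simp add: cube_def)
    define q where "q = (- 1 / a) * (y \<bullet> 1)"
    have q: "\<bar>q\<bar> < 1" using y a by (simp add: q_def abs_mult r_def field_simps)
    have "((\<lambda>k. q ^ k) has_sum (1 / (1 - q))) UNIV"
      using q by (intro norm_summable_imp_has_sum geometric_sums) (auto simp: power_abs)
    then have "((\<lambda>k. 1 / a * q ^ k) has_sum (1 / a * (1 / (1 - q)))) UNIV"
      by (rule has_sum_cmult_right)
    moreover have "1 / a * (1 / (1 - q)) = inverse (a + y)"
      using a by (simp add: q_def field_simps)
    ultimately show "((\<lambda>k. 1 / a * ((- 1 / a) * (y \<bullet> 1)) ^ k) has_sum inverse (a + y)) UNIV"
      by (simp add: q_def)
  qed
  then show "\<exists>r>0. \<exists>K. psb r (\<lambda>y. inverse (a + y)) K" using r by blast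
qed

lemma real_analytic_on_compose_real:
  fixes f :: "real \<Rightarrow> real"
  assumes "real_analytic_on f T" "real_analytic_on g S" "\<And>y. y \<in> S \<Longrightarrow> g y \<in> T"
  shows "real_analytic_on (\<lambda>y. f (g y)) S"
  by (rule real_analytic_on_compose[OF assms(1)]) (use assms in auto)

lemma real_analytic_on_divide:
  assumes "real_analytic_on f S" "real_analytic_on g S" "\<And>x. x \<in> S \<Longrightarrow> g x \<noteq> 0"
  shows "real_analytic_on (\<lambda>x. f x / g x) S"
  unfolding divide_inverse
  by (intro real_analytic_on_mult real_analytic_on_compose_real[OF real_analytic_on_inverse] assms)
    (use assms in auto)

section \<open>Differentiation\<close>

text \<open>The left side is one term of the binomial expansion of the right side. It plays the part
  of the Cauchy estimate: giving up \<open>\<rho>\<close> of the radius pays for the factor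
  \<open>k\<close> produced by differentiation.\<close>

lemma power_derivative_bound:
  fixes A \<rho> :: real
  assumes "0 \<le> A" "0 < \<rho>"
  shows "real k * A ^ (k - 1) * \<rho> \<le> (A + \<rho>) ^ k"
proof (induction k)
  case (Suc k)
  have "real k * A ^ k = real k * A ^ (k - 1) * A" by (cases k) auto
  then have "real (Suc k) * A ^ k * \<rho> = A * (real k * A ^ (k - 1) * \<rho>) + A ^ k * \<rho>"
    by (simp add: algebra_simps)
  also have "\<dots> \<le> A * (A + \<rho>) ^ k + (A + \<rho>) ^ k * \<rho>"
    using assms Suc by (intro add_mono mult_left_mono mult_right_mono power_mono) auto
  finally show ?case by (simp add: algebra_simps)
qed simp

lemma power_remainder_bound:
  fixes x t A \<rho> :: real
  assumes "\<bar>x\<bar> \<le> A" "0 < \<rho>" "\<bar>t\<bar> \<le> \<rho> / 2"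
  shows "\<bar>(x + t) ^ k - x ^ k - real k * t * x ^ (k - 1)\<bar> \<le> 2 * t\<^sup>2 / \<rho>\<^sup>2 * (A + \<rho>) ^ k"
proof (induction k)
  case 0
  then show ?case by simp
next
  case (Suc k)
  define e where "e = (x + t) ^ k - x ^ k - real k * t * x ^ (k - 1)"
  define C where "C = t\<^sup>2 / \<rho>\<^sup>2 * (A + \<rho>) ^ k"
  have A: "0 \<le> A" using assms by linarith
  have C: "0 \<le> C" using A assms by (simp add: C_def)
  have xk: "real k * x ^ (k - 1) * x = real k * x ^ k" by (cases k) auto
  have "(x + t) ^ Suc k - x ^ Suc k - real (Suc k) * t * x ^ k
      = (x + t) * e + t\<^sup>2 * (real k * x ^ (k - 1)) + t * (real k * x ^ (k - 1) * x - real k * x ^ k)"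
    by (simp add: e_def algebra_simps power2_eq_square)
  also have "\<dots> = (x + t) * e + t\<^sup>2 * (real k * x ^ (k - 1))"
    by (simp only: xk diff_self mult_zero_right add_0_right)
  also have "\<bar>\<dots>\<bar> \<le> \<bar>x + t\<bar> * \<bar>e\<bar> + t\<^sup>2 * (real k * \<bar>x\<bar> ^ (k - 1))"
    by (rule order_trans[OF abs_triangle_ineq]) (simp add: abs_mult power_abs)
  \<comment> \<open>The constant 2 and the restriction to \<open>\<rho> / 2\<close> are balanced
    here: 2 * (\<rho> / 2) + \<rho> = 2 * \<rho> closes the induction.\<close>
  also have "\<dots> \<le> (A + \<rho> / 2) * (2 * C) + \<rho> * C"
  proof (rule add_mono)
    show "\<bar>x + t\<bar> * \<bar>e\<bar> \<le> (A + \<rho> / 2) * (2 * C)"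
      using Suc assms A by (intro mult_mono) (auto simp: e_def C_def)
    have "real k * \<bar>x\<bar> ^ (k - 1) * \<rho> \<le> real k * A ^ (k - 1) * \<rho>"
      using assms by (intro mult_left_mono mult_right_mono power_mono) auto
    also have "\<dots> \<le> (A + \<rho>) ^ k" using power_derivative_bound A assms by blast
    finally have "t\<^sup>2 / \<rho> * (real k * \<bar>x\<bar> ^ (k - 1) * \<rho>) \<le> t\<^sup>2 / \<rho> * (A + \<rho>) ^ k"
      using assms by (intro mult_left_mono) auto
    then show "t\<^sup>2 * (real k * \<bar>x\<bar> ^ (k - 1)) \<le> \<rho> * C"
      using assms by (simp add: C_def power2_eq_square field_simps)
  qed
  also have "\<dots> = 2 * t\<^sup>2 / \<rho>\<^sup>2 * (A + \<rho>) ^ Suc k"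
  proof -
    have "(A + \<rho> / 2) * (2 * C) + \<rho> * C = 2 * (A + \<rho>) * C" by (simp add: algebra_simps)
    then show ?thesis by (simp add: C_def mult_ac)
  qed
  finally show ?case by simp
qed

lemma has_derivative_quadratic_remainder:
  fixes f :: "'a::real_normed_vector \<Rightarrow> real"
  assumes F: "bounded_linear F" and \<delta>: "0 < \<delta>"
    and bd: "\<And>h. norm h < \<delta> \<Longrightarrow> \<bar>f (x + h) - f x - F h\<bar> \<le> C * (norm h)\<^sup>2"
  shows "(f has_derivative F) (at x)"
  unfolding has_derivative_at
proof (intro conjI F)
  have ev: "\<forall>\<^sub>F h in at (0::'a). norm h < \<delta>"
    unfolding eventually_at using \<delta> by (auto simp: dist_norm)
  show "(\<lambda>h. norm (f (x + h) - f x - F h) / norm h) \<midarrow>0\<rightarrow> 0"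
  proof (rule Lim_null_comparison)
    show "\<forall>\<^sub>F h in at 0. norm (norm (f (x + h) - f x - F h) / norm h) \<le> C * norm h"
      using ev
    proof eventually_elim
      case (elim h)
      from bd[OF elim] show ?case
        by (cases "h = 0") (auto simp: divide_simps power2_eq_square mult_ac)
    qed
    show "((\<lambda>h. C * norm h) \<longlongrightarrow> 0) (at (0::'a))"
      by (rule tendsto_eq_intros refl | simp)+
  qed
qed

lemma psb_infsum:
  fixes f :: "'j \<Rightarrow> 'a::euclidean_space \<Rightarrow> real"
  assumes r: "0 < r" and f: "\<And>j. j \<in> J \<Longrightarrow> psb r (f j) (K j)" and K: "(K has_sum L) J"
  shows "psb r (\<lambda>x. infsum (\<lambda>j. f j x) J) L"
    and "\<And>x. x \<in> cube r \<Longrightarrow> ((\<lambda>j. f j x) has_sum infsum (\<lambda>j. f j x) J) J"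
proof -
  show *: "((\<lambda>j. f j x) has_sum infsum (\<lambda>j. f j x) J) J" if x: "x \<in> cube r" for x
  proof -
    have "(\<lambda>j. norm (f j x)) summable_on J"
    proof (rule summable_on_comparison_test[OF has_sum_imp_summable[OF K]])
      fix j assume "j \<in> J"
      from psb_bound[OF f[OF this] x] show "norm (f j x) \<le> K j" by simp
    qed simp
    then show ?thesis by (rule has_sum_infsum[OF abs_summable_summable])
  qed
  show "psb r (\<lambda>x. infsum (\<lambda>j. f j x) J) L"
    by (rule psb_has_sum[OF r f K *])
qed

text \<open>The termwise derivative converges on every smaller cube by the estimate for
  \<open>k * A ^ (k - 1)\<close>. Coefficients are kept explicit, in hypothesis and conclusion,
  because the action of the Euler operator is later read off from them.\<close>

lemma psb_partial_derivative:
  fixes f :: "'a::euclidean_space \<Rightarrow> real"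
  assumes c: "((\<lambda>m. \<bar>c m\<bar> * r ^ mdeg m) has_sum N) midx"
    "\<And>x. x \<in> cube r \<Longrightarrow> ((\<lambda>m. c m * monomial m x) has_sum f x) midx"
    and s: "0 < s" "s < r" and b: "b \<in> Basis"
  shows "\<exists>g L. psb s g L \<and>
    (\<forall>x\<in>cube s. ((\<lambda>t. f (x + t *\<^sub>R b)) has_real_derivative g x) (at 0) \<and>
       ((\<lambda>m. c m * (real (m b) * monomial (m(b := m b - 1)) x)) has_sum g x) midx)"
proof -
  define \<rho> where "\<rho> = r - s"
  have \<rho>: "0 < \<rho>" "r = s + \<rho>" using s by (auto simp: \<rho>_def)
  \<comment> \<open>The factor of the monomial that is constant along \<open>b\<close>; it reduces
    the differentiation to powers of one real variable.\<close>
  define P where "P m x = (\<Prod>b'\<in>Basis - {b}. (x \<bullet> b') ^ m b')" for m and x :: 'a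
  define e where "e m = (\<Sum>b'\<in>Basis - {b}. m b')" for m :: "'a \<Rightarrow> nat"
  have deg: "mdeg m = m b + e m" for m
    by (simp add: mdeg_def e_def sum.remove[OF _ b])
  have mon: "monomial m x = (x \<bullet> b) ^ m b * P m x" for m x
    by (simp add: P_def monomial_remove[OF b])
  have P_upd: "P (m(b := k)) x = P m x" and e_upd: "e (m(b := k)) = e m" for m k x
    unfolding P_def e_def by (auto intro!: prod.cong sum.cong)
  have P_shift: "P m (x + t *\<^sub>R b) = P m x" for m x t
    unfolding P_def by (rule prod.cong) (use b in \<open>auto simp: inner_add_left inner_Basis\<close>)
  have P_bound: "\<bar>P m x\<bar> \<le> r ^ e m" if "x \<in> cube s" for m x
  proof -
    have "\<bar>P m x\<bar> = (\<Prod>b'\<in>Basis - {b}. \<bar>x \<bullet> b'\<bar> ^ m b')"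
      by (simp add: P_def abs_prod power_abs)
    also have "\<dots> \<le> (\<Prod>b'\<in>Basis - {b}. r ^ m b')"
      using that s by (intro prod_mono conjI power_mono) (force simp: cube_def)+
    finally show ?thesis by (simp add: e_def power_sum)
  qed
  \<comment> \<open>Truncated subtraction is harmless at exponent 0, where the factor
    \<open>real (m b)\<close> vanishes.\<close>
  define d where "d m x = c m * (real (m b) * monomial (m(b := m b - 1)) x)" for m x
  have d_eq: "d m x = c m * (real (m b) * (x \<bullet> b) ^ (m b - 1) * P m x)" for m x
    by (simp add: d_def mon P_upd)
  have d_psb: "psb s (d m) (1 / \<rho> * (\<bar>c m\<bar> * r ^ mdeg m))" for m
  proof -
    have 1: "psb s (d m) (\<bar>c m\<bar> * (\<bar>real (m b)\<bar> * s ^ mdeg (m(b := m b - 1))))"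
      unfolding d_def using s by (intro psb_cmult psb_monomial) auto
    have "real (m b) * s ^ (m b - 1) * \<rho> \<le> r ^ m b"
      using power_derivative_bound[of s \<rho> "m b"] s \<rho> by simp
    moreover have "s ^ e m \<le> r ^ e m" using s by (intro power_mono) auto
    ultimately have "(real (m b) * s ^ (m b - 1) * \<rho>) * s ^ e m \<le> r ^ m b * r ^ e m"
      using s by (intro mult_mono) auto
    then have "real (m b) * s ^ mdeg (m(b := m b - 1)) \<le> 1 / \<rho> * r ^ mdeg m"
      using \<rho>(1) by (simp add: deg e_upd power_add field_simps)
    then have "\<bar>c m\<bar> * (\<bar>real (m b)\<bar> * s ^ mdeg (m(b := m b - 1))) \<le> \<bar>c m\<bar> * (1 / \<rho> * r ^ mdeg m)"
      by (intro mult_left_mono) auto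
    then show ?thesis using psb_mono[OF 1] by (simp add: mult_ac)
  qed
  define g where "g x = infsum (\<lambda>m. d m x) midx" for x
  note g = psb_infsum[OF s(1) d_psb has_sum_cmult_right[OF c(1), of "1 / \<rho>"], folded g_def]
  have "((\<lambda>t. f (x + t *\<^sub>R b)) has_real_derivative g x) (at 0)" if x: "x \<in> cube s" for x
    unfolding has_field_derivative_def
  proof (rule has_derivative_quadratic_remainder[where C = "2 / \<rho>\<^sup>2 * N" and \<delta> = "\<rho> / 2"])
    show "bounded_linear ((*) (g x))" by (rule bounded_linear_mult_right)
    show "0 < \<rho> / 2" using \<rho> by simp
    fix t :: real assume "norm t < \<rho> / 2"
    then have t: "\<bar>t\<bar> \<le> \<rho> / 2" by simp
    have xr: "x \<in> cube r" using cube_mono[OF x] s by simp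
    have xtr: "x + t *\<^sub>R b \<in> cube r"
      unfolding cube_def
    proof (intro CollectI ballI)
      fix b' :: 'a assume b': "b' \<in> Basis"
      have "\<bar>x \<bullet> b'\<bar> \<le> s" using x b' by (simp add: cube_def)
      moreover have "\<bar>t * (b \<bullet> b')\<bar> \<le> \<bar>t\<bar>" using b b' by (simp add: inner_Basis)
      ultimately show "\<bar>(x + t *\<^sub>R b) \<bullet> b'\<bar> \<le> r"
        using t \<rho> by (simp add: inner_add_left)
    qed
    \<comment> \<open>The second order Taylor remainder, term by term. Each term is at most a
      constant times \<open>t\<^sup>2\<close> times its weight in the norm at radius
      \<open>r\<close>, so the sum is still quadratic in \<open>t\<close>.\<close>
    let ?E = "\<lambda>m. c m * monomial m (x + t *\<^sub>R b) + (- 1) * (c m * monomial m x) + (- t) * d m x"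
    have S: "(?E has_sum (f (x + t *\<^sub>R b) + (- 1) * f x + (- t) * g x)) midx"
      by (intro has_sum_add has_sum_cmult_right c(2) xr xtr g(2) x)
    have bd: "\<bar>?E m\<bar> \<le> 2 * t\<^sup>2 / \<rho>\<^sup>2 * (\<bar>c m\<bar> * r ^ mdeg m)" for m
    proof -
      let ?y = "x \<bullet> b"
      have "?E m = c m * P m x * ((?y + t) ^ m b - ?y ^ m b - real (m b) * t * ?y ^ (m b - 1))"
        using b by (simp add: mon P_shift d_eq inner_add_left algebra_simps)
      also have "\<bar>\<dots>\<bar> = \<bar>c m\<bar> * \<bar>P m x\<bar> * \<bar>(?y + t) ^ m b - ?y ^ m b - real (m b) * t * ?y ^ (m b - 1)\<bar>"
        by (simp add: abs_mult)
      also have "\<dots> \<le> \<bar>c m\<bar> * r ^ e m * (2 * t\<^sup>2 / \<rho>\<^sup>2 * (s + \<rho>) ^ m b)"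
        using x b \<rho> t s
        by (intro mult_mono mult_left_mono P_bound power_remainder_bound) (auto simp: cube_def)
      finally show ?thesis using \<rho> by (simp add: deg power_add mult_ac)
    qed
    have R: "((\<lambda>m. 2 * t\<^sup>2 / \<rho>\<^sup>2 * (\<bar>c m\<bar> * r ^ mdeg m)) has_sum (2 * t\<^sup>2 / \<rho>\<^sup>2 * N)) midx"
      by (rule has_sum_cmult_right[OF c(1)])
    have "norm (f (x + t *\<^sub>R b) + (- 1) * f x + (- t) * g x) \<le> 2 * t\<^sup>2 / \<rho>\<^sup>2 * N"
      by (rule norm_infsum_le[OF S R]) (use bd in auto)
    then show "\<bar>f (x + (0 + t) *\<^sub>R b) - f (x + 0 *\<^sub>R b) - g x * t\<bar> \<le> 2 / \<rho>\<^sup>2 * N * (norm t)\<^sup>2"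
      by (simp add: mult_ac)
  qed
  then show ?thesis using g unfolding d_def by blast
qed

text \<open>The terms of degree at most 1 form the affine part. A monomial of degree at least 2 is
  at most \<open>(norm h)\<^sup>2 / r\<^sup>2\<close> times its weight, so the tail is quadratically
  small.\<close>

lemma psb_differentiable:
  fixes f :: "'a::euclidean_space \<Rightarrow> real"
  assumes f: "psb r f K" and r: "0 < r"
  shows "f differentiable (at 0)"
proof -
  obtain c N where c: "((\<lambda>m. \<bar>c m\<bar> * r ^ mdeg m) has_sum N) midx" "N \<le> K"
    "\<And>x. x \<in> cube r \<Longrightarrow> ((\<lambda>m. c m * monomial m x) has_sum f x) midx"
    using f unfolding psb_def by blast
  define e where "e b = (\<lambda>_::'a. 0::nat)(b := 1)" for b
  have e_midx: "e b \<in> midx" if "b \<in> Basis" for b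
    using that by (auto simp: e_def midx_def)
  have e_inj: "inj_on e Basis"
    by (rule inj_onI) (auto simp: e_def fun_eq_iff split: if_splits)
  have e_nz: "e b \<noteq> (\<lambda>_. 0)" for b by (auto simp: e_def fun_eq_iff)
  have e_mon: "monomial (e b) x = x \<bullet> b" if "b \<in> Basis" for b x
    using monomial_upd_Suc[OF that, of "\<lambda>_. 0"] by (simp add: e_def)
  have z: "(\<lambda>_. 0) \<notin> e ` Basis" using e_nz by (metis imageE)
  \<comment> \<open>The multi-indices of degree at most 1: zero and the unit indices
    \<open>e b\<close>.\<close>
  let ?B = "insert (\<lambda>_. 0) (e ` Basis)"
  have low: "m \<in> ?B" if m: "m \<in> midx" "\<not> 2 \<le> mdeg m" for m
  proof (cases "mdeg m = 0")
    case False
    then have "mdeg m = Suc 0" using m by simp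
    then obtain b where b: "b \<in> Basis" "m b = 1" "\<forall>b'\<in>Basis. b \<noteq> b' \<longrightarrow> m b' = 0"
      unfolding mdeg_def by (subst (asm) sum_eq_Suc0_iff) auto
    have "m = e b"
    proof
      fix x show "m x = e b x" using b m(1) by (cases "x \<in> Basis") (auto simp: e_def midx_def)
    qed
    then show ?thesis using b by blast
  qed (use m midx_mdeg_eq_0 in blast)
  define F where "F h = (\<Sum>b\<in>Basis. c (e b) * (h \<bullet> b))" for h
  have F: "bounded_linear F"
    unfolding F_def by (intro bounded_linear_sum bounded_linear_const_mult bounded_linear_inner_left)
  have hs: "((\<lambda>m. if m \<in> ?B then c m * monomial m h else 0) has_sum (c (\<lambda>_. 0) + F h)) midx" for h
  proof (rule has_sum_finite_neutralI[of ?B])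
    have "(\<Sum>m\<in>?B. if m \<in> ?B then c m * monomial m h else 0) = (\<Sum>m\<in>?B. c m * monomial m h)"
      by (rule sum.cong) auto
    also have "\<dots> = c (\<lambda>_. 0) + (\<Sum>m\<in>e ` Basis. c m * monomial m h)"
      using z by (subst sum.insert) auto
    also have "(\<Sum>m\<in>e ` Basis. c m * monomial m h) = F h"
      by (simp add: sum.reindex[OF e_inj] e_mon F_def)
    finally show "c (\<lambda>_. 0) + F h = (\<Sum>m\<in>?B. if m \<in> ?B then c m * monomial m h else 0)" by simp
  qed (use e_midx in auto)
  have "(f has_derivative F) (at 0)"
  proof (rule has_derivative_quadratic_remainder[OF F r, where C = "N / r\<^sup>2"])
    fix h :: 'a assume h: "norm h < r"
    have hc: "h \<in> cube (norm h)" using Basis_le_norm[of _ h] by (simp add: cube_def)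
    then have hr: "h \<in> cube r" using h by (intro cube_mono[OF hc]) simp
    have "((\<lambda>m. c m * monomial m (0::'a)) has_sum c (\<lambda>_. 0)) midx"
      by (rule has_sum_finite_neutralI[of "{\<lambda>_. 0}"]) (auto simp: monomial_at_0)
    with c(3)[of 0] r have f0: "f 0 = c (\<lambda>_. 0)" by (auto dest: has_sum_unique)
    have S: "((\<lambda>m. c m * monomial m h + (- 1) * (if m \<in> ?B then c m * monomial m h else 0)) has_sum
        (f h + (- 1) * (c (\<lambda>_. 0) + F h))) midx"
      by (intro has_sum_add has_sum_cmult_right c(3) hr hs)
    have R: "((\<lambda>m. ((norm h)\<^sup>2 / r\<^sup>2) * (\<bar>c m\<bar> * r ^ mdeg m)) has_sum (((norm h)\<^sup>2 / r\<^sup>2) * N)) midx"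
      by (rule has_sum_cmult_right[OF c(1)])
    have "norm (f h + (- 1) * (c (\<lambda>_. 0) + F h)) \<le> ((norm h)\<^sup>2 / r\<^sup>2) * N"
    proof (rule norm_infsum_le[OF S R])
      fix m :: "'a \<Rightarrow> nat" assume m: "m \<in> midx"
      show "norm (c m * monomial m h + (- 1) * (if m \<in> ?B then c m * monomial m h else 0))
          \<le> ((norm h)\<^sup>2 / r\<^sup>2) * (\<bar>c m\<bar> * r ^ mdeg m)"
      proof (cases "m \<in> ?B")
        case False
        then have "2 \<le> mdeg m" using low m by blast
        then obtain k where k: "mdeg m = 2 + k" using le_Suc_ex by blast
        have "\<bar>monomial m h\<bar> \<le> norm h ^ mdeg m" by (rule monomial_bound[OF hc])
        also have "\<dots> = (norm h)\<^sup>2 * norm h ^ k" by (simp add: k power_add power2_eq_square)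
        also have "\<dots> \<le> (norm h)\<^sup>2 * r ^ k" using h by (intro mult_left_mono power_mono) auto
        also have "\<dots> = (norm h)\<^sup>2 / r\<^sup>2 * r ^ mdeg m" using r by (simp add: k power_add power2_eq_square)
        finally have "\<bar>c m\<bar> * \<bar>monomial m h\<bar> \<le> \<bar>c m\<bar> * ((norm h)\<^sup>2 / r\<^sup>2 * r ^ mdeg m)"
          by (intro mult_left_mono) auto
        then show ?thesis using False by (simp add: abs_mult mult_ac)
      qed (use r in auto)
    qed
    then show "\<bar>f (0 + h) - f 0 - F h\<bar> \<le> N / r\<^sup>2 * (norm h)\<^sup>2"
      by (simp add: f0 algebra_simps)
  qed
  then show ?thesis by (auto simp: differentiable_def)
qed

section \<open>Total and partial derivatives of analytic functions, chain rule along paths\<close>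

lemma real_analytic_on_differentiable:
  fixes f :: "'a::euclidean_space \<Rightarrow> real"
  assumes f: "real_analytic_on f S" and x: "x \<in> S"
  shows "f differentiable (at x)"
proof -
  obtain r K where "0 < r" "psb r (\<lambda>y. f (x + y)) K"
    using real_analytic_on_psbE[OF f x] .
  then have "(\<lambda>y. f (x + y)) differentiable (at 0)" by (intro psb_differentiable)
  then obtain F where F: "((\<lambda>y. f (x + y)) has_derivative F) (at (x - x))"
    by (auto simp: differentiable_def)
  have "((\<lambda>z. z - x) has_derivative (\<lambda>h. h)) (at x)"
    by (auto intro!: derivative_eq_intros)
  from diff_chain_at[OF this F] have "(f has_derivative F) (at x)" by (simp add: o_def)
  then show ?thesis by (auto simp: differentiable_def)
qed

lemma real_analytic_on_partial_derivative:
  fixes f :: "'a::euclidean_space \<Rightarrow> real"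
  assumes f: "real_analytic_on f S" and b: "b \<in> Basis"
  shows "real_analytic_on (\<lambda>x. deriv (\<lambda>t. f (x + t *\<^sub>R b)) 0) S"
  unfolding real_analytic_on_iff_psb
proof
  fix x assume x: "x \<in> S"
  obtain r K where r: "0 < r" "psb r (\<lambda>y. f (x + y)) K"
    using real_analytic_on_psbE[OF f x] .
  obtain c N where c: "((\<lambda>m. \<bar>c m\<bar> * r ^ mdeg m) has_sum N) midx"
    "\<And>y. y \<in> cube r \<Longrightarrow> ((\<lambda>m. c m * monomial m y) has_sum f (x + y)) midx"
    using r(2) unfolding psb_def by blast
  obtain g L where g: "psb (r / 2) g L"
    "\<And>y. y \<in> cube (r / 2) \<Longrightarrow> ((\<lambda>t. f (x + (y + t *\<^sub>R b))) has_real_derivative g y) (at 0)"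
    using psb_partial_derivative[OF c _ _ b, of "r / 2"] r by auto
  have "psb (r / 2) (\<lambda>y. deriv (\<lambda>t. f (x + y + t *\<^sub>R b)) 0) L"
    by (rule psb_cong[OF g(1)]) (simp add: add.assoc DERIV_imp_deriv[OF g(2)])
  then show "\<exists>r>0. \<exists>K. psb r (\<lambda>y. deriv (\<lambda>t. f (x + y + t *\<^sub>R b)) 0) K"
    using r by (intro exI[of _ "r / 2"]) auto
qed

lemma real_analytic_on_DERIV:
  fixes f :: "real \<Rightarrow> real"
  assumes "real_analytic_on f S" "x \<in> S"
  shows "(f has_real_derivative deriv f x) (at x)"
  using real_analytic_on_differentiable[OF assms] DERIV_deriv_iff_real_differentiable by blast

lemma real_analytic_on_deriv:
  fixes f :: "real \<Rightarrow> real"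
  assumes f: "real_analytic_on f S" and S: "open S"
  shows "real_analytic_on (deriv f) S"
proof (rule real_analytic_on_cong[OF real_analytic_on_partial_derivative[OF f, of 1] S])
  fix x assume x: "x \<in> S"
  have "(f has_real_derivative deriv f x) (at (0 + x))"
    using real_analytic_on_DERIV[OF f x] by simp
  then have "((\<lambda>t. f (x + t)) has_real_derivative deriv f x) (at 0)"
    unfolding DERIV_shift by (simp add: add.commute)
  then show "deriv (\<lambda>t. f (x + t *\<^sub>R 1)) 0 = deriv f x"
    by (simp add: DERIV_imp_deriv)
qed simp

lemma real_analytic_on_pd: "real_analytic_on f S \<Longrightarrow> real_analytic_on (pd i f) S"
  unfolding pd_def [abs_def] by (rule real_analytic_on_partial_derivative) simp_all

lemma real_analytic_on_vec_nth: "real_analytic_on (\<lambda>x::real^'n. x $ i) S"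
  using real_analytic_on_inner_Basis[of "axis i 1 :: real^'n" S] by (simp add: inner_axis)

lemma real_analytic_on_id_real: "real_analytic_on (\<lambda>x::real. x) S"
  using real_analytic_on_inner_Basis[of "1::real" S] by simp

lemma real_analytic_has_derivative_pd:
  fixes f :: "real^'n \<Rightarrow> real"
  assumes "real_analytic_on f S" "x \<in> S"
  shows "(f has_derivative (\<lambda>h. \<Sum>i\<in>UNIV. h $ i * pd i f x)) (at x)"
proof -
  obtain F where F: "(f has_derivative F) (at x)"
    using real_analytic_on_differentiable[OF assms] by (auto simp: differentiable_def)
  then have lin: "linear F" using has_derivative_linear by blast
  have pd: "pd i f x = F (axis i 1)" for i
  proof -
    have "((\<lambda>t::real. x + t *\<^sub>R axis i 1) has_derivative (\<lambda>t. t *\<^sub>R axis i 1)) (at 0)"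
      by (auto intro!: derivative_eq_intros)
    from diff_chain_at[OF this] F
    have "((\<lambda>t. f (x + t *\<^sub>R axis i 1)) has_derivative (\<lambda>t. F (t *\<^sub>R axis i 1))) (at 0)"
      by (simp add: o_def)
    then have "((\<lambda>t. f (x + t *\<^sub>R axis i 1)) has_real_derivative F (axis i 1)) (at 0)"
      by (simp add: has_field_derivative_def linear_scale[OF lin] mult.commute[of _ "F (axis i 1)"])
    then show ?thesis by (simp add: pd_def DERIV_imp_deriv)
  qed
  have "F h = (\<Sum>i\<in>UNIV. h $ i * pd i f x)" for h
  proof -
    have "F h = F (\<Sum>i\<in>UNIV. h $ i *\<^sub>R axis i 1)"
      using basis_expansion[of h] by (simp add: scalar_mult_eq_scaleR)
    then show ?thesis by (simp add: linear_sum[OF lin] linear_scale[OF lin] pd)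
  qed
  then have "F = (\<lambda>h. \<Sum>i\<in>UNIV. h $ i * pd i f x)" by blast
  then show ?thesis using F by simp
qed

lemma real_analytic_on_continuous:
  fixes f :: "'a::euclidean_space \<Rightarrow> real"
  assumes "real_analytic_on f S" "x \<in> S"
  shows "isCont f x"
  using real_analytic_on_differentiable[OF assms] by (rule differentiable_imp_continuous_within)

lemma real_analytic_DERIV_path:
  fixes f :: "real^'n \<Rightarrow> real"
  assumes "real_analytic_on f S" "\<gamma> t \<in> S" "(\<gamma> has_vector_derivative v) (at t)"
  shows "((\<lambda>t. f (\<gamma> t)) has_real_derivative (\<Sum>i\<in>UNIV. v $ i * pd i f (\<gamma> t))) (at t)"
proof -
  have "((\<lambda>t. f (\<gamma> t)) has_derivative (\<lambda>s. \<Sum>i\<in>UNIV. (s *\<^sub>R v) $ i * pd i f (\<gamma> t))) (at t)"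
    using diff_chain_at[OF assms(3)[unfolded has_vector_derivative_def]
        real_analytic_has_derivative_pd[OF assms(1,2)]] by (simp add: o_def)
  then show ?thesis
    unfolding has_field_derivative_def
    by (rule has_derivative_eq_rhs) (simp add: fun_eq_iff sum_distrib_left mult_ac)
qed

lemma sum_axis_mult: "(\<Sum>j\<in>UNIV. (axis i (1::real) :: real^'n) $ j * F j) = F i"
  by (simp add: axis_def if_distrib[of "\<lambda>x. x * _"] cong: if_cong)

lemma pd_DERIV_at:
  fixes f :: "real^'n \<Rightarrow> real"
  assumes "real_analytic_on f S" "x + t *\<^sub>R axis i 1 \<in> S"
  shows "((\<lambda>t. f (x + t *\<^sub>R axis i 1)) has_real_derivative pd i f (x + t *\<^sub>R axis i 1)) (at t)"
proof -
  have "((\<lambda>t. x + t *\<^sub>R axis i 1) has_vector_derivative axis i 1) (at t)"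
    by (auto intro!: derivative_eq_intros)
  from real_analytic_DERIV_path[OF assms(1) _ this] assms(2) show ?thesis
    by (simp add: sum_axis_mult)
qed

lemma pd_DERIV:
  fixes f :: "real^'n \<Rightarrow> real"
  assumes "real_analytic_on f S" "x \<in> S"
  shows "((\<lambda>t. f (x + t *\<^sub>R axis i 1)) has_real_derivative pd i f x) (at 0)"
  using pd_DERIV_at[of f S x 0 i] assms by simp

lemma pd_eqI: "((\<lambda>t. f (x + t *\<^sub>R axis i 1)) has_real_derivative D) (at 0) \<Longrightarrow> pd i f x = D"
  by (simp add: pd_def DERIV_imp_deriv)

lemma pd_cong_open:
  fixes f g :: "real^'n \<Rightarrow> real"
  assumes "open S" "x \<in> S" "\<And>y. y \<in> S \<Longrightarrow> f y = g y"
  shows "pd i f x = pd i g x"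
  unfolding pd_def
proof (rule deriv_cong_ev)
  have "isCont (\<lambda>t::real. x + t *\<^sub>R axis i 1) 0" by (intro continuous_intros)
  then have "((\<lambda>t::real. x + t *\<^sub>R axis i 1) \<longlongrightarrow> x) (nhds 0)"
    by (simp add: continuous_at tendsto_nhds_iff)
  then have "\<forall>\<^sub>F t in nhds 0. x + t *\<^sub>R axis i 1 \<in> S"
    using assms(1,2) topological_tendstoD by blast
  then show "\<forall>\<^sub>F t in nhds 0. f (x + t *\<^sub>R axis i 1) = g (x + t *\<^sub>R axis i 1)"
    by eventually_elim (rule assms(3))
qed simp

text \<open>The mean value theorem, applied first along \<open>i\<close> and then along
  \<open>j\<close>. The second difference itself is symmetric in \<open>i\<close> and
  \<open>j\<close>, so it can be compared with both orders of differentiation.\<close>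

lemma pd_second_difference:
  fixes f :: "real^'n \<Rightarrow> real"
  assumes f: "real_analytic_on f S" and t: "0 < t"
    and S: "\<And>a b. 0 \<le> a \<Longrightarrow> a \<le> t \<Longrightarrow> 0 \<le> b \<Longrightarrow> b \<le> t \<Longrightarrow> x + a *\<^sub>R axis i 1 + b *\<^sub>R axis j 1 \<in> S"
  shows "\<exists>a b. 0 < a \<and> a < t \<and> 0 < b \<and> b < t \<and>
    f (x + t *\<^sub>R axis i 1 + t *\<^sub>R axis j 1) - f (x + t *\<^sub>R axis i 1) - f (x + t *\<^sub>R axis j 1) + f x
      = t\<^sup>2 * pd j (pd i f) (x + a *\<^sub>R axis i 1 + b *\<^sub>R axis j 1)"
proof -
  define \<phi> where "\<phi> s = f (x + t *\<^sub>R axis j 1 + s *\<^sub>R axis i 1) - f (x + s *\<^sub>R axis i 1)" for s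
  define \<phi>' where "\<phi>' s = pd i f (x + t *\<^sub>R axis j 1 + s *\<^sub>R axis i 1) - pd i f (x + s *\<^sub>R axis i 1)" for s
  have "(\<phi> has_real_derivative \<phi>' s) (at s)" if "0 \<le> s" "s \<le> t" for s
    unfolding \<phi>_def \<phi>'_def
    by (intro DERIV_diff pd_DERIV_at[OF f]) (use S[of s t] S[of s 0] that t in \<open>auto simp: add_ac\<close>)
  from MVT2[OF t this] obtain a where a: "0 < a" "a < t" "\<phi> t - \<phi> 0 = (t - 0) * \<phi>' a" by blast
  have "((\<lambda>s. pd i f (x + a *\<^sub>R axis i 1 + s *\<^sub>R axis j 1)) has_real_derivative
      pd j (pd i f) (x + a *\<^sub>R axis i 1 + s *\<^sub>R axis j 1)) (at s)" if "0 \<le> s" "s \<le> t" for s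
    by (rule pd_DERIV_at[OF real_analytic_on_pd[OF f]]) (use S that a in auto)
  from MVT2[OF t this] obtain b where b: "0 < b" "b < t"
    "\<phi>' a = t * pd j (pd i f) (x + a *\<^sub>R axis i 1 + b *\<^sub>R axis j 1)"
    by (auto simp: \<phi>'_def add_ac)
  show ?thesis
    using a b by (intro exI[of _ a] exI[of _ b]) (simp add: \<phi>_def power2_eq_square add_ac)
qed

text \<open>Both mixed derivatives take a common value at suitable points arbitrarily close to
  \<open>x\<close>, namely a second difference divided by \<open>t\<^sup>2\<close>; continuity then
  makes them agree at \<open>x\<close>.\<close>

lemma pd_commute:
  fixes f :: "real^'n \<Rightarrow> real"
  assumes f: "real_analytic_on f S" and S: "open S" and x: "x \<in> S"
  shows "pd i (pd j f) x = pd j (pd i f) x"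
proof (rule ccontr)
  assume ne: "pd i (pd j f) x \<noteq> pd j (pd i f) x"
  define \<epsilon> where "\<epsilon> = \<bar>pd i (pd j f) x - pd j (pd i f) x\<bar> / 2"
  have \<epsilon>: "0 < \<epsilon>" using ne by (simp add: \<epsilon>_def)
  have "isCont (pd i (pd j f)) x" "isCont (pd j (pd i f)) x"
    using f x by (auto intro!: real_analytic_on_continuous real_analytic_on_pd)
  then obtain d1 d2 where d: "0 < d1" "\<And>y. dist y x < d1 \<Longrightarrow> dist (pd i (pd j f) y) (pd i (pd j f) x) < \<epsilon>"
    "0 < d2" "\<And>y. dist y x < d2 \<Longrightarrow> dist (pd j (pd i f) y) (pd j (pd i f) x) < \<epsilon>"
    using \<epsilon> unfolding continuous_at_eps_delta by metis
  obtain d3 where d3: "0 < d3" "ball x d3 \<subseteq> S" using S x open_contains_ball by blast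
  define \<delta> where "\<delta> = min d1 (min d2 d3)"
  \<comment> \<open>The intermediate points are displaced by at most 2 * t, which is less than
    \<delta>.\<close>
  define t where "t = \<delta> / 3"
  have t: "0 < t" using d d3 by (simp add: t_def \<delta>_def)
  have near: "dist (x + a *\<^sub>R axis k 1 + b *\<^sub>R axis l 1) x < \<delta>" if "0 \<le> a" "a \<le> t" "0 \<le> b" "b \<le> t" for a b k l
  proof -
    have "dist (x + a *\<^sub>R axis k 1 + b *\<^sub>R axis l 1) x = norm (a *\<^sub>R axis k 1 + b *\<^sub>R axis l 1 :: real^'n)"
      by (simp add: dist_norm)
    also have "\<dots> \<le> \<bar>a\<bar> + \<bar>b\<bar>"
      by (rule order_trans[OF norm_triangle_ineq]) (simp)
    finally show ?thesis using that t by (simp add: t_def)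
  qed
  have inS: "x + a *\<^sub>R axis k 1 + b *\<^sub>R axis l 1 \<in> S" if "0 \<le> a" "a \<le> t" "0 \<le> b" "b \<le> t" for a b k l
    using near[OF that, of k l] d3 by (auto simp: \<delta>_def dist_commute)
  obtain a b where ab: "0 < a" "a < t" "0 < b" "b < t"
    "f (x + t *\<^sub>R axis i 1 + t *\<^sub>R axis j 1) - f (x + t *\<^sub>R axis i 1) - f (x + t *\<^sub>R axis j 1) + f x
      = t\<^sup>2 * pd j (pd i f) (x + a *\<^sub>R axis i 1 + b *\<^sub>R axis j 1)"
    using pd_second_difference[OF f t inS] by blast
  obtain a' b' where ab': "0 < a'" "a' < t" "0 < b'" "b' < t"
    "f (x + t *\<^sub>R axis j 1 + t *\<^sub>R axis i 1) - f (x + t *\<^sub>R axis j 1) - f (x + t *\<^sub>R axis i 1) + f x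
      = t\<^sup>2 * pd i (pd j f) (x + a' *\<^sub>R axis j 1 + b' *\<^sub>R axis i 1)"
    using pd_second_difference[OF f t inS] by blast
  have "t\<^sup>2 * pd j (pd i f) (x + a *\<^sub>R axis i 1 + b *\<^sub>R axis j 1)
      = t\<^sup>2 * pd i (pd j f) (x + a' *\<^sub>R axis j 1 + b' *\<^sub>R axis i 1)"
    unfolding ab(5)[symmetric] ab'(5)[symmetric] by (simp add: add_ac)
  then have eq: "pd j (pd i f) (x + a *\<^sub>R axis i 1 + b *\<^sub>R axis j 1)
      = pd i (pd j f) (x + a' *\<^sub>R axis j 1 + b' *\<^sub>R axis i 1)"
    using t by simp
  have "dist (pd j (pd i f) (x + a *\<^sub>R axis i 1 + b *\<^sub>R axis j 1)) (pd j (pd i f) x) < \<epsilon>"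
    using near[of a b i j] ab by (intro d(4)) (simp add: \<delta>_def)
  moreover have "dist (pd i (pd j f) (x + a' *\<^sub>R axis j 1 + b' *\<^sub>R axis i 1)) (pd i (pd j f) x) < \<epsilon>"
    using near[of a' b' j i] ab' by (intro d(2)) (simp add: \<delta>_def)
  ultimately show False unfolding eq \<epsilon>_def dist_real_def by (simp add: abs_if split: if_splits)
qed

section \<open>Partial derivatives, primitives and implicit functions\<close>

lemma pd_add:
  assumes "real_analytic_on f S" "real_analytic_on g S" "x \<in> S"
  shows "pd i (\<lambda>x. f x + g x) x = pd i f x + pd i g x"
  by (rule pd_eqI[OF DERIV_add[OF pd_DERIV[OF assms(1,3)] pd_DERIV[OF assms(2,3)]]])

lemma pd_diff:
  assumes "real_analytic_on f S" "real_analytic_on g S" "x \<in> S"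
  shows "pd i (\<lambda>x. f x - g x) x = pd i f x - pd i g x"
  by (rule pd_eqI[OF DERIV_diff[OF pd_DERIV[OF assms(1,3)] pd_DERIV[OF assms(2,3)]]])

lemma pd_mult:
  assumes "real_analytic_on f S" "real_analytic_on g S" "x \<in> S"
  shows "pd i (\<lambda>x. f x * g x) x = pd i f x * g x + f x * pd i g x"
proof (rule pd_eqI)
  show "((\<lambda>t. f (x + t *\<^sub>R axis i 1) * g (x + t *\<^sub>R axis i 1)) has_real_derivative
      pd i f x * g x + f x * pd i g x) (at 0)"
    using DERIV_mult[OF pd_DERIV[OF assms(1,3), of i] pd_DERIV[OF assms(2,3), of i]]
    by (simp add: add.commute mult.commute)
qed

lemma pd_divide:
  assumes "real_analytic_on f S" "real_analytic_on g S" "x \<in> S" "g x \<noteq> 0"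
  shows "pd i (\<lambda>x. f x / g x) x = (pd i f x * g x - f x * pd i g x) / (g x * g x)"
proof (rule pd_eqI)
  show "((\<lambda>t. f (x + t *\<^sub>R axis i 1) / g (x + t *\<^sub>R axis i 1)) has_real_derivative
      (pd i f x * g x - f x * pd i g x) / (g x * g x)) (at 0)"
    using DERIV_divide[OF pd_DERIV[OF assms(1,3), of i] pd_DERIV[OF assms(2,3), of i]] assms(4) by simp
qed

lemma pd_sum:
  assumes "\<And>j. j \<in> J \<Longrightarrow> real_analytic_on (f j) S" "x \<in> S"
  shows "pd i (\<lambda>x. \<Sum>j\<in>J. f j x) x = (\<Sum>j\<in>J. pd i (f j) x)"
  by (rule pd_eqI, rule DERIV_sum, rule pd_DERIV[OF assms])

lemma pd_compose_real:
  fixes f :: "real \<Rightarrow> real"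
  assumes "real_analytic_on f T" "real_analytic_on g S" "x \<in> S" "g x \<in> T"
  shows "pd i (\<lambda>x. f (g x)) x = deriv f (g x) * pd i g x"
proof (rule pd_eqI)
  have "(f has_real_derivative deriv f (g x)) (at (g (x + 0 *\<^sub>R axis i 1)))"
    using real_analytic_on_DERIV[OF assms(1,4)] by simp
  from DERIV_chain2[OF this pd_DERIV[OF assms(2,3)]]
  show "((\<lambda>t. f (g (x + t *\<^sub>R axis i 1))) has_real_derivative deriv f (g x) * pd i g x) (at 0)" .
qed

lemma pd_coord_diff: "pd i (\<lambda>x::real^'n. x $ j - c) x = (if i = j then 1 else 0)"
  by (rule pd_eqI) (auto simp: axis_def intro!: derivative_eq_intros)

lemma real_analytic_on_coord_diff: "real_analytic_on (\<lambda>x::real^'n. x $ j - c) S"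
  by (intro real_analytic_on_diff real_analytic_on_vec_nth real_analytic_on_const)

lemmas real_analytic_intros = real_analytic_on_coord_diff real_analytic_on_const real_analytic_on_pd
  real_analytic_on_add real_analytic_on_diff real_analytic_on_mult real_analytic_on_sum

section \<open>Radial primitives and the analytic Poincare lemma\<close>

lemma has_sum_finite_sum:
  fixes f :: "'j \<Rightarrow> 'm \<Rightarrow> real"
  assumes "finite J" "\<And>j. j \<in> J \<Longrightarrow> (f j has_sum s j) M"
  shows "((\<lambda>m. \<Sum>j\<in>J. f j m) has_sum (\<Sum>j\<in>J. s j)) M"
  using assms by (induction J rule: finite_induct) (auto intro: has_sum_add)

text \<open>Termwise division by degree plus one inverts \<open>1 + E\<close>, with \<open>E\<close> the Euler operator.\<close>

lemma psb_radial_primitive: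
  fixes f :: "'a::euclidean_space \<Rightarrow> real"
  assumes f: "psb r f K" and s: "0 < s" "s < r"
  shows "\<exists>F. psb r F K \<and>
    (\<forall>x\<in>cube s. F x + (\<Sum>b\<in>Basis. (x \<bullet> b) * deriv (\<lambda>t. F (x + t *\<^sub>R b)) 0) = f x)"
proof -
  obtain c N where c: "((\<lambda>m. \<bar>c m\<bar> * r ^ mdeg m) has_sum N) midx" "N \<le> K"
    "\<And>x. x \<in> cube r \<Longrightarrow> ((\<lambda>m. c m * monomial m x) has_sum f x) midx"
    using f unfolding psb_def by blast
  have r: "0 < r" using s by simp
  define d where "d m = c m / (real (mdeg m) + 1)" for m
  have d_le: "\<bar>d m\<bar> * r ^ mdeg m \<le> \<bar>c m\<bar> * r ^ mdeg m" for m
  proof (rule mult_right_mono)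
    have "\<bar>c m\<bar> * 1 \<le> \<bar>c m\<bar> * (real (mdeg m) + 1)" by (rule mult_left_mono) auto
    then show "\<bar>d m\<bar> \<le> \<bar>c m\<bar>" by (simp add: d_def divide_simps)
  qed (use r in simp)
  have "(\<lambda>m. \<bar>d m\<bar> * r ^ mdeg m) summable_on midx"
    using d_le r by (intro summable_on_comparison_test[OF has_sum_imp_summable[OF c(1)]]) auto
  then obtain D where D: "((\<lambda>m. \<bar>d m\<bar> * r ^ mdeg m) has_sum D) midx"
    by (auto simp: summable_on_def)
  have "psb r (\<lambda>x. d m * monomial m x) (\<bar>d m\<bar> * r ^ mdeg m)" for m :: "'a \<Rightarrow> nat"
    using r by (intro psb_cmult psb_monomial) simp
  note F = psb_infsum[OF r this D]
  define F where "F x = infsum (\<lambda>m. d m * monomial m x) midx" for x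
  note F = F[folded F_def]
  have "F x + (\<Sum>b\<in>Basis. (x \<bullet> b) * deriv (\<lambda>t. F (x + t *\<^sub>R b)) 0) = f x" if x: "x \<in> cube s" for x
  proof -
    have xr: "x \<in> cube r" using cube_mono[OF x] s by simp
    have b: "((\<lambda>m. d m * real (m b) * monomial m x) has_sum (x \<bullet> b) * deriv (\<lambda>t. F (x + t *\<^sub>R b)) 0) midx"
      if b: "b \<in> Basis" for b
    proof -
      obtain g where g: "((\<lambda>t. F (x + t *\<^sub>R b)) has_real_derivative g x) (at 0)"
        "((\<lambda>m. d m * (real (m b) * monomial (m(b := m b - 1)) x)) has_sum g x) midx"
        using psb_partial_derivative[OF D F(2) s b] x by blast
      \<comment> \<open>Monomials are eigenfunctions: x_b times the derivative in x_b multiplies the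
        term of index \<open>m\<close> by \<open>m b\<close>, so the Euler operator multiplies it by
        its degree.\<close>
      have eq: "(x \<bullet> b) * (d m * (real (m b) * monomial (m(b := m b - 1)) x)) = d m * real (m b) * monomial m x" for m
      proof (cases "m b = 0")
        case False
        then have "(m(b := m b - 1))(b := Suc ((m(b := m b - 1)) b)) = m" by auto
        then have "monomial m x = (x \<bullet> b) * monomial (m(b := m b - 1)) x"
          using monomial_upd_Suc[OF b, of "m(b := m b - 1)" x] by simp
        then show ?thesis by simp
      qed simp
      show ?thesis
        using has_sum_cmult_right[OF g(2), of "x \<bullet> b"] unfolding eq DERIV_imp_deriv[OF g(1)] .
    qed
    have "((\<lambda>m. d m * monomial m x + (\<Sum>b\<in>Basis. d m * real (m b) * monomial m x)) has_sum
        (F x + (\<Sum>b\<in>Basis. (x \<bullet> b) * deriv (\<lambda>t. F (x + t *\<^sub>R b)) 0))) midx"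
      by (intro has_sum_add F(2) xr has_sum_finite_sum b) auto
    moreover have "d m * monomial m x + (\<Sum>b\<in>Basis. d m * real (m b) * monomial m x) = c m * monomial m x" for m
    proof -
      have "(\<Sum>b\<in>Basis. d m * real (m b) * monomial m x) = d m * real (mdeg m) * monomial m x"
        by (simp add: mdeg_def sum_distrib_left sum_distrib_right)
      then have "d m * monomial m x + (\<Sum>b\<in>Basis. d m * real (m b) * monomial m x)
          = (d m * (real (mdeg m) + 1)) * monomial m x"
        by (simp add: algebra_simps)
      also have "d m * (real (mdeg m) + 1) = c m"
      proof -
        have "real (mdeg m) + 1 \<noteq> 0" by linarith
        then show ?thesis by (simp add: d_def)
      qed
      finally show ?thesis .
    qed
    ultimately show ?thesis using has_sum_unique[OF _ c(3)[OF xr]] by simp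
  qed
  moreover have "psb r F K"
    using psb_mono[OF F(1)] has_sum_mono[OF D c(1) d_le] c(2) by simp
  ultimately show ?thesis by blast
qed

lemma Basis_vec_real: "(Basis :: (real^'n) set) = range (\<lambda>i. axis i 1)"
  by (auto simp: Basis_vec_def)

lemma real_analytic_radial_primitive:
  fixes f :: "real^'n \<Rightarrow> real"
  assumes f: "real_analytic_on f S" and x0: "x0 \<in> S"
  shows "\<exists>r>0. \<exists>F. real_analytic_on F (ball x0 r) \<and>
    (\<forall>x\<in>ball x0 r. F x + (\<Sum>i\<in>UNIV. (x $ i - x0 $ i) * pd i F x) = f x)"
proof -
  obtain r K where r: "0 < r" "psb r (\<lambda>y. f (x0 + y)) K"
    using real_analytic_on_psbE[OF f x0] .
  then obtain G where G: "psb r G K" "\<And>y. y \<in> cube (r / 2) \<Longrightarrow>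
      G y + (\<Sum>b\<in>Basis. (y \<bullet> b) * deriv (\<lambda>t. G (y + t *\<^sub>R b)) 0) = f (x0 + y)"
    using psb_radial_primitive[OF r(2), of "r / 2"] by auto
  define F where "F x = G (x - x0)" for x
  have "real_analytic_on F (ball x0 r)"
    using G(1) by (intro psb_imp_real_analytic_on_ball[of r F x0 K]) (simp add: F_def)
  then have an: "real_analytic_on F (ball x0 (r / 2))"
    by (rule real_analytic_on_subset) (use r in auto)
  have "F x + (\<Sum>i\<in>UNIV. (x $ i - x0 $ i) * pd i F x) = f x" if "x \<in> ball x0 (r / 2)" for x
  proof -
    have "x - x0 \<in> cube (r / 2)"
      using that ball_subset_cube[of "r / 2"] by (force simp: dist_norm norm_minus_commute)
    from G(2)[OF this]
    have "F x + (\<Sum>b\<in>Basis. ((x - x0) \<bullet> b) * deriv (\<lambda>t. G (x - x0 + t *\<^sub>R b)) 0) = f x"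
      by (simp add: F_def)
    moreover have "(\<Sum>b\<in>Basis. ((x - x0) \<bullet> b) * deriv (\<lambda>t. G (x - x0 + t *\<^sub>R b)) 0)
        = (\<Sum>i\<in>UNIV. (x $ i - x0 $ i) * pd i F x)"
    proof -
      have "inj (\<lambda>i::'n. axis i (1::real))" by (auto simp: inj_def axis_eq_axis)
      then show ?thesis
        unfolding Basis_vec_real
        by (subst sum.reindex) (auto simp: inner_axis pd_def F_def algebra_simps)
    qed
    ultimately show ?thesis by simp
  qed
  with an r show ?thesis by (intro exI[of _ "r / 2"]) auto
qed

text \<open>The usual homotopy formula without integrals. Let E be the Euler operator centred at
  \<open>x0\<close>. The solution \<open>R i\<close> of (1 + E) R_i = \<omega>_i stands for the
  integral of \<omega>_i over the ray from \<open>x0\<close>, and H = sum of (x_j - x0_j) R_j. If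
  \<open>R\<close> is closed as well, then pd_i H = R_i + E R_i = \<omega>_i.\<close>

lemma poincare_lemma_analytic:
  fixes \<omega> :: "'n::finite \<Rightarrow> real^'n \<Rightarrow> real"
  assumes an: "\<And>i. real_analytic_on (\<omega> i) S" and S: "open S" and x0: "x0 \<in> S"
    and closed: "\<And>i j x. x \<in> S \<Longrightarrow> pd i (\<omega> j) x = pd j (\<omega> i) x"
  shows "\<exists>r>0. \<exists>H. ball x0 r \<subseteq> S \<and> real_analytic_on H (ball x0 r) \<and> H x0 = 0 \<and>
    (\<forall>x\<in>ball x0 r. \<forall>i. pd i H x = \<omega> i x)"
proof -
  define A where "A i r F \<longleftrightarrow> 0 < r \<and> real_analytic_on F (ball x0 r) \<and>
    (\<forall>x\<in>ball x0 r. F x + (\<Sum>k\<in>UNIV. (x $ k - x0 $ k) * pd k F x) = \<omega> i x)" for i r F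
  have "\<forall>i. \<exists>r. \<exists>F. A i r F"
    unfolding A_def using real_analytic_radial_primitive[OF an x0] by blast
  from choice[OF this] obtain \<rho> where "\<forall>i. \<exists>F. A i (\<rho> i) F" ..
  from choice[OF this] obtain R where "\<forall>i. A i (\<rho> i) (R i)" ..
  then have R: "\<And>i. 0 < \<rho> i" "\<And>i. real_analytic_on (R i) (ball x0 (\<rho> i))"
    "\<And>i x. x \<in> ball x0 (\<rho> i) \<Longrightarrow> R i x + (\<Sum>k\<in>UNIV. (x $ k - x0 $ k) * pd k (R i) x) = \<omega> i x"
    unfolding A_def by blast+
  obtain \<epsilon> where \<epsilon>: "0 < \<epsilon>" "ball x0 \<epsilon> \<subseteq> S" using S x0 open_contains_ball by blast
  define r where "r = Min (insert \<epsilon> (range \<rho>))"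
  have r: "0 < r" unfolding r_def using R(1) \<epsilon> by (subst Min_gr_iff) auto
  have r_le: "r \<le> \<rho> i" for i unfolding r_def by (rule Min_le) auto
  have "r \<le> \<epsilon>" unfolding r_def by (rule Min_le) auto
  then have BS: "ball x0 r \<subseteq> S" using \<epsilon> by auto
  let ?B = "ball x0 r"
  have Ran: "real_analytic_on (R i) ?B" for i
    using real_analytic_on_subset[OF R(2)] r_le by (simp add: subset_ball)
  have Req: "R i x + (\<Sum>k\<in>UNIV. (x $ k - x0 $ k) * pd k (R i) x) = \<omega> i x" if "x \<in> ?B" for i x
    using R(3)[of x i] that subset_ball[OF r_le[of i]] by blast
  \<comment> \<open>Differentiation commutes with E up to one extra copy of itself, so (1 + E)
    becomes (2 + E).\<close>
  have curl_eq: "2 * pd i (R j) x + (\<Sum>k\<in>UNIV. (x $ k - x0 $ k) * pd k (pd i (R j)) x) = pd i (\<omega> j) x"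
    if x: "x \<in> ?B" for i j x
  proof -
    have an': "real_analytic_on (\<lambda>x. \<Sum>k\<in>UNIV. (x $ k - x0 $ k) * pd k (R j) x) ?B"
      by (intro real_analytic_intros Ran)
    have "pd i (\<omega> j) x = pd i (\<lambda>x. R j x + (\<Sum>k\<in>UNIV. (x $ k - x0 $ k) * pd k (R j) x)) x"
      using Req by (intro pd_cong_open[of ?B]) (use x in auto)
    also have "\<dots> = pd i (R j) x + pd i (\<lambda>x. \<Sum>k\<in>UNIV. (x $ k - x0 $ k) * pd k (R j) x) x"
      by (rule pd_add[OF Ran an' x])
    also have "pd i (\<lambda>x. \<Sum>k\<in>UNIV. (x $ k - x0 $ k) * pd k (R j) x) x
        = (\<Sum>k\<in>UNIV. pd i (\<lambda>x. (x $ k - x0 $ k) * pd k (R j) x) x)"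
      by (rule pd_sum[OF _ x]) (intro real_analytic_intros Ran)
    also have "(\<Sum>k\<in>UNIV. pd i (\<lambda>x. (x $ k - x0 $ k) * pd k (R j) x) x)
        = (\<Sum>k\<in>UNIV. (if i = k then pd k (R j) x else 0) + (x $ k - x0 $ k) * pd k (pd i (R j)) x)"
    proof (rule sum.cong)
      fix k
      have "pd i (\<lambda>x. (x $ k - x0 $ k) * pd k (R j) x) x
          = pd i (\<lambda>x. x $ k - x0 $ k) x * pd k (R j) x + (x $ k - x0 $ k) * pd i (pd k (R j)) x"
        by (rule pd_mult[OF _ _ x]) (intro real_analytic_intros Ran)+
      then show "pd i (\<lambda>x. (x $ k - x0 $ k) * pd k (R j) x) x
          = (if i = k then pd k (R j) x else 0) + (x $ k - x0 $ k) * pd k (pd i (R j)) x"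
        using pd_commute[OF Ran open_ball x, of i k] by (simp add: pd_coord_diff)
    qed simp
    also have "\<dots> = pd i (R j) x + (\<Sum>k\<in>UNIV. (x $ k - x0 $ k) * pd k (pd i (R j)) x)"
      by (simp add: sum.distrib)
    finally show ?thesis by simp
  qed
  have curl: "pd i (R j) x = pd j (R i) x" if x: "x \<in> ?B" for i j x
  proof -
    \<comment> \<open>Closedness of \<omega> gives (2 + E) P = 0 for this component of the curl of
      \<open>R\<close>.\<close>
    define P where "P x = pd i (R j) x - pd j (R i) x" for x
    have Pan: "real_analytic_on P ?B" unfolding P_def by (intro real_analytic_intros Ran)
    have P: "2 * P z + (\<Sum>k\<in>UNIV. (z $ k - x0 $ k) * pd k P z) = 0" if z: "z \<in> ?B" for z
    proof -
      have pdP: "pd k P z = pd k (pd i (R j)) z - pd k (pd j (R i)) z" for k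
        unfolding P_def by (rule pd_diff[OF _ _ z]) (intro real_analytic_intros Ran)+
      have sum: "(\<Sum>k\<in>UNIV. (z $ k - x0 $ k) * pd k P z)
          = (\<Sum>k\<in>UNIV. (z $ k - x0 $ k) * pd k (pd i (R j)) z) - (\<Sum>k\<in>UNIV. (z $ k - x0 $ k) * pd k (pd j (R i)) z)"
        by (simp only: pdP right_diff_distrib sum_subtractf)
      have "2 * P z + (\<Sum>k\<in>UNIV. (z $ k - x0 $ k) * pd k P z)
          = (2 * pd i (R j) z + (\<Sum>k\<in>UNIV. (z $ k - x0 $ k) * pd k (pd i (R j)) z))
            - (2 * pd j (R i) z + (\<Sum>k\<in>UNIV. (z $ k - x0 $ k) * pd k (pd j (R i)) z))"
        unfolding sum by (simp add: P_def)
      also have "\<dots> = pd i (\<omega> j) z - pd j (\<omega> i) z" unfolding curl_eq[OF z] ..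
      also have "\<dots> = 0" using closed[of z i j] BS z by auto
      finally show ?thesis .
    qed
    \<comment> \<open>The factor \<open>\<tau>\<^sup>2\<close> integrates (2 + E) P = 0 along the
      ray: \<psi> is constant there and vanishes at \<tau> = 0, hence P = 0.\<close>
    define \<psi> where "\<psi> \<tau> = \<tau>\<^sup>2 * P (x0 + \<tau> *\<^sub>R (x - x0))" for \<tau>
    have "(\<psi> has_real_derivative 0) (at \<tau>)" if \<tau>: "0 \<le> \<tau>" "\<tau> \<le> 1" for \<tau>
    proof -
      let ?z = "x0 + \<tau> *\<^sub>R (x - x0)"
      have z: "?z \<in> ?B"
      proof -
        have "norm (\<tau> *\<^sub>R (x - x0)) \<le> norm (x - x0)"
          using \<tau> by (simp add: mult_left_le_one_le)
        then show ?thesis using x by (simp add: dist_norm norm_minus_commute)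
      qed
      have "((\<lambda>\<tau>. x0 + \<tau> *\<^sub>R (x - x0)) has_vector_derivative (x - x0)) (at \<tau>)"
        by (auto intro!: derivative_eq_intros)
      from real_analytic_DERIV_path[OF Pan z this]
      have D: "((\<lambda>\<tau>. P (x0 + \<tau> *\<^sub>R (x - x0))) has_real_derivative
        (\<Sum>k\<in>UNIV. (x - x0) $ k * pd k P ?z)) (at \<tau>)" .
      have "(\<psi> has_real_derivative (2 * \<tau> * P ?z + \<tau>\<^sup>2 * (\<Sum>k\<in>UNIV. (x - x0) $ k * pd k P ?z))) (at \<tau>)"
        unfolding \<psi>_def by (rule derivative_eq_intros D refl)+ (simp add: algebra_simps)
      moreover have "2 * \<tau> * P ?z + \<tau>\<^sup>2 * (\<Sum>k\<in>UNIV. (x - x0) $ k * pd k P ?z)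
          = \<tau> * (2 * P ?z + (\<Sum>k\<in>UNIV. (?z $ k - x0 $ k) * pd k P ?z))"
        by (simp add: power2_eq_square sum_distrib_left algebra_simps)
      ultimately show ?thesis using P[OF z] by simp
    qed
    then have "\<psi> 1 = \<psi> 0"
      using MVT2[of 0 1 \<psi> "\<lambda>_. 0"] by force
    then show ?thesis by (simp add: \<psi>_def P_def)
  qed
  define H where "H x = (\<Sum>j\<in>UNIV. (x $ j - x0 $ j) * R j x)" for x
  have "real_analytic_on H ?B" unfolding H_def by (intro real_analytic_intros Ran)
  moreover have "pd i H x = \<omega> i x" if x: "x \<in> ?B" for i x
  proof -
    have "pd i H x = (\<Sum>j\<in>UNIV. pd i (\<lambda>x. (x $ j - x0 $ j) * R j x) x)"
      unfolding H_def by (rule pd_sum[OF _ x]) (intro real_analytic_intros Ran)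
    also have "\<dots> = (\<Sum>j\<in>UNIV. (if i = j then R j x else 0) + (x $ j - x0 $ j) * pd j (R i) x)"
    proof (rule sum.cong)
      fix j
      have "pd i (\<lambda>x. (x $ j - x0 $ j) * R j x) x
          = pd i (\<lambda>x. x $ j - x0 $ j) x * R j x + (x $ j - x0 $ j) * pd i (R j) x"
        by (rule pd_mult[OF _ _ x]) (intro real_analytic_intros Ran)+
      then show "pd i (\<lambda>x. (x $ j - x0 $ j) * R j x) x
          = (if i = j then R j x else 0) + (x $ j - x0 $ j) * pd j (R i) x"
        using curl[OF x, of i j] by (simp add: pd_coord_diff)
    qed simp
    also have "\<dots> = \<omega> i x" using Req[OF x, of i] by (simp add: sum.distrib)
    finally show ?thesis .
  qed
  moreover have "H x0 = 0" by (simp add: H_def)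
  ultimately show ?thesis using r BS by blast
qed

section \<open>Analytic implicit functions by contraction\<close>

lemma psb_power_diff:
  fixes \<sigma> \<sigma>' :: "'a::euclidean_space \<Rightarrow> real"
  assumes r: "0 < r" and \<sigma>: "psb r \<sigma> q" and \<sigma>': "psb r \<sigma>' q" and \<delta>: "psb r (\<lambda>y. \<sigma> y - \<sigma>' y) \<delta>"
  shows "psb r (\<lambda>y. \<sigma> y ^ k - \<sigma>' y ^ k) (real k * q ^ (k - 1) * \<delta>)"
proof (induction k)
  case 0
  show ?case using psb_const[of r 0] by simp
next
  case (Suc k)
  have *: "psb r (\<lambda>y. \<sigma> y * (\<sigma> y ^ k - \<sigma>' y ^ k) + (\<sigma> y - \<sigma>' y) * \<sigma>' y ^ k)
      (q * (real k * q ^ (k - 1) * \<delta>) + \<delta> * q ^ k)"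
    by (intro psb_add psb_mult psb_power r \<sigma> \<sigma>' \<delta> Suc)
  have eqK: "q * (real k * q ^ (k - 1) * \<delta>) + \<delta> * q ^ k = real (Suc k) * q ^ (Suc k - 1) * \<delta>"
    by (cases k) (auto simp: algebra_simps)
  have eqf: "(\<lambda>y. \<sigma> y * (\<sigma> y ^ k - \<sigma>' y ^ k) + (\<sigma> y - \<sigma>' y) * \<sigma>' y ^ k)
      = (\<lambda>y. \<sigma> y ^ Suc k - \<sigma>' y ^ Suc k)"
    by (simp add: fun_eq_iff algebra_simps)
  show ?case using * unfolding eqf eqK .
qed

text \<open>Composition with \<open>g\<close> is Lipschitz on the norm ball of radius
  \<open>q\<close>. Termwise, k * q^(k - 1) is at most R^k / (R - q), the Cauchy estimate for the
  derivative of \<open>g\<close>.\<close>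

lemma psb_compose_lipschitz:
  fixes \<sigma> \<sigma>' :: "'a::euclidean_space \<Rightarrow> real" and g :: "real \<Rightarrow> real"
  assumes r: "0 < r" and g: "psb R g K" and q: "0 \<le> q" "q < R"
    and \<sigma>: "psb r \<sigma> q" and \<sigma>': "psb r \<sigma>' q" and \<delta>: "psb r (\<lambda>y. \<sigma> y - \<sigma>' y) \<delta>"
  shows "psb r (\<lambda>y. g (\<sigma> y) - g (\<sigma>' y)) (\<delta> / (R - q) * K)"
proof -
  obtain c N where c: "((\<lambda>m. \<bar>c m\<bar> * R ^ mdeg m) has_sum N) midx" "N \<le> K"
    "\<And>x. x \<in> cube R \<Longrightarrow> ((\<lambda>m. c m * monomial m x) has_sum g x) midx"
    using g unfolding psb_def by blast
  have \<delta>0: "0 \<le> \<delta>" using psb_nonneg[OF \<delta>] r by simp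
  have cubeR: "\<sigma> y \<in> cube R" "\<sigma>' y \<in> cube R" if "y \<in> cube r" for y
    using psb_bound[OF \<sigma> that] psb_bound[OF \<sigma>' that] q by (auto simp: cube_def)
  have "psb r (\<lambda>y. g (\<sigma> y) - g (\<sigma>' y)) (\<delta> / (R - q) * N)"
  proof (rule psb_has_sum[OF r])
    show "((\<lambda>m. \<delta> / (R - q) * (\<bar>c m\<bar> * R ^ mdeg m)) has_sum (\<delta> / (R - q) * N)) midx"
      by (rule has_sum_cmult_right[OF c(1)])
    fix m :: "real \<Rightarrow> nat"
    have "psb r (\<lambda>y. c m * (\<sigma> y ^ m 1 - \<sigma>' y ^ m 1)) (\<bar>c m\<bar> * (real (m 1) * q ^ (m 1 - 1) * \<delta>))"
      by (intro psb_cmult psb_power_diff r \<sigma> \<sigma>' \<delta>)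
    moreover have "\<bar>c m\<bar> * (real (m 1) * q ^ (m 1 - 1) * \<delta>) \<le> \<delta> / (R - q) * (\<bar>c m\<bar> * R ^ mdeg m)"
    proof -
      have "real (m 1) * q ^ (m 1 - 1) * (R - q) \<le> R ^ m 1"
        using power_derivative_bound[of q "R - q" "m 1"] q by simp
      then have "real (m 1) * q ^ (m 1 - 1) \<le> R ^ m 1 / (R - q)"
        using q by (simp add: pos_le_divide_eq)
      then have "\<bar>c m\<bar> * \<delta> * (real (m 1) * q ^ (m 1 - 1)) \<le> \<bar>c m\<bar> * \<delta> * (R ^ m 1 / (R - q))"
        using \<delta>0 by (intro mult_left_mono) auto
      then show ?thesis by (simp add: mdeg_def mult_ac)
    qed
    ultimately show "psb r (\<lambda>y. c m * (\<sigma> y ^ m 1 - \<sigma>' y ^ m 1)) (\<delta> / (R - q) * (\<bar>c m\<bar> * R ^ mdeg m))"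
      by (rule psb_mono)
  next
    fix y :: 'a assume y: "y \<in> cube r"
    have "((\<lambda>m. c m * monomial m (\<sigma> y) + (- 1) * (c m * monomial m (\<sigma>' y))) has_sum
        (g (\<sigma> y) + (- 1) * g (\<sigma>' y))) midx"
      by (intro has_sum_add has_sum_cmult_right c(3) cubeR y)
    then show "((\<lambda>m. c m * (\<sigma> y ^ m 1 - \<sigma>' y ^ m 1)) has_sum (g (\<sigma> y) - g (\<sigma>' y))) midx"
      by (simp add: monomial_def algebra_simps)
  qed
  then show ?thesis
    by (rule psb_mono) (use c(2) \<delta>0 q in \<open>intro mult_left_mono, auto\<close>)
qed

text \<open>Contraction in the power series norm, which keeps the fixed point analytic.\<close>

lemma analytic_implicit_function:
  fixes C :: "'n::finite \<Rightarrow> real \<Rightarrow> real" and x0 :: "real^'n"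
  assumes C: "\<And>j. j \<noteq> k \<Longrightarrow> real_analytic_on (C j) I" and I: "open I" "x0 $ k \<in> I"
  shows "\<exists>r>0. \<exists>s. real_analytic_on s (ball x0 r) \<and>
    (\<forall>x\<in>ball x0 r. s x \<in> I \<and> s x = x $ k + (\<Sum>j\<in>UNIV - {k}. (x $ j - x0 $ j) * C j (s x)))"
proof -
  define z where "z = x0 $ k"
  let ?J = "UNIV - {k}"
  obtain \<epsilon> where \<epsilon>: "0 < \<epsilon>" "ball z \<epsilon> \<subseteq> I" using I open_contains_ball unfolding z_def by blast
  have "\<forall>j\<in>?J. \<exists>r. 0 < r \<and> (\<exists>K. psb r (\<lambda>h. C j (z + h)) K)"
    using C I unfolding real_analytic_on_iff_psb z_def by blast
  from bchoice[OF this] obtain \<rho> where \<rho>: "\<forall>j\<in>?J. 0 < \<rho> j \<and> (\<exists>K. psb (\<rho> j) (\<lambda>h. C j (z + h)) K)" ..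
  then have "\<forall>j\<in>?J. \<exists>K. psb (\<rho> j) (\<lambda>h. C j (z + h)) K" by blast
  from bchoice[OF this] obtain K where K: "\<forall>j\<in>?J. psb (\<rho> j) (\<lambda>h. C j (z + h)) (K j)" ..
  define R where "R = Min (insert \<epsilon> (\<rho> ` ?J))"
  have R: "0 < R" unfolding R_def using \<rho> \<epsilon> by (subst Min_gr_iff) auto
  have KR: "psb R (\<lambda>h. C j (z + h)) (K j)" if "j \<in> ?J" for j
  proof (rule psb_shrink[OF K[rule_format, OF that]])
    show "R \<le> \<rho> j" unfolding R_def by (rule Min_le) (use that in auto)
  qed (use R in simp)
  have "R \<le> \<epsilon>" unfolding R_def by (rule Min_le) auto
  then have RI: "ball z R \<subseteq> I" using \<epsilon> by auto
  define D where "D = (\<Sum>j\<in>?J. K j)"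
  have K0: "0 \<le> K j" if "j \<in> ?J" for j using psb_nonneg[OF KR[OF that]] R by simp
  have D0: "0 \<le> D" unfolding D_def by (rule sum_nonneg) (use K0 in auto)
  \<comment> \<open>Makes \<open>r + r * D \<le> R / 2\<close>, so that \<open>T\<close> preserves
    the norm ball of radius \<open>R / 2\<close>, and \<open>r * D \<le> R / 4\<close>, so that
    \<open>T\<close> halves distances there.\<close>
  define r where "r = R / (4 * (1 + D))"
  have r: "0 < r" using R D0 by (simp add: r_def)
  have rD: "r * (1 + D) = R / 4" using D0 by (simp add: r_def field_simps)
  have rD': "r * D \<le> R / 4" "r + r * D \<le> R / 2"
    using rD r D0 R by (simp_all add: algebra_simps)
  have coord: "psb r (\<lambda>y::real^'n. y $ j) r" for j
    using psb_coord[of r "axis j 1 :: real^'n"] r by (simp add: inner_axis)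
  \<comment> \<open>The unknown is the deviation of \<open>s\<close> from \<open>x0 $ k\<close>, as
    a function of \<open>y = x - x0\<close>; the implicit equation becomes the fixed point equation
    of \<open>T\<close>.\<close>
  define T where "T \<sigma> y = y $ k + (\<Sum>j\<in>?J. y $ j * C j (z + \<sigma> y))" for \<sigma> and y :: "real^'n"
  have T_psb: "psb r (T \<sigma>) (R / 2)" if \<sigma>: "psb r \<sigma> (R / 2)" for \<sigma>
  proof -
    have "psb r (\<lambda>y. C j (z + \<sigma> y)) (K j)" if j: "j \<in> ?J" for j
    proof (rule psb_compose[OF r KR[OF j]])
      show "psb r (\<lambda>y. \<sigma> y \<bullet> b) R" if "b \<in> Basis" for b :: real
        using psb_mono[OF \<sigma>, of R] that R by simp
    qed
    then have "psb r (T \<sigma>) (r + (\<Sum>j\<in>?J. r * K j))"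
      unfolding T_def [abs_def] by (intro psb_add psb_sum psb_mult r coord) auto
    then show ?thesis by (rule psb_mono) (use rD' in \<open>simp add: D_def sum_distrib_left\<close>)
  qed
  have T_lip: "psb r (\<lambda>y. T \<sigma> y - T \<sigma>' y) (\<delta> / 2)"
    if \<sigma>: "psb r \<sigma> (R / 2)" and \<sigma>': "psb r \<sigma>' (R / 2)" and \<delta>: "psb r (\<lambda>y. \<sigma> y - \<sigma>' y) \<delta>" for \<sigma> \<sigma>' \<delta>
  proof -
    have \<delta>0: "0 \<le> \<delta>" using psb_nonneg[OF \<delta>] r by simp
    have *: "psb r (\<lambda>y. \<Sum>j\<in>?J. y $ j * (C j (z + \<sigma> y) - C j (z + \<sigma>' y))) (\<Sum>j\<in>?J. r * (\<delta> / (R - R / 2) * K j))"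
      by (intro psb_sum psb_mult r coord psb_compose_lipschitz[where g = "\<lambda>h. C _ (z + h)"] KR \<sigma> \<sigma>' \<delta>)
        (use R in auto)
    have eqT: "(\<lambda>y. \<Sum>j\<in>?J. y $ j * (C j (z + \<sigma> y) - C j (z + \<sigma>' y))) = (\<lambda>y. T \<sigma> y - T \<sigma>' y)"
      by (simp add: T_def fun_eq_iff algebra_simps sum_subtractf)
    have le: "(\<Sum>j\<in>?J. r * (\<delta> / (R - R / 2) * K j)) \<le> \<delta> / 2"
    proof -
      have "(\<Sum>j\<in>?J. r * (\<delta> / (R - R / 2) * K j)) = \<delta> * (2 / R) * (r * D)"
        by (simp add: D_def sum_distrib_left mult_ac)
      also have "\<dots> \<le> \<delta> * (2 / R) * (R / 4)"
        using rD' \<delta>0 R by (intro mult_left_mono) auto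
      finally show ?thesis using R by simp
    qed
    show ?thesis by (rule psb_mono[OF *[unfolded eqT] le])
  qed
  define \<sigma> where "\<sigma> n = (T ^^ n) (\<lambda>_. 0)" for n
  have \<sigma>_Suc: "\<sigma> (Suc n) = T (\<sigma> n)" for n by (simp add: \<sigma>_def)
  have \<sigma>_psb: "psb r (\<sigma> n) (R / 2)" for n
  proof (induction n)
    case 0
    have "psb r (\<lambda>_::real^'n. 0) (R / 2)" by (rule psb_mono[OF psb_const]) (use R in simp)
    then show ?case by (simp add: \<sigma>_def)
  qed (simp add: \<sigma>_Suc T_psb)
  have \<sigma>_diff: "psb r (\<lambda>y. \<sigma> (Suc n) y - \<sigma> n y) (R / 2 * (1 / 2) ^ n)" for n
  proof (induction n)
    case 0
    show ?case using \<sigma>_psb[of 1] by (simp add: \<sigma>_def)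
  next
    case (Suc n)
    from T_lip[OF \<sigma>_psb \<sigma>_psb Suc] show ?case by (simp add: \<sigma>_Suc)
  qed
  have "((\<lambda>n. (1 / 2 :: real) ^ n) has_sum (1 / (1 - 1 / 2))) UNIV"
    by (intro norm_summable_imp_has_sum geometric_sums) (auto simp: norm_power)
  then have geo: "((\<lambda>n. R / 2 * (1 / 2) ^ n) has_sum (R / 2 * (1 / (1 - 1 / 2)))) UNIV"
    by (rule has_sum_cmult_right)
  \<comment> \<open>The limit of the iterates as a telescoping series, so that completeness of the
    norm makes it analytic.\<close>
  define S where "S y = (\<Sum>\<^sub>\<infinity>n. \<sigma> (Suc n) y - \<sigma> n y)" for y
  have S_psb: "psb r S (R / 2 * (1 / (1 - 1 / 2)))"
    and S_sum: "\<And>y. y \<in> cube r \<Longrightarrow> ((\<lambda>n. \<sigma> (Suc n) y - \<sigma> n y) has_sum S y) UNIV"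
    using psb_infsum[OF r \<sigma>_diff geo] unfolding S_def by auto
  have lim: "(\<lambda>n. \<sigma> n y) \<longlonglongrightarrow> S y" if y: "y \<in> cube r" for y
  proof -
    have "(\<lambda>n. \<Sum>i<n. \<sigma> (Suc i) y - \<sigma> i y) \<longlonglongrightarrow> S y"
      using has_sum_imp_sums[OF S_sum[OF y]] by (simp add: sums_def)
    moreover have "(\<Sum>i<n. \<sigma> (Suc i) y - \<sigma> i y) = \<sigma> n y" for n
      using sum_lessThan_telescope[of "\<lambda>i. \<sigma> i y" n] by (simp add: \<sigma>_def)
    ultimately show ?thesis by simp
  qed
  \<comment> \<open>The series bounds the norm of \<open>S\<close> only by \<open>R\<close>, while
    staying in the open ball around \<open>z\<close> needs a strict inequality; the bound on the
    iterates passes to the limit.\<close>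
  have S_bound: "\<bar>S y\<bar> \<le> R / 2" if y: "y \<in> cube r" for y
    by (rule LIMSEQ_le_const2[OF tendsto_rabs[OF lim[OF y]]]) (use psb_bound[OF \<sigma>_psb y] in blast)
  have S_I: "z + S y \<in> I" if y: "y \<in> cube r" for y
    using S_bound[OF y] R by (intro subsetD[OF RI]) (simp add: dist_norm)
  have fixp: "S y = T S y" if y: "y \<in> cube r" for y
  proof (rule LIMSEQ_unique)
    show "(\<lambda>n. \<sigma> (Suc n) y) \<longlonglongrightarrow> S y" using lim[OF y] by (rule LIMSEQ_Suc)
    have "(\<lambda>n. C j (z + \<sigma> n y)) \<longlonglongrightarrow> C j (z + S y)" if "j \<in> ?J" for j
    proof (rule isCont_tendsto_compose[where g = "C j"])
      show "isCont (C j) (z + S y)"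
        using C[of j] that S_I[OF y] by (intro real_analytic_on_continuous) auto
      show "(\<lambda>n. z + \<sigma> n y) \<longlonglongrightarrow> z + S y" by (intro tendsto_intros lim[OF y])
    qed
    then have "(\<lambda>n. T (\<sigma> n) y) \<longlonglongrightarrow> T S y"
      unfolding T_def by (intro tendsto_intros) auto
    then show "(\<lambda>n. \<sigma> (Suc n) y) \<longlonglongrightarrow> T S y" by (simp add: \<sigma>_Suc)
  qed
  define s where "s x = z + S (x - x0)" for x
  have "psb r (\<lambda>y. s (x0 + y)) (\<bar>z\<bar> + R / 2 * (1 / (1 - 1 / 2)))"
    using psb_add[OF r psb_const[of r z] S_psb] by (simp add: s_def)
  then have "real_analytic_on s (ball x0 r)" by (rule psb_imp_real_analytic_on_ball)
  moreover have "s x \<in> I \<and> s x = x $ k + (\<Sum>j\<in>?J. (x $ j - x0 $ j) * C j (s x))" if "x \<in> ball x0 r" for x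
  proof -
    have y: "x - x0 \<in> cube r"
      using that ball_subset_cube[of r] by (force simp: dist_norm norm_minus_commute)
    have "s x = z + T S (x - x0)" unfolding s_def by (subst fixp[OF y]) (rule refl)
    then show ?thesis
      using S_I[OF y] by (simp only: s_def T_def) (simp add: z_def)
  qed
  ultimately show ?thesis using r by blast
qed

section \<open>Functions with Hessian of rank one\<close>

lemma deriv_shift: "deriv (\<lambda>t. \<phi> (c + t)) 0 = deriv (\<phi> :: real \<Rightarrow> real) c"
proof -
  have "((\<lambda>t. \<phi> (c + t)) has_real_derivative D) (at 0) \<longleftrightarrow> (\<phi> has_real_derivative D) (at c)" for D
    using DERIV_shift[of \<phi> D 0 c] by (simp add: add.commute)
  then show ?thesis by (simp add: deriv_def)
qed

text \<open>The derivative along the line sees only values on the line. This is how Cauchy data,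
  known nowhere else, determine derivatives in the first coordinate.\<close>

lemma pd_along_line:
  fixes F :: "real^'n \<Rightarrow> real"
  assumes W: "open W" "x \<in> W" and x: "\<And>\<beta>. \<beta> \<noteq> k \<Longrightarrow> x $ \<beta> = x0 $ \<beta>"
    and F: "\<And>z. z \<in> W \<Longrightarrow> \<forall>\<beta>. \<beta> \<noteq> k \<longrightarrow> z $ \<beta> = x0 $ \<beta> \<Longrightarrow> F z = \<phi> (z $ k)"
  shows "pd k F x = deriv \<phi> (x $ k)"
proof -
  have "isCont (\<lambda>t::real. x + t *\<^sub>R axis k 1) 0" by (intro continuous_intros)
  then have "((\<lambda>t::real. x + t *\<^sub>R axis k 1) \<longlongrightarrow> x) (nhds 0)"
    by (simp add: continuous_at tendsto_nhds_iff)
  then have "\<forall>\<^sub>F t in nhds 0. x + t *\<^sub>R axis k 1 \<in> W"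
    using W topological_tendstoD by blast
  then have "\<forall>\<^sub>F t in nhds 0. F (x + t *\<^sub>R axis k 1) = \<phi> (x $ k + t)"
  proof eventually_elim
    case (elim t)
    show ?case using F[OF elim] x by (simp add: axis_def)
  qed
  then have "pd k F x = deriv (\<lambda>t. \<phi> (x $ k + t)) 0"
    unfolding pd_def by (rule deriv_cong_ev) simp
  then show ?thesis by (simp add: deriv_shift)
qed

lemma constant_on_segment:
  fixes F :: "real^'n \<Rightarrow> real"
  assumes F: "real_analytic_on F S"
    and seg: "\<And>\<tau>. 0 \<le> \<tau> \<Longrightarrow> \<tau> \<le> 1 \<Longrightarrow> p + \<tau> *\<^sub>R (x - p) \<in> S \<and>
      (\<Sum>i\<in>UNIV. (x - p) $ i * pd i F (p + \<tau> *\<^sub>R (x - p))) = 0"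
  shows "F x = F p"
proof -
  have "((\<lambda>\<tau>. F (p + \<tau> *\<^sub>R (x - p))) has_real_derivative 0) (at \<tau>)" if "0 \<le> \<tau>" "\<tau> \<le> 1" for \<tau>
  proof -
    have "((\<lambda>\<tau>. p + \<tau> *\<^sub>R (x - p)) has_vector_derivative (x - p)) (at \<tau>)"
      by (auto intro!: derivative_eq_intros)
    from real_analytic_DERIV_path[OF F _ this] seg[OF that] show ?thesis by simp
  qed
  then show ?thesis
    using MVT2[of 0 1 "\<lambda>\<tau>. F (p + \<tau> *\<^sub>R (x - p))" "\<lambda>_. 0"] by force
qed

lemma segment_in_ball:
  fixes p x z :: "'a::real_normed_vector"
  assumes "p \<in> ball z r" "x \<in> ball z r" "0 \<le> \<tau>" "\<tau> \<le> 1"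
  shows "p + \<tau> *\<^sub>R (x - p) \<in> ball z r"
proof -
  have "(1 - \<tau>) *\<^sub>R p + \<tau> *\<^sub>R x \<in> ball z r"
    using assms convexD[OF convex_ball, of p z r x "1 - \<tau>" \<tau>] by simp
  then show ?thesis by (simp add: algebra_simps)
qed

text \<open>Gronwall's argument: if \<open>L\<close> bounds |M|, then E^2 * exp(-2 L t) is
  nonincreasing, nonnegative and starts at 0.\<close>

lemma linear_ode_zero:
  fixes E M :: "real \<Rightarrow> real"
  assumes E: "\<And>\<tau>. 0 \<le> \<tau> \<Longrightarrow> \<tau> \<le> 1 \<Longrightarrow> (E has_real_derivative M \<tau> * E \<tau>) (at \<tau>)"
    and M: "continuous_on {0..1} M" and E0: "E 0 = 0" and \<tau>: "0 \<le> \<tau>" "\<tau> \<le> 1"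
  shows "E \<tau> = 0"
proof -
  have "compact (M ` {0..1})" using M by (intro compact_continuous_image) auto
  then obtain L where L: "\<And>t. 0 \<le> t \<Longrightarrow> t \<le> 1 \<Longrightarrow> \<bar>M t\<bar> \<le> L"
    using compact_imp_bounded bounded_real by (metis atLeastAtMost_iff image_eqI)
  define F where "F t = (E t)\<^sup>2 * exp (- 2 * L * t)" for t
  have D: "(F has_real_derivative (2 * (E t)\<^sup>2 * exp (- 2 * L * t) * (M t - L))) (at t)"
    if t: "0 \<le> t" "t \<le> 1" for t
    unfolding F_def
    by (rule derivative_eq_intros E[OF t] refl)+ (simp add: algebra_simps power2_eq_square)
  have "F \<tau> \<le> F 0"
  proof (rule DERIV_nonpos_imp_nonincreasing[OF \<tau>(1)])
    fix t assume "0 \<le> t" "t \<le> \<tau>"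
    then have t: "0 \<le> t" "t \<le> 1" using \<tau> by auto
    have "2 * (E t)\<^sup>2 * exp (- 2 * L * t) * (M t - L) \<le> 0"
      using L[OF t] by (intro mult_nonneg_nonpos) auto
    then show "\<exists>y. (F has_real_derivative y) (at t) \<and> y \<le> 0" using D[OF t] by blast
  qed
  then have "(E \<tau>)\<^sup>2 * exp (- 2 * L * \<tau>) \<le> 0" by (simp add: F_def E0)
  then show ?thesis by (auto simp: mult_le_0_iff power2_eq_square)
qed

lemma pd_const: "pd i (\<lambda>_. c) x = 0"
  by (rule pd_eqI) simp

text \<open>The Poincare lemma twice. Each row of \<open>g\<close> is closed and has a potential
  \<open>P i\<close>; symmetry of \<open>g\<close> makes the family \<open>P\<close> closed, and its
  potential is \<open>H\<close>. Normalising every \<open>P i\<close> to vanish at \<open>x0\<close>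
  makes the gradient of \<open>H\<close> vanish there.\<close>

lemma compatible_potential:
  fixes g :: "'n::finite \<Rightarrow> 'n \<Rightarrow> real^'n \<Rightarrow> real"
  assumes U: "open U" "x0 \<in> U"
    and an: "\<And>i j. real_analytic_on (g i j) U"
    and sym: "\<And>i j x. x \<in> U \<Longrightarrow> g i j x = g j i x"
    and comp: "\<And>i j l x. x \<in> U \<Longrightarrow> pd l (g i j) x = pd j (g i l) x"
  shows "\<exists>r>0. \<exists>H. ball x0 r \<subseteq> U \<and> real_analytic_on H (ball x0 r) \<and> H x0 = 0 \<and> (\<forall>i. pd i H x0 = 0) \<and>
    (\<forall>x\<in>ball x0 r. \<forall>i j. pd i (pd j H) x = g i j x)"
proof -
  define A where "A i r P \<longleftrightarrow> 0 < r \<and> ball x0 r \<subseteq> U \<and> real_analytic_on P (ball x0 r) \<and> P x0 = 0 \<and>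
    (\<forall>x\<in>ball x0 r. \<forall>j. pd j P x = g i j x)" for i r P
  have "\<forall>i. \<exists>r. \<exists>P. A i r P"
  proof
    fix i
    show "\<exists>r. \<exists>P. A i r P"
      unfolding A_def using poincare_lemma_analytic[of "g i", OF an U] comp by blast
  qed
  from choice[OF this] obtain \<rho> where "\<forall>i. \<exists>P. A i (\<rho> i) P" ..
  from choice[OF this] obtain P where P: "\<forall>i. A i (\<rho> i) (P i)" ..
  define r where "r = Min (range \<rho>)"
  have r: "0 < r" unfolding r_def using P by (subst Min_gr_iff) (auto simp: A_def)
  have sub: "ball x0 r \<subseteq> ball x0 (\<rho> i)" for i
    unfolding r_def by (rule subset_ball) (rule Min_le, auto)
  have Pan: "real_analytic_on (P i) (ball x0 r)" for i
    using P real_analytic_on_subset[OF _ sub] unfolding A_def by blast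
  have Ppd: "pd j (P i) x = g i j x" if "x \<in> ball x0 r" for i j x
    using P sub[of i] that unfolding A_def by blast
  have rU: "ball x0 r \<subseteq> U"
    using P sub unfolding A_def by blast
  have x0B: "x0 \<in> ball x0 r" using r by simp
  have "pd i (P j) x = pd j (P i) x" if "x \<in> ball x0 r" for i j x
    using Ppd[OF that] sym rU that by auto
  from poincare_lemma_analytic[of P, OF Pan open_ball x0B this]
  obtain s H where H: "0 < s" "ball x0 s \<subseteq> ball x0 r" "real_analytic_on H (ball x0 s)" "H x0 = 0"
    "\<And>x i. x \<in> ball x0 s \<Longrightarrow> pd i H x = P i x" by blast
  have "pd i H x0 = 0" for i
    using H(5)[of x0 i] H(1) P by (simp add: A_def)
  moreover have "pd i (pd j H) x = g i j x" if x: "x \<in> ball x0 s" for x i j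
  proof -
    have "pd i (pd j H) x = pd i (P j) x"
      by (rule pd_cong_open[OF open_ball x H(5)])
    also have "\<dots> = g j i x" using H(2) x by (intro Ppd) auto
    also have "\<dots> = g i j x" using H(2) x rU by (intro sym) auto
    finally show ?thesis .
  qed
  ultimately show ?thesis using H rU by blast
qed

text \<open>The graph of \<open>v\<close> is the envelope of the tangent hyperplanes prescribed along the initial
  line; \<open>s x\<close> is the parameter of the hyperplane touching at \<open>x\<close>.\<close>

lemma envelope_solution:
  fixes x0 :: "real^'n" and a :: "real \<Rightarrow> real" and A :: "'n \<Rightarrow> real \<Rightarrow> real"
  assumes I: "open I" "x0 $ k \<in> I" and a: "real_analytic_on a I"
    and A: "\<And>j. j \<noteq> k \<Longrightarrow> real_analytic_on (A j) I"
    and a2: "deriv (deriv a) (x0 $ k) \<noteq> 0"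
  shows "\<exists>r>0. \<exists>s v. real_analytic_on s (ball x0 r) \<and> real_analytic_on v (ball x0 r) \<and>
    (\<forall>x\<in>ball x0 r. s x \<in> I \<and> deriv (deriv a) (s x) \<noteq> 0 \<and>
       s x = x $ k + (\<Sum>j\<in>UNIV - {k}. (x $ j - x0 $ j) * (deriv (A j) (s x) / deriv (deriv a) (s x))) \<and>
       pd k v x = deriv a (s x) \<and> (\<forall>j. j \<noteq> k \<longrightarrow> pd j v x = A j (s x)) \<and>
       ((\<forall>\<beta>. \<beta> \<noteq> k \<longrightarrow> x $ \<beta> = x0 $ \<beta>) \<longrightarrow> v x = a (x $ k)))"
proof -
  let ?a1 = "deriv a" and ?a2 = "deriv (deriv a)"
  have a1: "real_analytic_on ?a1 I" and a2an: "real_analytic_on ?a2 I"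
    using a I by (auto intro!: real_analytic_on_deriv)
  \<comment> \<open>The implicit equation divides by the second derivative of \<open>a\<close>, so
    the parameter is confined to where that is nonzero.\<close>
  define I' where "I' = I \<inter> ?a2 -` (- {0})"
  have cont: "continuous_on I ?a2"
    using real_analytic_on_continuous[OF a2an] by (simp add: continuous_at_imp_continuous_on)
  have I'op: "open I'"
    unfolding I'_def by (rule continuous_open_preimage[OF cont I(1)]) (intro open_Compl closed_singleton)
  have I': "I' \<subseteq> I" "x0 $ k \<in> I'" using I a2 by (auto simp: I'_def)
  have "real_analytic_on (\<lambda>z. deriv (A j) z / ?a2 z) I'" if "j \<noteq> k" for j
    by (intro real_analytic_on_divide real_analytic_on_subset[OF _ I'(1)] real_analytic_on_deriv A a2an I that)
      (simp add: I'_def)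
  from analytic_implicit_function[of k "\<lambda>j z. deriv (A j) z / ?a2 z", OF this I'op I'(2)]
  obtain r s where r: "0 < r" and s: "real_analytic_on s (ball x0 r)"
    and s_eq: "\<And>x. x \<in> ball x0 r \<Longrightarrow> s x \<in> I' \<and>
      s x = x $ k + (\<Sum>j\<in>UNIV - {k}. (x $ j - x0 $ j) * (deriv (A j) (s x) / ?a2 (s x)))"
    by blast
  let ?B = "ball x0 r" and ?J = "UNIV - {k}"
  have sI: "s x \<in> I" "?a2 (s x) \<noteq> 0" if "x \<in> ?B" for x
    using s_eq[OF that] by (auto simp: I'_def)
  \<comment> \<open>The affine function with value a(s), slope a'(s) in the first coordinate and
    slopes A_j(s) in the others at the point of the initial line with parameter s, evaluated at
    \<open>x\<close> for s = \<open>s x\<close>.\<close>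
  define v where "v x = a (s x) + (?a1 (s x) * (x $ k - s x) + (\<Sum>j\<in>?J. (x $ j - x0 $ j) * A j (s x)))" for x
  have as: "real_analytic_on (\<lambda>x. a (s x)) ?B" and a1s: "real_analytic_on (\<lambda>x. ?a1 (s x)) ?B"
    by (rule real_analytic_on_compose_real[OF a s sI(1)], assumption,
        rule real_analytic_on_compose_real[OF a1 s sI(1)], assumption)
  have As: "real_analytic_on (\<lambda>x. A j (s x)) ?B" if "j \<in> ?J" for j
    by (rule real_analytic_on_compose_real[OF A s sI(1)]) (use that in auto)
  have ks: "real_analytic_on (\<lambda>x. x $ k - s x) ?B"
    by (intro real_analytic_on_diff real_analytic_on_vec_nth s)
  have m1: "real_analytic_on (\<lambda>x. ?a1 (s x) * (x $ k - s x)) ?B"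
    by (intro real_analytic_on_mult a1s ks)
  have m2: "real_analytic_on (\<lambda>x. (x $ j - x0 $ j) * A j (s x)) ?B" if "j \<in> ?J" for j
    by (intro real_analytic_on_mult real_analytic_on_coord_diff As that)
  have m3: "real_analytic_on (\<lambda>x. \<Sum>j\<in>?J. (x $ j - x0 $ j) * A j (s x)) ?B"
    by (intro real_analytic_on_sum m2)
  have v: "real_analytic_on v ?B"
    unfolding v_def by (intro real_analytic_on_add as m1 m3)
  have grad: "pd i v x = (if i = k then ?a1 (s x) else A i (s x))" if x: "x \<in> ?B" for i x
  proof -
    have p1: "pd i (\<lambda>x. a (s x)) x = ?a1 (s x) * pd i s x"
      by (rule pd_compose_real[OF a s x sI(1)[OF x]])
    have p2: "pd i (\<lambda>x. ?a1 (s x) * (x $ k - s x)) x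
        = ?a2 (s x) * pd i s x * (x $ k - s x) + ?a1 (s x) * ((if i = k then 1 else 0) - pd i s x)"
    proof -
      have "pd i (\<lambda>x. x $ k - s x) x = (if i = k then 1 else 0) - pd i s x"
        using pd_diff[OF real_analytic_on_vec_nth s x] pd_coord_diff[of i k 0 x] by simp
      then show ?thesis
        using pd_mult[OF a1s ks x, of i] pd_compose_real[OF a1 s x sI(1)[OF x], of i] by simp
    qed
    have p3: "pd i (\<lambda>x. (x $ j - x0 $ j) * A j (s x)) x
        = (if i = j then A j (s x) else 0) + (x $ j - x0 $ j) * deriv (A j) (s x) * pd i s x"
      if j: "j \<in> ?J" for j
    proof -
      have "pd i (\<lambda>x. A j (s x)) x = deriv (A j) (s x) * pd i s x"
        by (rule pd_compose_real[OF A s x sI(1)[OF x]]) (use j in simp)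
      then show ?thesis
        using pd_mult[OF real_analytic_on_coord_diff As[OF j] x] by (simp add: pd_coord_diff)
    qed
    \<comment> \<open>The envelope condition: the derivative of that affine family in its parameter
      vanishes. It is the implicit equation for \<open>s\<close> multiplied by the second derivative
      of \<open>a\<close>, and it leaves in the gradient of \<open>v\<close> only the slopes of the
      touching hyperplane.\<close>
    have key: "?a2 (s x) * (x $ k - s x) + (\<Sum>j\<in>?J. (x $ j - x0 $ j) * deriv (A j) (s x)) = 0"
    proof -
      have "(\<Sum>j\<in>?J. (x $ j - x0 $ j) * deriv (A j) (s x))
          = ?a2 (s x) * (\<Sum>j\<in>?J. (x $ j - x0 $ j) * (deriv (A j) (s x) / ?a2 (s x)))"
        using sI(2)[OF x] by (simp add: sum_distrib_left)
      also have "\<dots> = ?a2 (s x) * (s x - x $ k)" using s_eq[OF x] by simp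
      finally show ?thesis by (simp add: algebra_simps)
    qed
    have "pd i v x = pd i (\<lambda>x. a (s x)) x + (pd i (\<lambda>x. ?a1 (s x) * (x $ k - s x)) x
        + (\<Sum>j\<in>?J. pd i (\<lambda>x. (x $ j - x0 $ j) * A j (s x)) x))"
      unfolding v_def
      by (subst pd_add[OF as real_analytic_on_add[OF m1 m3] x], subst pd_add[OF m1 m3 x],
          subst pd_sum[OF m2 x]) auto
    also have "(\<Sum>j\<in>?J. pd i (\<lambda>x. (x $ j - x0 $ j) * A j (s x)) x)
        = (\<Sum>j\<in>?J. if i = j then A j (s x) else 0)
          + (\<Sum>j\<in>?J. (x $ j - x0 $ j) * deriv (A j) (s x)) * pd i s x"
      by (simp add: p3 sum.distrib sum_distrib_right)
    also have "(\<Sum>j\<in>?J. if i = j then A j (s x) else 0) = (if i = k then 0 else A i (s x))"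
      by (subst sum.delta') auto
    also have "pd i (\<lambda>x. a (s x)) x + (pd i (\<lambda>x. ?a1 (s x) * (x $ k - s x)) x
        + ((if i = k then 0 else A i (s x)) + (\<Sum>j\<in>?J. (x $ j - x0 $ j) * deriv (A j) (s x)) * pd i s x))
      = (?a2 (s x) * (x $ k - s x) + (\<Sum>j\<in>?J. (x $ j - x0 $ j) * deriv (A j) (s x))) * pd i s x
        + (if i = k then ?a1 (s x) else A i (s x))"
      unfolding p1 p2 by (simp add: algebra_simps)
    finally show ?thesis by (simp add: key)
  qed
  have line: "v x = a (x $ k)" if x: "x \<in> ?B" and "\<forall>\<beta>. \<beta> \<noteq> k \<longrightarrow> x $ \<beta> = x0 $ \<beta>" for x
  proof -
    have z: "(\<Sum>j\<in>?J. (x $ j - x0 $ j) * c j) = 0" for c using that(2) by (intro sum.neutral) auto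
    have "s x = x $ k" using s_eq[OF x] unfolding z by simp
    then show ?thesis unfolding v_def z by simp
  qed
  show ?thesis
    using r s v s_eq sI grad line by (intro exI[of _ r] conjI exI[of _ s] exI[of _ v]) auto
qed

lemma sum_line:
  fixes x x0 :: "real^'n"
  assumes "\<forall>\<beta>. \<beta> \<noteq> k \<longrightarrow> x $ \<beta> = x0 $ \<beta>"
  shows "(\<Sum>l\<in>UNIV. (x - x0) $ l * c l) = (x $ k - x0 $ k) * c k"
proof -
  have "(\<Sum>l\<in>UNIV. (x - x0) $ l * c l) = (x - x0) $ k * c k + (\<Sum>l\<in>UNIV - {k}. (x - x0) $ l * c l)"
    by (rule sum.remove) auto
  also have "(\<Sum>l\<in>UNIV - {k}. (x - x0) $ l * c l) = 0" using assms by (intro sum.neutral) auto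
  finally show ?thesis by simp
qed

text \<open>Rank one of the Hessian makes the gradient constant in the directions \<open>d\<close> with
  \<open>(\<Sum>i. d i * \<kappa> i) = 0\<close>, where \<open>\<kappa> i = w_{ki} / w_{kk}\<close>. Following such a direction along a straight
  segment is legitimate because \<open>\<kappa>\<close> itself is transported along it.\<close>

lemma rank_one_gradient_constant:
  fixes w :: "real^'n \<Rightarrow> real"
  assumes S: "open S" "convex S" and w: "real_analytic_on w S"
    and p0: "\<And>x. x \<in> S \<Longrightarrow> pd k (pd k w) x \<noteq> 0"
    and rank: "\<And>x i j. x \<in> S \<Longrightarrow> pd k (pd k w) x * pd j (pd i w) x = pd k (pd i w) x * pd k (pd j w) x"
    and q: "q \<in> S" and x: "x \<in> S" and dir: "(\<Sum>i\<in>UNIV. (x - q) $ i * pd k (pd i w) q) = 0"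
  shows "pd i w x = pd i w q"
proof -
  define p where "p = pd k (pd k w)"
  define \<kappa> where "\<kappa> i z = pd k (pd i w) z / p z" for i z
  have wi: "real_analytic_on (pd i w) S" for i by (intro real_analytic_on_pd w)
  have wij: "real_analytic_on (pd j (pd i w)) S" for i j by (intro real_analytic_on_pd w)
  have p: "real_analytic_on p S" unfolding p_def by (rule wij)
  have pne: "p z \<noteq> 0" if "z \<in> S" for z using p0[OF that] by (simp add: p_def)
  have \<kappa>: "real_analytic_on (\<kappa> i) S" for i
    unfolding \<kappa>_def by (intro real_analytic_on_divide wij p pne)
  have \<kappa>p: "real_analytic_on (\<lambda>z. \<kappa> i z * p z) S" for i by (intro real_analytic_on_mult \<kappa> p)
  have k1i: "pd k (pd i w) z = \<kappa> i z * p z" if "z \<in> S" for i z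
    using pne[OF that] by (simp add: \<kappa>_def)
  have hess: "pd j (pd i w) z = \<kappa> j z * (\<kappa> i z * p z)" if z: "z \<in> S" for i j z
  proof -
    have "p z * pd j (pd i w) z = p z * (\<kappa> j z * (\<kappa> i z * p z))"
      using rank[OF z, of j i, folded p_def, unfolded k1i[OF z]] by (simp only: mult_ac)
    then show ?thesis using pne[OF z] by simp
  qed
  \<comment> \<open>Obtained from pd_j w_{1i} = pd_k w_{ij} with w_{ij} = \<kappa>_i \<kappa>_j p
    and index 1 for \<open>k\<close>; the terms with the derivative of p cancel against pd_j p =
    pd_k (\<kappa>_j p).\<close>
  have transport: "pd j (\<kappa> i) z = \<kappa> j z * pd k (\<kappa> i) z" if z: "z \<in> S" for i j z
  proof -
    have "pd j p z = pd j (pd k (pd k w)) z" by (simp add: p_def)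
    also have "\<dots> = pd k (pd j (pd k w)) z" by (rule pd_commute[OF wi S(1) z])
    also have "\<dots> = pd k (pd k (pd j w)) z"
      by (rule pd_cong_open[OF S(1) z]) (rule pd_commute[OF w S(1)])
    also have "\<dots> = pd k (\<lambda>z. \<kappa> j z * p z) z"
      by (rule pd_cong_open[OF S(1) z k1i])
    finally have pj: "pd j p z = pd k (\<lambda>z. \<kappa> j z * p z) z" .
    have "pd j (\<kappa> i) z * p z + \<kappa> i z * pd j p z = pd j (\<lambda>z. \<kappa> i z * p z) z"
      by (rule pd_mult[OF \<kappa> p z, symmetric])
    also have "\<dots> = pd j (pd k (pd i w)) z"
      by (rule pd_cong_open[OF S(1) z]) (simp add: k1i)
    also have "\<dots> = pd k (pd j (pd i w)) z" by (rule pd_commute[OF wi S(1) z])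
    also have "\<dots> = pd k (\<lambda>z. \<kappa> i z * (\<kappa> j z * p z)) z"
      by (rule pd_cong_open[OF S(1) z]) (simp add: hess)
    also have "\<dots> = pd k (\<kappa> i) z * (\<kappa> j z * p z) + \<kappa> i z * pd k (\<lambda>z. \<kappa> j z * p z) z"
      by (rule pd_mult[OF \<kappa> \<kappa>p z])
    finally have "pd j (\<kappa> i) z * p z = (\<kappa> j z * pd k (\<kappa> i) z) * p z" by (simp add: pj mult_ac)
    then show ?thesis using pne[OF z] by simp
  qed
  let ?d = "x - q" and ?\<gamma> = "\<lambda>\<tau>. q + \<tau> *\<^sub>R (x - q)"
  have seg: "?\<gamma> \<tau> \<in> S" if "0 \<le> \<tau>" "\<tau> \<le> 1" for \<tau>
  proof -
    have "(1 - \<tau>) *\<^sub>R q + \<tau> *\<^sub>R x \<in> S" using convexD[OF S(2) q x, of "1 - \<tau>" \<tau>] that by simp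
    then show ?thesis by (simp add: algebra_simps)
  qed
  have \<gamma>': "(?\<gamma> has_vector_derivative ?d) (at \<tau>)" for \<tau>
    by (auto intro!: derivative_eq_intros)
  \<comment> \<open>Measures how far the fixed direction x - q is from being characteristic at the
    moving point. \<open>transport\<close> gives E' = M * E, and \<open>dir\<close> says E(0) = 0,
    so the direction remains characteristic on the whole segment.\<close>
  define E where "E \<tau> = (\<Sum>i\<in>UNIV. ?d $ i * \<kappa> i (?\<gamma> \<tau>))" for \<tau>
  define M where "M \<tau> = (\<Sum>i\<in>UNIV. ?d $ i * pd k (\<kappa> i) (?\<gamma> \<tau>))" for \<tau>
  have "E \<tau> = 0" if \<tau>: "0 \<le> \<tau>" "\<tau> \<le> 1" for \<tau>
  proof (rule linear_ode_zero[OF _ _ _ \<tau>])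
    fix t :: real assume t: "0 \<le> t" "t \<le> 1"
    have "((\<lambda>t. \<kappa> i (?\<gamma> t)) has_real_derivative pd k (\<kappa> i) (?\<gamma> t) * E t) (at t)" for i
    proof -
      have eq: "(\<Sum>j\<in>UNIV. ?d $ j * pd j (\<kappa> i) (?\<gamma> t)) = pd k (\<kappa> i) (?\<gamma> t) * E t"
        unfolding E_def sum_distrib_left
      proof (rule sum.cong)
        fix j
        show "?d $ j * pd j (\<kappa> i) (?\<gamma> t) = pd k (\<kappa> i) (?\<gamma> t) * (?d $ j * \<kappa> j (?\<gamma> t))"
          using transport[OF seg[OF t], of j i] by simp
      qed simp
      show ?thesis
        unfolding eq[symmetric] by (rule real_analytic_DERIV_path[OF \<kappa> seg[OF t] \<gamma>'])
    qed
    then have "(E has_real_derivative (\<Sum>i\<in>UNIV. ?d $ i * (pd k (\<kappa> i) (?\<gamma> t) * E t))) (at t)"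
      unfolding E_def by (intro DERIV_sum DERIV_cmult)
    also have "(\<Sum>i\<in>UNIV. ?d $ i * (pd k (\<kappa> i) (?\<gamma> t) * E t)) = M t * E t"
      unfolding M_def sum_distrib_right by (rule sum.cong) auto
    finally show "(E has_real_derivative M t * E t) (at t)" .
  next
    have "continuous_on {0..1} (\<lambda>t. pd k (\<kappa> i) (?\<gamma> t))" for i
    proof (rule continuous_at_imp_continuous_on, intro ballI)
      fix t :: real assume "t \<in> {0..1}"
      then have "?\<gamma> t \<in> S" using seg by simp
      from DERIV_isCont[OF real_analytic_DERIV_path[OF real_analytic_on_pd[OF \<kappa>] this \<gamma>']]
      show "isCont (\<lambda>t. pd k (\<kappa> i) (?\<gamma> t)) t" .
    qed
    then show "continuous_on {0..1} M"
      unfolding M_def by (intro continuous_on_sum continuous_on_mult_left)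
    have "E 0 = (\<Sum>i\<in>UNIV. ?d $ i * pd k (pd i w) q) / p q"
      by (simp add: E_def \<kappa>_def sum_divide_distrib)
    then show "E 0 = 0" by (simp only: dir)
  qed
  then have E: "(\<Sum>j\<in>UNIV. ?d $ j * \<kappa> j (?\<gamma> \<tau>)) = 0" if "0 \<le> \<tau>" "\<tau> \<le> 1" for \<tau>
    using that by (simp add: E_def)
  show ?thesis
  proof (rule constant_on_segment[OF wi], intro conjI)
    fix \<tau> :: real assume \<tau>: "0 \<le> \<tau>" "\<tau> \<le> 1"
    show "?\<gamma> \<tau> \<in> S" by (rule seg[OF \<tau>])
    have "(\<Sum>j\<in>UNIV. ?d $ j * pd j (pd i w) (?\<gamma> \<tau>))
        = (\<Sum>j\<in>UNIV. ?d $ j * \<kappa> j (?\<gamma> \<tau>)) * (\<kappa> i (?\<gamma> \<tau>) * p (?\<gamma> \<tau>))"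
      unfolding sum_distrib_right by (rule sum.cong) (auto simp: hess[OF seg[OF \<tau>]])
    then show "(\<Sum>j\<in>UNIV. ?d $ j * pd j (pd i w) (?\<gamma> \<tau>)) = 0"
      unfolding E[OF \<tau>] by simp
  qed
qed

section \<open>Existence and uniqueness for the Cauchy problem\<close>

text \<open>Here \<open>g\<close> carries all indices, with zero entries at \<open>k1\<close>.
  Taking \<open>l = k1\<close> in the compatibility condition then recovers independence of the
  first coordinate, and the full matrix \<open>g\<close> is a Hessian.\<close>

lemma cauchy_problem_well_posed:
  fixes k1 :: "'n::finite" and f :: "'n \<Rightarrow> 'n \<Rightarrow> (real^'n) \<times> real \<Rightarrow> real"
    and g :: "'n \<Rightarrow> 'n \<Rightarrow> real^'n \<Rightarrow> real"
  assumes U: "open U" "x0 \<in> U" and V: "open V" "0 \<notin> V"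
    and g_an: "\<And>i j. real_analytic_on (g i j) U"
    and g_sym: "\<And>i j x. x \<in> U \<Longrightarrow> g i j x = g j i x"
    and g_comp: "\<And>i j l x. x \<in> U \<Longrightarrow> pd l (g i j) x = pd j (g i l) x"
    and g_k1: "\<And>j x. g k1 j x = 0"
    and fg: "\<And>\<alpha> \<beta> x t. \<alpha> \<noteq> k1 \<Longrightarrow> \<beta> \<noteq> k1 \<Longrightarrow> x \<in> U \<Longrightarrow> t \<in> V \<Longrightarrow> f \<alpha> \<beta> (x, t) = g \<alpha> \<beta> x * t"
    and I: "open I" "x0 $ k1 \<in> I" and a: "real_analytic_on a I"
    and A: "\<And>\<alpha>. \<alpha> \<noteq> k1 \<Longrightarrow> real_analytic_on (A \<alpha>) I"
    and a2: "deriv (deriv a) (x0 $ k1) \<in> V"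
  shows "\<exists>u W. cauchy_solution k1 f U V x0 I a A u W \<and>
          (\<forall>v W'. cauchy_solution k1 f U V x0 I a A v W' \<longrightarrow>
             (\<exists>W''. open W'' \<and> x0 \<in> W'' \<and> (\<forall>x\<in>W''. v x = u x)))"
proof -
  let ?line = "\<lambda>x. \<forall>\<beta>. \<beta> \<noteq> k1 \<longrightarrow> x $ \<beta> = x0 $ \<beta>"
  obtain r1 H where r1: "0 < r1" "ball x0 r1 \<subseteq> U" "real_analytic_on H (ball x0 r1)" "H x0 = 0"
    "\<And>i. pd i H x0 = 0" "\<And>x i j. x \<in> ball x0 r1 \<Longrightarrow> pd i (pd j H) x = g i j x"
    using compatible_potential[OF U g_an g_sym g_comp] by blast
  have "deriv (deriv a) (x0 $ k1) \<noteq> 0" using a2 V by auto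
  from envelope_solution[where A = A, OF I a A this] obtain r2 s v where r2: "0 < r2"
    "real_analytic_on s (ball x0 r2)" "real_analytic_on v (ball x0 r2)"
    and sv: "\<forall>x\<in>ball x0 r2. s x \<in> I \<and> deriv (deriv a) (s x) \<noteq> 0 \<and>
       s x = x $ k1 + (\<Sum>j\<in>UNIV - {k1}. (x $ j - x0 $ j) * (deriv (A j) (s x) / deriv (deriv a) (s x))) \<and>
       pd k1 v x = deriv a (s x) \<and> (\<forall>j. j \<noteq> k1 \<longrightarrow> pd j v x = A j (s x)) \<and>
       (?line x \<longrightarrow> v x = a (x $ k1))"
    by blast
  define r where "r = min r1 r2"
  have r: "0 < r" using r1 r2 by (simp add: r_def)
  let ?B = "ball x0 r"
  have B1: "?B \<subseteq> ball x0 r1" and B2: "?B \<subseteq> ball x0 r2" by (auto simp: r_def)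
  have x0B: "x0 \<in> ball x0 r" using r by simp
  have H: "real_analytic_on H ?B" and s: "real_analytic_on s ?B" and v: "real_analytic_on v ?B"
    using real_analytic_on_subset B1 B2 r1 r2 by blast+
  have BU: "?B \<subseteq> U" using r1 B1 by blast
  have hessH: "pd i (pd j H) x = g i j x" if "x \<in> ball x0 r" for x i j
    using r1(6) B1 that by blast
  have g_k1': "g j k1 x = 0" if "x \<in> U" for j x
    using g_sym[OF that, of j k1] g_k1 by simp
  define b where "b i = (if i = k1 then deriv a else A i)" for i
  have b: "real_analytic_on (b i) I" for i
    using real_analytic_on_deriv[OF a I(1)] A by (simp add: b_def)
  have sI: "s x \<in> I" and a2s: "deriv (deriv a) (s x) \<noteq> 0"
    and s_eq: "s x = x $ k1 + (\<Sum>j\<in>UNIV - {k1}. (x $ j - x0 $ j) * (deriv (A j) (s x) / deriv (deriv a) (s x)))"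
    and gradv: "pd i v x = b i (s x)" and vline: "?line x \<Longrightarrow> v x = a (x $ k1)"
    if "x \<in> ball x0 r" for x i
    using sv B2 that by (auto simp: b_def)
  have sline: "s x = x $ k1" if x: "x \<in> ball x0 r" and l: "?line x" for x
  proof -
    have "(\<Sum>j\<in>UNIV - {k1}. (x $ j - x0 $ j) * (deriv (A j) (s x) / deriv (deriv a) (s x))) = 0"
      using l by (intro sum.neutral) auto
    then show ?thesis using s_eq[OF x] by linarith
  qed
  \<comment> \<open>Every second derivative of \<open>H\<close> involving \<open>k1\<close> is an
    entry of \<open>g\<close> at \<open>k1\<close>, hence zero. So the gradient of \<open>H\<close>,
    and then \<open>H\<close>, keep along the initial line the value 0 that they have at
    \<open>x0\<close>.\<close>
  have Hline: "pd i H x = 0" "H x = 0" if x: "x \<in> ball x0 r" and l: "?line x" for x i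
  proof -
    have 1: "pd i H z = 0" if z: "z \<in> ball x0 r" and lz: "?line z" for z i
    proof -
      have "pd i H z = pd i H x0"
      proof (rule constant_on_segment[OF real_analytic_on_pd[OF H]], intro conjI)
        fix \<tau> :: real assume \<tau>: "0 \<le> \<tau>" "\<tau> \<le> 1"
        show in_B: "x0 + \<tau> *\<^sub>R (z - x0) \<in> ?B" by (rule segment_in_ball[OF x0B z \<tau>])
        show "(\<Sum>j\<in>UNIV. (z - x0) $ j * pd j (pd i H) (x0 + \<tau> *\<^sub>R (z - x0))) = 0"
          unfolding sum_line[OF lz] hessH[OF in_B] g_k1 by simp
      qed
      then show ?thesis using r1(5) by simp
    qed
    then show "pd i H x = 0" using x l by blast
    have "H x = H x0"
    proof (rule constant_on_segment[OF H], intro conjI)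
      fix \<tau> :: real assume \<tau>: "0 \<le> \<tau>" "\<tau> \<le> 1"
      show in_B: "x0 + \<tau> *\<^sub>R (x - x0) \<in> ?B" by (rule segment_in_ball[OF x0B x \<tau>])
      have "pd k1 H (x0 + \<tau> *\<^sub>R (x - x0)) = 0" using l by (intro 1 in_B) auto
      then show "(\<Sum>j\<in>UNIV. (x - x0) $ j * pd j H (x0 + \<tau> *\<^sub>R (x - x0))) = 0"
        unfolding sum_line[OF l] by simp
    qed
    then show "H x = 0" using r1(4) by simp
  qed
  define u where "u x = v x + H x" for x
  have u: "real_analytic_on u ?B" unfolding u_def by (intro real_analytic_on_add v H)
  have gradu: "pd i u x = b i (s x) + pd i H x" if x: "x \<in> ball x0 r" for i x
    unfolding u_def using pd_add[OF v H x] gradv[OF x] by simp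
  have bs: "real_analytic_on (\<lambda>x. b i (s x)) ?B" for i
    by (rule real_analytic_on_compose_real[OF b s sI])
  have hessu: "pd j (pd i u) x = deriv (b i) (s x) * pd j s x + g j i x" if x: "x \<in> ball x0 r" for i j x
  proof -
    have "pd j (pd i u) x = pd j (\<lambda>x. b i (s x) + pd i H x) x"
      by (rule pd_cong_open[OF open_ball x gradu])
    also have "\<dots> = pd j (\<lambda>x. b i (s x)) x + pd j (pd i H) x"
      by (rule pd_add[OF bs real_analytic_on_pd[OF H] x])
    finally show ?thesis
      using pd_compose_real[OF b s x sI[OF x]] hessH[OF x] by simp
  qed
  have u11: "pd k1 (pd k1 u) x = deriv (deriv a) (s x) * pd k1 s x" if "x \<in> ball x0 r" for x
    using hessu[OF that] by (simp add: b_def g_k1)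
  have x0line: "?line x0" by simp
  \<comment> \<open>On the initial line \<open>s\<close> is the first coordinate itself, so its
    derivative there is 1 and u_11 starts at the prescribed second derivative of
    \<open>a\<close>.\<close>
  have "pd k1 s x0 = deriv (\<lambda>z. z) (x0 $ k1)"
    by (rule pd_along_line[OF open_ball x0B, of k1 x0]) (simp_all add: sline)
  then have u11x0: "pd k1 (pd k1 u) x0 = deriv (deriv a) (x0 $ k1)"
    using u11[OF x0B] sline[OF x0B x0line] by simp
  \<comment> \<open>A solution must keep u_11 in \<open>V\<close> throughout its domain; by
    continuity this holds near \<open>x0\<close>.\<close>
  define W where "W = ?B \<inter> pd k1 (pd k1 u) -` V"
  have "continuous_on ?B (pd k1 (pd k1 u))"
    by (rule continuous_at_imp_continuous_on)
      (auto intro!: real_analytic_on_continuous[OF real_analytic_on_pd[OF real_analytic_on_pd[OF u]]])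
  then have W: "open W" unfolding W_def using V(1) by (intro continuous_open_preimage) auto
  have x0W: "x0 \<in> W" using x0B u11x0 a2 by (simp add: W_def)
  have sol: "cauchy_solution k1 f U V x0 I a A u W"
    unfolding cauchy_solution_def
  proof (intro conjI ballI allI impI W x0W)
    show "W \<subseteq> U" using BU by (auto simp: W_def)
    show "real_analytic_on u W" by (rule real_analytic_on_subset[OF u]) (auto simp: W_def)
    fix x assume "x \<in> W"
    then have x: "x \<in> ball x0 r" and xV: "pd k1 (pd k1 u) x \<in> V" by (auto simp: W_def)
    show "pd k1 (pd k1 u) x \<in> V" by (rule xV)
    { fix \<alpha> \<beta> assume ab: "\<alpha> \<noteq> k1" "\<beta> \<noteq> k1"
      have "x \<in> U" using x BU by blast
      \<comment> \<open>In the determinant the products of b_i'(s) with derivatives of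
        \<open>s\<close> cancel, since that part of the Hessian depends on \<open>x\<close> through
        the single function \<open>s\<close>. Only g_{\<alpha>\<beta>} u_11 survives.\<close>
      have "Delta k1 \<alpha> \<beta> u x = g \<alpha> \<beta> x * pd k1 (pd k1 u) x"
        unfolding Delta_def hessu[OF x] using g_k1' \<open>x \<in> U\<close> by (simp add: g_k1 algebra_simps)
      then show "Delta k1 \<alpha> \<beta> u x = f \<alpha> \<beta> (x, pd k1 (pd k1 u) x)"
        using fg[OF ab \<open>x \<in> U\<close> xV] by simp }
    assume l: "?line x"
    show "x $ k1 \<in> I" using sI[OF x] sline[OF x l] by simp
    show "u x = a (x $ k1)" using vline[OF x l] Hline(2)[OF x l] by (simp add: u_def)
    fix \<alpha> assume "\<alpha> \<noteq> k1"
    then show "pd \<alpha> u x = A \<alpha> (x $ k1)"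
      using gradu[OF x] Hline(1)[OF x l] sline[OF x l] by (simp add: b_def)
  qed
  have "\<exists>W''. open W'' \<and> x0 \<in> W'' \<and> (\<forall>x\<in>W''. w x = u x)"
    if w: "cauchy_solution k1 f U V x0 I a A w W'" for w W'
  proof -
    have W': "open W'" "x0 \<in> W'" "W' \<subseteq> U" and w_an: "real_analytic_on w W'"
      and w11: "\<And>x. x \<in> W' \<Longrightarrow> pd k1 (pd k1 w) x \<in> V"
      and wD: "\<And>x \<alpha> \<beta>. x \<in> W' \<Longrightarrow> \<alpha> \<noteq> k1 \<Longrightarrow> \<beta> \<noteq> k1 \<Longrightarrow>
        Delta k1 \<alpha> \<beta> w x = f \<alpha> \<beta> (x, pd k1 (pd k1 w) x)"
      and wl: "\<And>x. x \<in> W' \<Longrightarrow> ?line x \<Longrightarrow> w x = a (x $ k1)"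
      and wl': "\<And>x \<alpha>. x \<in> W' \<Longrightarrow> ?line x \<Longrightarrow> \<alpha> \<noteq> k1 \<Longrightarrow> pd \<alpha> w x = A \<alpha> (x $ k1)"
      using w unfolding cauchy_solution_def by blast+
    have "open (W' \<inter> ?B)" "x0 \<in> W' \<inter> ?B" using W' x0B by auto
    then obtain \<epsilon> where \<epsilon>: "0 < \<epsilon>" "ball x0 \<epsilon> \<subseteq> W' \<inter> ?B" using open_contains_ball by blast
    let ?S = "ball x0 \<epsilon>"
    have SW: "x \<in> W'" and SB: "x \<in> ball x0 r" and SU: "x \<in> U" if "x \<in> ball x0 \<epsilon>" for x
      using that \<epsilon>(2) BU by blast+
    have wS: "real_analytic_on w ?S" and HS: "real_analytic_on H ?S"
      using real_analytic_on_subset[OF w_an] real_analytic_on_subset[OF H] \<epsilon>(2) by blast+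
    define m where "m x = w x - H x" for x
    have m: "real_analytic_on m ?S" unfolding m_def by (intro real_analytic_on_diff wS HS)
    have gradm: "pd i m x = pd i w x - pd i H x" if "x \<in> ball x0 \<epsilon>" for i x
      unfolding m_def by (rule pd_diff[OF wS HS that])
    have hessm: "pd j (pd i m) x = pd j (pd i w) x - g j i x" if x: "x \<in> ball x0 \<epsilon>" for i j x
    proof -
      have "pd j (pd i m) x = pd j (\<lambda>x. pd i w x - pd i H x) x"
        by (rule pd_cong_open[OF open_ball x gradm])
      also have "\<dots> = pd j (pd i w) x - pd j (pd i H) x"
        by (rule pd_diff[OF real_analytic_on_pd[OF wS] real_analytic_on_pd[OF HS] x])
      finally show ?thesis by (simp add: hessH[OF SB[OF x]])
    qed
    have m11: "pd k1 (pd k1 m) x = pd k1 (pd k1 w) x" if x: "x \<in> ball x0 \<epsilon>" for x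
      using hessm[OF x] by (simp add: g_k1)
    have m11_ne: "pd k1 (pd k1 m) x \<noteq> 0" if x: "x \<in> ball x0 \<epsilon>" for x
      using w11[OF SW[OF x]] m11[OF x] V(2) by auto
    \<comment> \<open>Subtracting \<open>H\<close> removes exactly the term g_{ij} w_11 from the
      equation and changes no derivative involving \<open>k1\<close>. If \<open>i\<close> or
      \<open>j\<close> is \<open>k1\<close>, the identity holds for any function.\<close>
    have rank: "pd k1 (pd k1 m) x * pd j (pd i m) x = pd k1 (pd i m) x * pd k1 (pd j m) x"
      if x: "x \<in> ball x0 \<epsilon>" for x i j
    proof -
      have comm: "pd j (pd k1 m) x = pd k1 (pd j m) x" for j by (rule pd_commute[OF m open_ball x])
      consider "i = k1" | "j = k1" | "i \<noteq> k1" "j \<noteq> k1" by blast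
      then show ?thesis
      proof cases
        case 3
        have "pd k1 (pd k1 w) x * pd j (pd i w) x - pd k1 (pd i w) x * pd j (pd k1 w) x
            = g j i x * pd k1 (pd k1 w) x"
          using wD[OF SW[OF x] 3(2,1)] fg[OF 3(2,1) SU[OF x] w11[OF SW[OF x]]] by (simp add: Delta_def)
        moreover have "pd k1 (pd i w) x = pd k1 (pd i m) x" "pd j (pd k1 w) x = pd k1 (pd j m) x"
          using hessm[OF x, of k1 i] hessm[OF x, of j k1] comm[of j] g_k1' SU[OF x] by (simp_all add: g_k1)
        moreover have "pd j (pd i w) x = pd j (pd i m) x + g j i x" using hessm[OF x] by simp
        ultimately show ?thesis using m11[OF x] by (simp add: algebra_simps)
      next
        case 1
        show ?thesis unfolding 1 comm[of j] ..
      next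
        case 2
        show ?thesis unfolding 2 by (rule mult.commute)
      qed
    qed
    have gradm_line: "pd i m x = b i (x $ k1)" if x: "x \<in> ball x0 \<epsilon>" and l: "?line x" for i x
    proof -
      have "pd i w x = b i (x $ k1)"
      proof (cases "i = k1")
        case True
        have "pd k1 w x = deriv a (x $ k1)"
          by (rule pd_along_line[OF W'(1) SW[OF x], of k1 x0]) (use l wl in auto)
        then show ?thesis using True by (simp add: b_def)
      qed (use wl'[OF SW[OF x] l] in \<open>simp add: b_def\<close>)
      then show ?thesis using gradm[OF x] Hline(1)[OF SB[OF x] l] by simp
    qed
    have m1i_line: "pd k1 (pd i m) x = deriv (b i) (x $ k1)" if x: "x \<in> ball x0 \<epsilon>" and l: "?line x" for i x
      by (rule pd_along_line[OF open_ball x, of k1 x0]) (use l gradm_line in auto)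
    have "isCont s x0" by (rule real_analytic_on_continuous[OF s x0B])
    then obtain \<delta>0 where \<delta>0: "0 < \<delta>0" "\<And>x. dist x x0 < \<delta>0 \<Longrightarrow> dist (s x) (s x0) < \<epsilon>"
      using \<epsilon>(1) unfolding continuous_at_eps_delta by blast
    \<comment> \<open>The foot point \<open>q\<close> below has distance |s x - s x0| from
      \<open>x0\<close>; this radius keeps it inside \<open>?S\<close>.\<close>
    define \<delta> where "\<delta> = min \<delta>0 \<epsilon>"
    have \<delta>: "0 < \<delta>" "ball x0 \<delta> \<subseteq> ?S" using \<delta>0 \<epsilon> by (auto simp: \<delta>_def)
    have grad_eq: "pd i m x = pd i v x" if x: "x \<in> ball x0 \<delta>" for x i
    proof -
      have xS: "x \<in> ball x0 \<epsilon>" using x \<delta>(2) by blast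
      note xB = SB[OF xS]
      \<comment> \<open>The point of the initial line where the hyperplane with parameter
        \<open>s x\<close> touches.\<close>
      define q where "q = x0 + (s x - x0 $ k1) *\<^sub>R axis k1 1"
      have q_k1: "q $ k1 = s x" by (simp add: q_def)
      have q_line: "?line q" by (simp add: q_def axis_def)
      have "dist (s x) (s x0) < \<epsilon>" using x by (intro \<delta>0) (simp add: \<delta>_def dist_commute)
      then have qS: "q \<in> ball x0 \<epsilon>"
        using sline[OF x0B x0line] by (simp add: q_def dist_norm)
      let ?c = "\<lambda>j. deriv (A j) (s x) / deriv (deriv a) (s x)"
      \<comment> \<open>The equation defining \<open>s\<close> says precisely that x - q is
        characteristic for \<open>m\<close> at \<open>q\<close>, the Hessian entries at
        \<open>q\<close> being known from the data. So any solution has at \<open>x\<close> the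
        gradient prescribed at \<open>q\<close>.\<close>
      have "(\<Sum>j\<in>UNIV. (x - q) $ j * pd k1 (pd j m) q) = (\<Sum>j\<in>UNIV. (x - q) $ j * deriv (b j) (s x))"
        using m1i_line[OF qS q_line] q_k1 by simp
      also have "\<dots> = (x - q) $ k1 * deriv (b k1) (s x) + (\<Sum>j\<in>UNIV - {k1}. (x - q) $ j * deriv (b j) (s x))"
        by (rule sum.remove) auto
      also have "(\<Sum>j\<in>UNIV - {k1}. (x - q) $ j * deriv (b j) (s x))
          = deriv (deriv a) (s x) * (\<Sum>j\<in>UNIV - {k1}. (x $ j - x0 $ j) * ?c j)"
        unfolding sum_distrib_left
        by (rule sum.cong) (use q_line a2s[OF xB] in \<open>auto simp: b_def\<close>)
      also have "(\<Sum>j\<in>UNIV - {k1}. (x $ j - x0 $ j) * ?c j) = s x - x $ k1"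
        using s_eq[OF xB] by linarith
      finally have "(\<Sum>j\<in>UNIV. (x - q) $ j * pd k1 (pd j m) q) = 0"
        by (simp add: q_k1 b_def algebra_simps)
      from rank_one_gradient_constant[OF open_ball convex_ball m m11_ne rank qS xS this]
      have "pd i m x = pd i m q" .
      then show ?thesis using gradm_line[OF qS q_line] q_k1 gradv[OF xB] by simp
    qed
    have "w x = u x" if x: "x \<in> ball x0 \<delta>" for x
    proof -
      have x0\<delta>: "x0 \<in> ball x0 \<delta>" using \<delta> by simp
      have mv: "real_analytic_on m (ball x0 \<delta>)" "real_analytic_on v (ball x0 \<delta>)"
        using real_analytic_on_subset[OF m] real_analytic_on_subset[OF v] \<delta>(2) SB by blast+
      have "m x - v x = m x0 - v x0"
      proof (rule constant_on_segment[OF real_analytic_on_diff[OF mv]], intro conjI)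
        fix \<tau> :: real assume \<tau>: "0 \<le> \<tau>" "\<tau> \<le> 1"
        show z: "x0 + \<tau> *\<^sub>R (x - x0) \<in> ball x0 \<delta>" by (rule segment_in_ball[OF x0\<delta> x \<tau>])
        show "(\<Sum>i\<in>UNIV. (x - x0) $ i * pd i (\<lambda>x. m x - v x) (x0 + \<tau> *\<^sub>R (x - x0))) = 0"
          unfolding pd_diff[OF mv z] grad_eq[OF z] by simp
      qed
      also have "\<dots> = 0"
        using wl[OF W'(2)] vline[OF x0B x0line] r1(4) by (simp add: m_def)
      finally show ?thesis by (simp add: m_def u_def)
    qed
    then show ?thesis using \<delta> by (intro exI[of _ "ball x0 \<delta>"]) auto
  qed
  then show ?thesis using sol by blast
qed

section \<open>Integrability conditions\<close>

lemma DERIV_along_path: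
  assumes h: "(h has_derivative D) (at (\<gamma> t))" and \<gamma>: "(\<gamma> has_vector_derivative w) (at t)"
  shows "((\<lambda>t. h (\<gamma> t)) has_real_derivative D w) (at t)"
proof -
  have "((\<lambda>t. h (\<gamma> t)) has_derivative (\<lambda>s. D (s *\<^sub>R w))) (at t)"
    using diff_chain_at[OF \<gamma>[unfolded has_vector_derivative_def] h] by (simp add: o_def)
  then show ?thesis
    unfolding has_field_derivative_def
    by (rule has_derivative_eq_rhs)
      (simp add: fun_eq_iff linear_scale[OF has_derivative_linear[OF h]] mult.commute)
qed

lemma pd_graph:
  fixes h :: "(real^'n) \<times> real \<Rightarrow> real"
  assumes h: "real_analytic_on h T" and \<phi>: "real_analytic_on \<phi> S" and x: "x \<in> S" "(x, \<phi> x) \<in> T"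
  shows "pd i (\<lambda>x. h (x, \<phi> x)) x
    = pd i (\<lambda>y. h (y, \<phi> x)) x + deriv (\<lambda>\<tau>. h (x, \<tau>)) (\<phi> x) * pd i \<phi> x"
proof -
  obtain D where D: "(h has_derivative D) (at (x, \<phi> x))"
    using real_analytic_on_differentiable[OF h x(2)] by (auto simp: differentiable_def)
  then have lin: "linear D" by (rule has_derivative_linear)
  let ?e = "axis i 1 :: real^'n"
  have line: "((\<lambda>t. x + t *\<^sub>R ?e) has_vector_derivative ?e) (at 0)"
    by (auto intro!: derivative_eq_intros)
  have "((\<lambda>t. \<phi> (x + t *\<^sub>R ?e)) has_vector_derivative pd i \<phi> x) (at 0)"
    using pd_DERIV[OF \<phi> x(1)] by (simp add: has_real_derivative_iff_has_vector_derivative)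
  from has_vector_derivative_Pair[OF line this]
  have "((\<lambda>t. (x + t *\<^sub>R ?e, \<phi> (x + t *\<^sub>R ?e))) has_vector_derivative (?e, pd i \<phi> x)) (at 0)" .
  from DERIV_along_path[OF _ this, of h D] D
  have 1: "pd i (\<lambda>x. h (x, \<phi> x)) x = D (?e, pd i \<phi> x)" by (intro pd_eqI) simp
  have "((\<lambda>t. (x + t *\<^sub>R ?e, \<phi> x)) has_vector_derivative (?e, 0)) (at 0)"
    by (rule has_vector_derivative_Pair[OF line]) simp
  from DERIV_along_path[OF _ this, of h D] D
  have 2: "pd i (\<lambda>y. h (y, \<phi> x)) x = D (?e, 0)" by (intro pd_eqI) simp
  have "((\<lambda>\<tau>. (x, \<tau>)) has_vector_derivative (0, 1)) (at (\<phi> x))"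
    by (rule has_vector_derivative_Pair) (auto intro!: derivative_eq_intros)
  from DERIV_along_path[OF _ this, of h D] D
  have 3: "deriv (\<lambda>\<tau>. h (x, \<tau>)) (\<phi> x) = D (0, 1)" by (intro DERIV_imp_deriv) simp
  have "D (?e, pd i \<phi> x) = D ((?e, 0) + pd i \<phi> x *\<^sub>R (0, 1))" by simp
  also have "\<dots> = D (?e, 0) + pd i \<phi> x * D (0, 1)"
    by (simp only: linear_add[OF lin] linear_scale[OF lin] real_scaleR_def)
  finally show ?thesis unfolding 1 2 3 by simp
qed

lemma real_analytic_on_Pair_compose:
  fixes h :: "'a::euclidean_space \<times> real \<Rightarrow> real" and G :: "'c::euclidean_space \<Rightarrow> 'a"
  assumes h: "real_analytic_on h T" and G: "\<And>b. b \<in> Basis \<Longrightarrow> real_analytic_on (\<lambda>y. G y \<bullet> b) S"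
    and \<phi>: "real_analytic_on \<phi> S" and "\<And>y. y \<in> S \<Longrightarrow> (G y, \<phi> y) \<in> T"
  shows "real_analytic_on (\<lambda>y. h (G y, \<phi> y)) S"
  by (rule real_analytic_on_compose[OF h]) (use assms in \<open>auto simp: Basis_prod_def\<close>)

lemma real_analytic_on_snd: "real_analytic_on (snd :: 'a::euclidean_space \<times> real \<Rightarrow> real) S"
  using real_analytic_on_inner_Basis[of "(0, 1) :: 'a \<times> real" S] by (simp add: Basis_prod_def inner_prod_def)

text \<open>One shape serves all initial data: the datum \<open>a\<close> is the case
  \<open>\<kappa> = 0\<close>, which explains its summand with factor 0 in the statements
  below.\<close>

lemma deriv_quadratic: "deriv (\<lambda>z. \<kappa> * (z - c) + \<mu> / 2 * (z - c)\<^sup>2) = (\<lambda>z::real. \<kappa> + \<mu> * (z - c))"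
  by (rule ext, rule DERIV_imp_deriv) (auto intro!: derivative_eq_intros)

lemma deriv_affine: "deriv (\<lambda>z. \<kappa> + \<mu> * (z - c)) = (\<lambda>z::real. \<mu>)"
  by (rule ext, rule DERIV_imp_deriv) (auto intro!: derivative_eq_intros)

text \<open>Equates \<open>u_{\<alpha>\<beta>\<gamma>}\<close> and \<open>u_{\<alpha>\<gamma>\<beta>}\<close>, both computed from
  \<open>u_{\<alpha>\<beta>} = h_{\<alpha>\<beta>}(x, u_{11}) + u_{1\<alpha>} u_{1\<beta>} / u_{11}\<close>, for quadratic initial data.\<close>

lemma integrability_condition:
  fixes k1 :: "'n::finite" and f :: "'n \<Rightarrow> 'n \<Rightarrow> (real^'n) \<times> real \<Rightarrow> real" and \<kappa> \<mu> :: "'n \<Rightarrow> real"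
  defines "h \<equiv> \<lambda>\<alpha> \<beta> p. f \<alpha> \<beta> p / snd p"
  assumes V: "0 \<notin> V"
    and fan: "\<And>\<alpha> \<beta>. \<alpha> \<noteq> k1 \<Longrightarrow> \<beta> \<noteq> k1 \<Longrightarrow> real_analytic_on (f \<alpha> \<beta>) (U \<times> V)"
    and sol: "cauchy_solution k1 f U V x0 UNIV (\<lambda>z. 0 * (z - x0 $ k1) + t / 2 * (z - x0 $ k1)\<^sup>2)
      (\<lambda>\<alpha> z. \<kappa> \<alpha> * (z - x0 $ k1) + \<mu> \<alpha> / 2 * (z - x0 $ k1)\<^sup>2) u W"
    and idx: "\<alpha> \<noteq> k1" "\<beta> \<noteq> k1" "\<gamma> \<noteq> k1"
  defines "H \<equiv> \<lambda>\<alpha> \<beta> i. pd i (\<lambda>y. h \<alpha> \<beta> (y, t)) x0" and "T \<equiv> \<lambda>\<alpha> \<beta>. deriv (\<lambda>\<tau>. h \<alpha> \<beta> (x0, \<tau>)) t"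
  shows "h \<alpha> \<beta> (x0, t) = h \<beta> \<alpha> (x0, t)"
    and "H \<alpha> \<beta> \<gamma> + T \<alpha> \<beta> * \<mu> \<gamma> + (H \<gamma> \<alpha> k1 + (\<mu> \<gamma> * \<kappa> \<alpha> + \<kappa> \<gamma> * \<mu> \<alpha>) / t) * \<kappa> \<beta> / t - \<kappa> \<alpha> * \<kappa> \<beta> * \<mu> \<gamma> / t\<^sup>2
      = H \<alpha> \<gamma> \<beta> + T \<alpha> \<gamma> * \<mu> \<beta> + (H \<beta> \<alpha> k1 + (\<mu> \<beta> * \<kappa> \<alpha> + \<kappa> \<beta> * \<mu> \<alpha>) / t) * \<kappa> \<gamma> / t - \<kappa> \<alpha> * \<kappa> \<gamma> * \<mu> \<beta> / t\<^sup>2"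
proof -
  let ?line = "\<lambda>x. \<forall>\<beta>. \<beta> \<noteq> k1 \<longrightarrow> x $ \<beta> = x0 $ \<beta>"
  define c where "c = x0 $ k1"
  have W: "open W" "x0 \<in> W" "W \<subseteq> U" and u: "real_analytic_on u W"
    and pV: "\<And>x. x \<in> W \<Longrightarrow> pd k1 (pd k1 u) x \<in> V"
    and Del: "\<And>x \<alpha> \<beta>. x \<in> W \<Longrightarrow> \<alpha> \<noteq> k1 \<Longrightarrow> \<beta> \<noteq> k1 \<Longrightarrow> Delta k1 \<alpha> \<beta> u x = f \<alpha> \<beta> (x, pd k1 (pd k1 u) x)"
    and ul: "\<And>x. x \<in> W \<Longrightarrow> ?line x \<Longrightarrow> u x = 0 * (x $ k1 - c) + t / 2 * (x $ k1 - c)\<^sup>2"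
    and ul': "\<And>x \<alpha>. x \<in> W \<Longrightarrow> ?line x \<Longrightarrow> \<alpha> \<noteq> k1 \<Longrightarrow>
      pd \<alpha> u x = \<kappa> \<alpha> * (x $ k1 - c) + \<mu> \<alpha> / 2 * (x $ k1 - c)\<^sup>2"
    using sol unfolding cauchy_solution_def c_def by blast+
  define p where "p = pd k1 (pd k1 u)"
  define q where "q i = pd k1 (pd i u)" for i
  have ui: "real_analytic_on (pd i u) W" for i by (intro real_analytic_on_pd u)
  have uij: "real_analytic_on (pd j (pd i u)) W" for i j by (intro real_analytic_on_pd u)
  have p: "real_analytic_on p W" and q: "real_analytic_on (q i) W" for i
    unfolding p_def q_def by (rule uij)+
  have pV: "p x \<in> V" if "x \<in> W" for x using pV[OF that] by (simp add: p_def)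
  have pne: "p x \<noteq> 0" if "x \<in> W" for x using pV[OF that] V by auto
  have c2: "pd i (pd j u) x = pd j (pd i u) x" if "x \<in> W" for i j x
    by (rule pd_commute[OF u W(1) that])
  have c3: "pd l (pd i (pd j u)) x = pd i (pd l (pd j u)) x" if "x \<in> W" for i j l x
    by (rule pd_commute[OF ui W(1) that])
  have c3': "pd l (pd i (pd j u)) x = pd l (pd j (pd i u)) x" if "x \<in> W" for i j l x
    by (rule pd_cong_open[OF W(1) that c2])
  have x0line: "?line x0" by simp
  \<comment> \<open>Along the line u_11 is constantly t and u_{1i} = \<kappa>_i + \<mu>_i (z - c).
    At \<open>x0\<close> this fixes u_111 = 0 and u_{11i} = \<mu>_i, with \<kappa> and \<mu> at free
    disposal.\<close>
  have grad1: "pd k1 u x = 0 + t * (x $ k1 - c)" if x: "x \<in> W" "?line x" for x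
  proof -
    have "pd k1 u x = deriv (\<lambda>z. 0 * (z - c) + t / 2 * (z - c)\<^sup>2) (x $ k1)"
      by (rule pd_along_line[OF W(1) x(1) x(2)[rule_format]], assumption, rule ul)
    then show ?thesis unfolding deriv_quadratic .
  qed
  have p_line: "p x = t" if x: "x \<in> W" "?line x" for x
  proof -
    have "p x = deriv (\<lambda>z. 0 + t * (z - c)) (x $ k1)"
      unfolding p_def by (rule pd_along_line[OF W(1) x(1) x(2)[rule_format]], assumption, rule grad1)
    then show ?thesis unfolding deriv_affine .
  qed
  have q_line: "q i x = \<kappa> i + \<mu> i * (x $ k1 - c)" if x: "x \<in> W" "?line x" and i: "i \<noteq> k1" for x i
  proof -
    have "q i x = deriv (\<lambda>z. \<kappa> i * (z - c) + \<mu> i / 2 * (z - c)\<^sup>2) (x $ k1)"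
      unfolding q_def by (rule pd_along_line[OF W(1) x(1) x(2)[rule_format]], assumption, rule ul'[OF _ _ i])
    then show ?thesis unfolding deriv_quadratic .
  qed
  have p0: "p x0 = t" by (rule p_line[OF W(2) x0line])
  have q0: "q i x0 = \<kappa> i" if "i \<noteq> k1" for i using q_line[OF W(2) x0line that] by (simp add: c_def)
  have tne: "t \<noteq> 0" using pne[OF W(2)] p0 by simp
  have p1: "pd k1 p x0 = 0"
    using pd_along_line[OF W(1,2), of k1 x0 p "\<lambda>_. t"] p_line by simp
  have q1: "pd k1 (q i) x0 = \<mu> i" if i: "i \<noteq> k1" for i
  proof -
    have "pd k1 (q i) x0 = deriv (\<lambda>z. \<kappa> i + \<mu> i * (z - c)) (x0 $ k1)"
      by (rule pd_along_line[OF W(1,2) refl]) (rule q_line[OF _ _ i])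
    then show ?thesis unfolding deriv_affine .
  qed
  have pi: "pd i p x0 = \<mu> i" if i: "i \<noteq> k1" for i
  proof -
    have "pd i p x0 = pd k1 (pd i (pd k1 u)) x0" unfolding p_def by (rule c3[OF W(2)])
    also have "\<dots> = pd k1 (q i) x0" unfolding q_def by (rule c3'[OF W(2)])
    finally show ?thesis using q1[OF i] by simp
  qed
  have han: "real_analytic_on (h i j) (U \<times> V)" if "i \<noteq> k1" "j \<noteq> k1" for i j
    unfolding h_def
    by (intro real_analytic_on_divide fan that real_analytic_on_snd) (use V in auto)
  have hess: "pd i (pd j u) x = h i j (x, p x) + q i x * q j x / p x"
    if x: "x \<in> W" and ij: "i \<noteq> k1" "j \<noteq> k1" for i j x
  proof -
    have "p x * pd i (pd j u) x - q j x * q i x = f i j (x, p x)"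
      using Del[OF x ij] c2[OF x, of i k1] by (simp add: Delta_def p_def q_def)
    then show ?thesis using pne[OF x] by (simp add: h_def field_simps)
  qed
  show "h \<alpha> \<beta> (x0, t) = h \<beta> \<alpha> (x0, t)"
    using hess[OF W(2) idx(1,2)] hess[OF W(2) idx(2,1)] c2[OF W(2), of \<alpha> \<beta>] p0 by (simp add: mult.commute)
  have third: "pd l (pd i (pd j u)) x0 = H i j l + T i j * pd l p x0
      + ((pd l (q i) x0 * \<kappa> j + \<kappa> i * pd l (q j) x0) * t - \<kappa> i * \<kappa> j * pd l p x0) / (t * t)"
    if ij: "i \<noteq> k1" "j \<noteq> k1" for i j l
  proof -
    have hp: "real_analytic_on (\<lambda>x. h i j (x, p x)) W"
    proof (rule real_analytic_on_Pair_compose[OF han[OF ij] _ p])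
      show "real_analytic_on (\<lambda>y. y \<bullet> b) W" if "b \<in> Basis" for b :: "real^'n"
        by (rule real_analytic_on_inner_Basis[OF that])
    qed (use W pV in auto)
    have qq: "real_analytic_on (\<lambda>x. q i x * q j x) W" by (intro real_analytic_on_mult q)
    have qqp: "real_analytic_on (\<lambda>x. q i x * q j x / p x) W"
      by (intro real_analytic_on_divide qq p pne)
    have "pd l (pd i (pd j u)) x0 = pd l (\<lambda>x. h i j (x, p x) + q i x * q j x / p x) x0"
      by (rule pd_cong_open[OF W(1,2) hess[OF _ ij]])
    also have "\<dots> = pd l (\<lambda>x. h i j (x, p x)) x0 + pd l (\<lambda>x. q i x * q j x / p x) x0"
      by (rule pd_add[OF hp qqp W(2)])
    also have "pd l (\<lambda>x. h i j (x, p x)) x0 = H i j l + T i j * pd l p x0"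
    proof -
      have "(x0, p x0) \<in> U \<times> V" using W pV by auto
      from pd_graph[OF han[OF ij] p W(2) this, of l] show ?thesis unfolding p0 H_def T_def .
    qed
    also have "pd l (\<lambda>x. q i x * q j x / p x) x0
        = ((pd l (q i) x0 * \<kappa> j + \<kappa> i * pd l (q j) x0) * t - \<kappa> i * \<kappa> j * pd l p x0) / (t * t)"
      using pd_divide[OF qq p W(2) pne[OF W(2)], of l] pd_mult[OF q q W(2), of l i j]
      unfolding p0 q0[OF ij(1)] q0[OF ij(2)] by simp
    finally show ?thesis by simp
  qed
  \<comment> \<open>The derivative of u_{1i} transversal to the line is u_{li} differentiated in the
    first coordinate, so the formula for u_{li} supplies it; the derivative of u_11 along the line
    drops out.\<close>
  have q_l: "pd l (q i) x0 = H l i k1 + (\<mu> l * \<kappa> i + \<kappa> l * \<mu> i) / t" if li: "l \<noteq> k1" "i \<noteq> k1" for l i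
  proof -
    have "pd l (q i) x0 = pd k1 (pd l (pd i u)) x0" unfolding q_def by (rule c3[OF W(2)])
    also have "\<dots> = H l i k1 + T l i * pd k1 p x0
      + ((pd k1 (q l) x0 * \<kappa> i + \<kappa> l * pd k1 (q i) x0) * t - \<kappa> l * \<kappa> i * pd k1 p x0) / (t * t)"
      by (rule third[OF li])
    also have "\<dots> = H l i k1 + (\<mu> l * \<kappa> i + \<kappa> l * \<mu> i) / t"
      unfolding p1 q1[OF li(1)] q1[OF li(2)] using tne by simp
    finally show ?thesis .
  qed
  \<comment> \<open>Both third derivatives contain \<kappa>_\<alpha> u_{1\<beta>\<gamma>} / t; this
    symmetry cancels it from the final equation.\<close>
  have Z: "pd \<gamma> (q \<beta>) x0 = pd \<beta> (q \<gamma>) x0"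
  proof -
    have "pd \<gamma> (q \<beta>) x0 = pd k1 (pd \<gamma> (pd \<beta> u)) x0" unfolding q_def by (rule c3[OF W(2)])
    also have "\<dots> = pd k1 (pd \<beta> (pd \<gamma> u)) x0" by (rule c3'[OF W(2)])
    also have "\<dots> = pd \<beta> (q \<gamma>) x0" unfolding q_def by (rule c3[OF W(2)])
    finally show ?thesis .
  qed
  have sym3: "pd \<gamma> (pd \<alpha> (pd \<beta> u)) x0 = pd \<beta> (pd \<alpha> (pd \<gamma> u)) x0"
  proof -
    have "pd \<gamma> (pd \<alpha> (pd \<beta> u)) x0 = pd \<alpha> (pd \<gamma> (pd \<beta> u)) x0" by (rule c3[OF W(2)])
    also have "\<dots> = pd \<alpha> (pd \<beta> (pd \<gamma> u)) x0" by (rule c3'[OF W(2)])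
    also have "\<dots> = pd \<beta> (pd \<alpha> (pd \<gamma> u)) x0" by (rule c3[OF W(2)])
    finally show ?thesis .
  qed
  have split: "((A * b + a * C) * t - a * b * m) / (t * t) = A * b / t + a * C / t - a * b * m / t\<^sup>2"
    for A C a b m :: real
    using tne by (simp add: field_simps power2_eq_square)
  show "H \<alpha> \<beta> \<gamma> + T \<alpha> \<beta> * \<mu> \<gamma> + (H \<gamma> \<alpha> k1 + (\<mu> \<gamma> * \<kappa> \<alpha> + \<kappa> \<gamma> * \<mu> \<alpha>) / t) * \<kappa> \<beta> / t - \<kappa> \<alpha> * \<kappa> \<beta> * \<mu> \<gamma> / t\<^sup>2
      = H \<alpha> \<gamma> \<beta> + T \<alpha> \<gamma> * \<mu> \<beta> + (H \<beta> \<alpha> k1 + (\<mu> \<beta> * \<kappa> \<alpha> + \<kappa> \<beta> * \<mu> \<alpha>) / t) * \<kappa> \<gamma> / t - \<kappa> \<alpha> * \<kappa> \<gamma> * \<mu> \<beta> / t\<^sup>2"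
    using sym3 unfolding third[OF idx(1,2)] third[OF idx(1,3)] split pi[OF idx(2)] pi[OF idx(3)] Z
      q_l[OF idx(3,1)] q_l[OF idx(2,1)] by linarith
qed

section \<open>Necessity from special data, sufficiency through the extended matrix g\<close>

theorem theorem1p3:
  fixes k1 :: "'n::finite"
    and f :: "'n \<Rightarrow> 'n \<Rightarrow> (real^'n) \<times> real \<Rightarrow> real"
    and U :: "(real^'n) set" and V :: "real set"
  assumes n: "CARD('n) > 2"
    and UV: "open U" "open V" "connected (U \<times> V)" "0 \<notin> V"
    and fan: "\<And>\<alpha> \<beta>. \<alpha> \<noteq> k1 \<Longrightarrow> \<beta> \<noteq> k1 \<Longrightarrow> real_analytic_on (f \<alpha> \<beta>) (U \<times> V)"
  shows
   "(\<forall>x0\<in>U. \<forall>I a A.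
       open I \<and> x0$k1 \<in> I \<and> real_analytic_on a I \<and>
       (\<forall>\<alpha>. \<alpha> \<noteq> k1 \<longrightarrow> real_analytic_on (A \<alpha>) I) \<and>
       deriv (deriv a) (x0$k1) \<in> V \<longrightarrow>
       (\<exists>u W. cauchy_solution k1 f U V x0 I a A u W \<and>
          (\<forall>v W'. cauchy_solution k1 f U V x0 I a A v W' \<longrightarrow>
             (\<exists>W''. open W'' \<and> x0 \<in> W'' \<and> (\<forall>x\<in>W''. v x = u x)))))
    \<longleftrightarrow>
    (\<exists>g :: 'n \<Rightarrow> 'n \<Rightarrow> real^'n \<Rightarrow> real.
       (\<forall>\<alpha> \<beta>. \<alpha> \<noteq> k1 \<longrightarrow> \<beta> \<noteq> k1 \<longrightarrow>
          real_analytic_on (g \<alpha> \<beta>) U \<and>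
          (\<forall>x\<in>U. \<forall>t\<in>V. f \<alpha> \<beta> (x, t) = g \<alpha> \<beta> x * t) \<and>
          (\<forall>x\<in>U. g \<alpha> \<beta> x = g \<beta> \<alpha> x) \<and>
          (\<forall>x\<in>U. pd k1 (g \<alpha> \<beta>) x = 0) \<and>
          (\<forall>\<gamma>. \<gamma> \<noteq> k1 \<longrightarrow> (\<forall>x\<in>U. pd \<gamma> (g \<alpha> \<beta>) x = pd \<beta> (g \<alpha> \<gamma>) x))))"
proof (rule iffI, goal_cases)
  case 1
  note L = this
  show ?case
  \<comment> \<open>For empty \<open>V\<close> the Cauchy condition is vacuous and the zero matrix
    serves. Otherwise a fixed \<open>t0\<close> in \<open>V\<close> defines the matrix as f(x, t0) /
    t0.\<close>
  proof (cases "V = {}")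
    case True
    then show ?thesis
      by (intro exI[of _ "\<lambda>_ _ _. 0"]) (simp add: pd_const real_analytic_on_const)
  next
    case False
    then obtain t0 where t0: "t0 \<in> V" by blast
    define h where "h = (\<lambda>\<alpha> \<beta> p. f \<alpha> \<beta> p / snd p)"
    have han: "real_analytic_on (h \<alpha> \<beta>) (U \<times> V)" if "\<alpha> \<noteq> k1" "\<beta> \<noteq> k1" for \<alpha> \<beta>
      unfolding h_def
      by (intro real_analytic_on_divide fan that real_analytic_on_snd) (use UV in auto)
    have ex: "\<exists>u W. cauchy_solution k1 f U V x0 UNIV
        (\<lambda>z. 0 * (z - x0 $ k1) + t / 2 * (z - x0 $ k1)\<^sup>2)
        (\<lambda>\<alpha> z. \<kappa> \<alpha> * (z - x0 $ k1) + \<mu> \<alpha> / 2 * (z - x0 $ k1)\<^sup>2) u W"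
      if x0: "x0 \<in> U" and t: "t \<in> V" for x0 t \<kappa> \<mu>
    proof -
      have an: "real_analytic_on (\<lambda>z. \<kappa> * (z - c) + \<mu> / 2 * (z - c)\<^sup>2) UNIV" for \<kappa> \<mu> c :: real
        unfolding power2_eq_square
        by (intro real_analytic_intros real_analytic_on_id_real)
      let ?a = "\<lambda>z. 0 * (z - x0 $ k1) + t / 2 * (z - x0 $ k1)\<^sup>2"
      let ?A = "\<lambda>\<alpha> z. \<kappa> \<alpha> * (z - x0 $ k1) + \<mu> \<alpha> / 2 * (z - x0 $ k1)\<^sup>2"
      have "deriv (deriv ?a) (x0 $ k1) \<in> V"
        unfolding deriv_quadratic deriv_affine by (rule t)
      then have "open UNIV \<and> x0 $ k1 \<in> UNIV \<and> real_analytic_on ?a UNIV \<and>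
          (\<forall>\<alpha>. \<alpha> \<noteq> k1 \<longrightarrow> real_analytic_on (?A \<alpha>) UNIV) \<and> deriv (deriv ?a) (x0 $ k1) \<in> V"
        by (intro conjI allI impI an open_UNIV UNIV_I)
      from L[THEN bspec, OF x0, THEN spec, THEN spec, THEN spec, THEN mp, OF this]
      show ?thesis by (elim exE conjE) (intro exI)
    qed
    have ic: "h \<alpha> \<beta> (x, t) = h \<beta> \<alpha> (x, t)"
      "pd \<gamma> (\<lambda>y. h \<alpha> \<beta> (y, t)) x + deriv (\<lambda>\<tau>. h \<alpha> \<beta> (x, \<tau>)) t * \<mu> \<gamma>
          + (pd k1 (\<lambda>y. h \<gamma> \<alpha> (y, t)) x + (\<mu> \<gamma> * \<kappa> \<alpha> + \<kappa> \<gamma> * \<mu> \<alpha>) / t) * \<kappa> \<beta> / t - \<kappa> \<alpha> * \<kappa> \<beta> * \<mu> \<gamma> / t\<^sup>2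
        = pd \<beta> (\<lambda>y. h \<alpha> \<gamma> (y, t)) x + deriv (\<lambda>\<tau>. h \<alpha> \<gamma> (x, \<tau>)) t * \<mu> \<beta>
          + (pd k1 (\<lambda>y. h \<beta> \<alpha> (y, t)) x + (\<mu> \<beta> * \<kappa> \<alpha> + \<kappa> \<beta> * \<mu> \<alpha>) / t) * \<kappa> \<gamma> / t - \<kappa> \<alpha> * \<kappa> \<gamma> * \<mu> \<beta> / t\<^sup>2"
      if idx: "\<alpha> \<noteq> k1" "\<beta> \<noteq> k1" "\<gamma> \<noteq> k1" and x: "x \<in> U" and t: "t \<in> V" for \<alpha> \<beta> \<gamma> x t \<kappa> \<mu>
    proof -
      obtain u W where sol: "cauchy_solution k1 f U V x UNIV
          (\<lambda>z. 0 * (z - x $ k1) + t / 2 * (z - x $ k1)\<^sup>2)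
          (\<lambda>\<alpha> z. \<kappa> \<alpha> * (z - x $ k1) + \<mu> \<alpha> / 2 * (z - x $ k1)\<^sup>2) u W"
        using ex[OF x t, of \<kappa> \<mu>] by (elim exE)
      note * = integrability_condition[where f = f and \<kappa> = \<kappa> and \<mu> = \<mu>, OF UV(4) fan sol idx]
      show "h \<alpha> \<beta> (x, t) = h \<beta> \<alpha> (x, t)" unfolding h_def by (rule *(1))
      show "pd \<gamma> (\<lambda>y. h \<alpha> \<beta> (y, t)) x + deriv (\<lambda>\<tau>. h \<alpha> \<beta> (x, \<tau>)) t * \<mu> \<gamma>
          + (pd k1 (\<lambda>y. h \<gamma> \<alpha> (y, t)) x + (\<mu> \<gamma> * \<kappa> \<alpha> + \<kappa> \<gamma> * \<mu> \<alpha>) / t) * \<kappa> \<beta> / t - \<kappa> \<alpha> * \<kappa> \<beta> * \<mu> \<gamma> / t\<^sup>2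
        = pd \<beta> (\<lambda>y. h \<alpha> \<gamma> (y, t)) x + deriv (\<lambda>\<tau>. h \<alpha> \<gamma> (x, \<tau>)) t * \<mu> \<beta>
          + (pd k1 (\<lambda>y. h \<beta> \<alpha> (y, t)) x + (\<mu> \<beta> * \<kappa> \<alpha> + \<kappa> \<beta> * \<mu> \<alpha>) / t) * \<kappa> \<gamma> / t - \<kappa> \<alpha> * \<kappa> \<gamma> * \<mu> \<beta> / t\<^sup>2"
        unfolding h_def by (rule *(2))
    qed
    have sym: "h \<alpha> \<beta> (x, t) = h \<beta> \<alpha> (x, t)"
      if "\<alpha> \<noteq> k1" "\<beta> \<noteq> k1" "x \<in> U" "t \<in> V" for \<alpha> \<beta> x t
      by (rule ic(1)[OF that(1,2,1,3,4)])
    have comp: "pd \<gamma> (\<lambda>y. h \<alpha> \<beta> (y, t)) x = pd \<beta> (\<lambda>y. h \<alpha> \<gamma> (y, t)) x"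
      if "\<alpha> \<noteq> k1" "\<beta> \<noteq> k1" "\<gamma> \<noteq> k1" "x \<in> U" "t \<in> V" for \<alpha> \<beta> \<gamma> x t
      using ic(2)[OF that, of "\<lambda>_. 0" "\<lambda>_. 0"] by simp
    \<comment> \<open>More than two indices leave a choice besides \<open>k1\<close> and
      \<beta>.\<close>
    have third_index: "\<exists>\<gamma>. \<gamma> \<noteq> k1 \<and> \<gamma> \<noteq> \<beta>" for \<beta>
    proof (rule ccontr)
      assume "\<nexists>\<gamma>. \<gamma> \<noteq> k1 \<and> \<gamma> \<noteq> \<beta>"
      then have "(UNIV :: 'n set) \<subseteq> {k1, \<beta>}" by auto
      then have "CARD('n) \<le> card {k1, \<beta>}" by (intro card_mono) auto
      also have "\<dots> \<le> 2" by (simp add: card_insert_if)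
      finally show False using n by simp
    qed
    \<comment> \<open>With \<kappa> = 0 and \<mu> the indicator of \<gamma>, the integrability
      condition reduces, modulo \<open>comp\<close>, to the vanishing of the t-derivative of
      h_{\<alpha>\<beta>}.\<close>
    have t_free: "deriv (\<lambda>\<tau>. h \<alpha> \<beta> (x, \<tau>)) t = 0"
      if "\<alpha> \<noteq> k1" "\<beta> \<noteq> k1" "x \<in> U" "t \<in> V" for \<alpha> \<beta> x t
    proof -
      obtain \<gamma> where \<gamma>: "\<gamma> \<noteq> k1" "\<gamma> \<noteq> \<beta>" using third_index by blast
      show ?thesis
        using ic(2)[OF that(1,2) \<gamma>(1) that(3,4), of "\<lambda>i. if i = \<gamma> then 1 else 0" "\<lambda>_. 0"]
          comp[OF that(1,2) \<gamma>(1) that(3,4)] \<gamma>(2) by simp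
    qed
    \<comment> \<open>Now \<mu> = 0 and \<kappa> is the indicator of \<gamma>: the only surviving
      term besides those of \<open>comp\<close> is the first-coordinate derivative of
      h_{\<beta>\<alpha>}, divided by t.\<close>
    have k1_free: "pd k1 (\<lambda>y. h \<beta> \<alpha> (y, t)) x = 0"
      if "\<alpha> \<noteq> k1" "\<beta> \<noteq> k1" "x \<in> U" "t \<in> V" for \<alpha> \<beta> x t
    proof -
      obtain \<gamma> where \<gamma>: "\<gamma> \<noteq> k1" "\<gamma> \<noteq> \<beta>" using third_index by blast
      have "t \<noteq> 0" using that UV by auto
      then show ?thesis
        using ic(2)[OF that(1,2) \<gamma>(1) that(3,4), of "\<lambda>_. 0" "\<lambda>i. if i = \<gamma> then 1 else 0"]
          comp[OF that(1,2) \<gamma>(1) that(3,4)] \<gamma>(2) by simp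
    qed
    \<comment> \<open>A vanishing t-derivative makes h independent of t only on a connected set;
      \<open>V\<close> is the projection of the connected product when \<open>U\<close> has a
      point.\<close>
    have "connected (snd ` (U \<times> V))"
      by (intro connected_continuous_image UV continuous_on_snd continuous_on_id)
    then have V_conn: "connected V" if "x \<in> U" for x using that by (auto simp: snd_image_times split: if_splits)
    have const: "h \<alpha> \<beta> (x, t) = h \<alpha> \<beta> (x, t0)"
      if ab: "\<alpha> \<noteq> k1" "\<beta> \<noteq> k1" and x: "x \<in> U" and t: "t \<in> V" for \<alpha> \<beta> x t
    proof (rule has_derivative_zero_unique_connected[OF UV(2) V_conn[OF x] _ t t0])
      fix \<tau> assume \<tau>: "\<tau> \<in> V"
      have "real_analytic_on (\<lambda>\<tau>. h \<alpha> \<beta> (x, \<tau>)) V"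
        by (rule real_analytic_on_Pair_compose[OF han[OF ab] real_analytic_on_const real_analytic_on_id_real])
          (use x in auto)
      from real_analytic_on_DERIV[OF this \<tau>]
      show "((\<lambda>\<tau>. h \<alpha> \<beta> (x, \<tau>)) has_derivative (\<lambda>_. 0)) (at \<tau>)"
        unfolding t_free[OF ab x \<tau>] has_field_derivative_def
        by (rule has_derivative_eq_rhs) (simp add: fun_eq_iff)
    qed
    show ?thesis
    proof (intro exI[of _ "\<lambda>\<alpha> \<beta> x. h \<alpha> \<beta> (x, t0)"] allI impI conjI ballI)
      fix \<alpha> \<beta> assume ab: "\<alpha> \<noteq> k1" "\<beta> \<noteq> k1"
      show "real_analytic_on (\<lambda>x. h \<alpha> \<beta> (x, t0)) U"
        by (rule real_analytic_on_Pair_compose[OF han[OF ab] real_analytic_on_inner_Basis real_analytic_on_const])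
          (use t0 in auto)
      fix x assume x: "x \<in> U"
      show "f \<alpha> \<beta> (x, t) = h \<alpha> \<beta> (x, t0) * t" if t: "t \<in> V" for t
      proof -
        have "t \<noteq> 0" using t UV(4) by auto
        then have "f \<alpha> \<beta> (x, t) = h \<alpha> \<beta> (x, t) * t" by (simp add: h_def)
        then show ?thesis by (simp only: const[OF ab x t])
      qed
      show "h \<alpha> \<beta> (x, t0) = h \<beta> \<alpha> (x, t0)" by (rule sym[OF ab x t0])
      show "pd k1 (\<lambda>x. h \<alpha> \<beta> (x, t0)) x = 0" by (rule k1_free[OF ab(2,1) x t0])
      show "pd \<gamma> (\<lambda>x. h \<alpha> \<beta> (x, t0)) x = pd \<beta> (\<lambda>x. h \<alpha> \<gamma> (x, t0)) x" if "\<gamma> \<noteq> k1" for \<gamma>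
        by (rule comp[OF ab that x t0])
    qed
  qed
next
  case 2
  then obtain g0 where G: "\<forall>\<alpha> \<beta>. \<alpha> \<noteq> k1 \<longrightarrow> \<beta> \<noteq> k1 \<longrightarrow>
      real_analytic_on (g0 \<alpha> \<beta>) U \<and>
      (\<forall>x\<in>U. \<forall>t\<in>V. f \<alpha> \<beta> (x, t) = g0 \<alpha> \<beta> x * t) \<and>
      (\<forall>x\<in>U. g0 \<alpha> \<beta> x = g0 \<beta> \<alpha> x) \<and>
      (\<forall>x\<in>U. pd k1 (g0 \<alpha> \<beta>) x = 0) \<and>
      (\<forall>\<gamma>. \<gamma> \<noteq> k1 \<longrightarrow> (\<forall>x\<in>U. pd \<gamma> (g0 \<alpha> \<beta>) x = pd \<beta> (g0 \<alpha> \<gamma>) x))"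
    by (elim exE)
  then have g0: "\<And>\<alpha> \<beta>. \<alpha> \<noteq> k1 \<Longrightarrow> \<beta> \<noteq> k1 \<Longrightarrow> real_analytic_on (g0 \<alpha> \<beta>) U"
    "\<And>\<alpha> \<beta> x t. \<alpha> \<noteq> k1 \<Longrightarrow> \<beta> \<noteq> k1 \<Longrightarrow> x \<in> U \<Longrightarrow> t \<in> V \<Longrightarrow> f \<alpha> \<beta> (x, t) = g0 \<alpha> \<beta> x * t"
    "\<And>\<alpha> \<beta> x. \<alpha> \<noteq> k1 \<Longrightarrow> \<beta> \<noteq> k1 \<Longrightarrow> x \<in> U \<Longrightarrow> g0 \<alpha> \<beta> x = g0 \<beta> \<alpha> x"
    "\<And>\<alpha> \<beta> x. \<alpha> \<noteq> k1 \<Longrightarrow> \<beta> \<noteq> k1 \<Longrightarrow> x \<in> U \<Longrightarrow> pd k1 (g0 \<alpha> \<beta>) x = 0"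
    "\<And>\<alpha> \<beta> \<gamma> x. \<alpha> \<noteq> k1 \<Longrightarrow> \<beta> \<noteq> k1 \<Longrightarrow> \<gamma> \<noteq> k1 \<Longrightarrow> x \<in> U \<Longrightarrow>
      pd \<gamma> (g0 \<alpha> \<beta>) x = pd \<beta> (g0 \<alpha> \<gamma>) x"
    by blast+
  \<comment> \<open>The hypotheses concern indices other than \<open>k1\<close> only. Extension by
    zero keeps symmetry, and compatibility with an index \<open>k1\<close> becomes the condition
    that g does not depend on the first coordinate.\<close>
  define g where "g \<alpha> \<beta> = (if \<alpha> = k1 \<or> \<beta> = k1 then (\<lambda>_. 0) else g0 \<alpha> \<beta>)" for \<alpha> \<beta>
  have g_an: "real_analytic_on (g i j) U" for i j
    using g0(1) by (simp add: g_def real_analytic_on_const)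
  have g_sym: "g i j x = g j i x" if "x \<in> U" for i j x
    using g0(3)[of i j x] that by (simp add: g_def)
  have g_comp: "pd l (g i j) x = pd j (g i l) x" if x: "x \<in> U" for i j l x
    using g0(4)[of i j x] g0(4)[of i l x] g0(5)[of i j l x] x by (simp add: g_def pd_const)
  have fg: "f \<alpha> \<beta> (x, t) = g \<alpha> \<beta> x * t" if "\<alpha> \<noteq> k1" "\<beta> \<noteq> k1" "x \<in> U" "t \<in> V" for \<alpha> \<beta> x t
    using g0(2) that by (simp add: g_def)
  have g_k1: "g k1 j x = 0" for j x by (simp add: g_def)
  show ?case
  proof (intro ballI allI impI, elim conjE)
    fix x0 I a A
    assume x0: "x0 \<in> U" and I: "open I" "x0 $ k1 \<in> I" and a: "real_analytic_on a I"
      and A: "\<forall>\<alpha>. \<alpha> \<noteq> k1 \<longrightarrow> real_analytic_on (A \<alpha>) I"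
      and a2: "deriv (deriv a) (x0 $ k1) \<in> V"
    show "\<exists>u W. cauchy_solution k1 f U V x0 I a A u W \<and>
          (\<forall>v W'. cauchy_solution k1 f U V x0 I a A v W' \<longrightarrow>
             (\<exists>W''. open W'' \<and> x0 \<in> W'' \<and> (\<forall>x\<in>W''. v x = u x)))"
      using A by (intro cauchy_problem_well_posed[OF UV(1) x0 UV(2,4) g_an g_sym g_comp g_k1 fg I a _ a2]) auto
  qed
qed

end
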